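(* Let $K\in\mathbb{R}^{d\times d}$ be symmetric, $f(q)=q\cdot Kq-\operatorname{Tr}K$, and $f_1(q)=q\cdot K_1q-\operatorname{Tr}K$ with $K_1=\frac{\operatorname{Tr}K}{d}I$. Then $$\min_{J^T=-J}\Big(\lim_{\mu\to\infty}\sigma_f^2(\mu,J)\Big)=\sigma_{f_1}^2(0),$$ where the minimum is over all antisymmetric $J\in\mathbb{R}^{d\times d}$.
   Context: For a skew-symmetric $J\in\mathbb{R}^{d\times d}$, $\gamma>0$ (fixed), $\mu\in\mathbb{R}$ and a standard $d$-dimensional Brownian motion $W$, consider on $\mathbb{R}^{2d}$ $$\mathrm{d}q_t=p_t\,\mathrm{d}t-\mu Jq_t\,\mathrm{d}t,\qquad \mathrm{d}p_t=-q_t\,\mathrm{d}t-\mu Jp_t\,\mathrm{d}t-\gamma p_t\,\mathrm{d}t+\sqrt{2\gamma}\,\mathrm{d}W_t .$$ It is ergodic with invariant measure $\widehat\pi=\mathcal{N}(0,I_{2d})$, whose $q$-marginal is $\pi=\mathcal{N}(0,I_d)$. Let $\mathcal{L}$ be the generator of its Markov semigroup on $L^2(\widehat\pi)$. For $f\in L^2(\pi)$ with $\pi(f)=0$, regarded as a function of $(q,p)$ depending on $q$ only, the asymptotic variance is $\sigma_f^2(\mu,J)=\langle\chi,f\rangle_{L^2(\widehat\pi)}$, where $\chi\in\mathcal{D}(\mathcal{L})$ is the unique solution of $-\mathcal{L}\chi=f$, $\widehat\pi(\chi)=0$. $\sigma_f^2(0)$ denotes the value at $\mu=0$ (independent of $J$).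 *)

theory Defs
  imports "HOL-Probability.Probability"
begin

text \<open>The law $N(0, v I)$ on a Euclidean space, for \<open>v > 0\<close>.\<close>

definition gaussian :: "real \<Rightarrow> 'a::euclidean_space measure" where
  "gaussian v = density lborel
     (\<lambda>x. ennreal ((2 * pi * v) powr (- (real DIM('a) / 2)) * exp (- (norm x)\<^sup>2 / (2 * v))))"

definition brownian_motion :: "'w measure \<Rightarrow> (real \<Rightarrow> 'w \<Rightarrow> 'a::euclidean_space) \<Rightarrow> bool" where
  "brownian_motion M W \<longleftrightarrow>
     prob_space M \<and>
     (\<forall>t\<ge>0. W t \<in> borel_measurable M) \<and>
     (AE \<omega> in M. W 0 \<omega> = 0) \<and>
     (\<forall>s t. 0 \<le> s \<and> s < t \<longrightarrow> distr M borel (\<lambda>\<omega>. W t \<omega> - W s \<omega>) = gaussian (t - s)) \<and>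
     (\<forall>\<tau>::nat \<Rightarrow> real. 0 \<le> \<tau> 0 \<and> incseq \<tau> \<longrightarrow>
        prob_space.indep_vars M (\<lambda>_. borel) (\<lambda>i \<omega>. W (\<tau> (Suc i)) \<omega> - W (\<tau> i) \<omega>) UNIV) \<and>
     (AE \<omega> in M. continuous_on {0..} (\<lambda>t. W t \<omega>))"

definition skew_symmetric :: "real^'n^'n \<Rightarrow> bool" where
  "skew_symmetric J \<longleftrightarrow> transpose J = - J"

text \<open>
  \<open>X\<close> is a continuous process solving
  $dq = p\,dt - \mu J q\,dt$, $dp = -q\,dt - \mu J p\,dt - \gamma p\,dt + \sqrt{2\gamma}\,dW$
  with initial value \<open>z\<close>; a state is a pair \<open>(q, p)\<close>.  The diffusion coefficient is constant, so
  the stochastic integral is \<open>sqrt (2 * \<gamma>) *\<^sub>R W t\<close> and the equation can be written in its integrated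
  form path by path.  At \<open>t = 0\<close> this says \<open>X 0 = z\<close> almost surely.
\<close>

definition langevin_solution ::
  "'w measure \<Rightarrow> (real \<Rightarrow> 'w \<Rightarrow> real^'n) \<Rightarrow> real \<Rightarrow> real \<Rightarrow> real^'n^'n \<Rightarrow> (real^'n) \<times> (real^'n)
     \<Rightarrow> (real \<Rightarrow> 'w \<Rightarrow> (real^'n) \<times> (real^'n)) \<Rightarrow> bool" where
  "langevin_solution M W \<gamma> \<mu> J z X \<longleftrightarrow>
     (\<forall>t\<ge>0. X t \<in> borel_measurable M) \<and>
     (AE \<omega> in M.
        continuous_on {0..} (\<lambda>t. X t \<omega>) \<and>
        (\<forall>t\<ge>0.
           ((\<lambda>s. snd (X s \<omega>) - \<mu> *\<^sub>R (J *v fst (X s \<omega>)))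
              has_integral (fst (X t \<omega>) - fst z)) {0..t} \<and>
           ((\<lambda>s. - fst (X s \<omega>) - \<mu> *\<^sub>R (J *v snd (X s \<omega>)) - \<gamma> *\<^sub>R snd (X s \<omega>))
              has_integral (snd (X t \<omega>) - snd z - sqrt (2 * \<gamma>) *\<^sub>R W t \<omega>)) {0..t}))"

definition square_integrable :: "'a measure \<Rightarrow> ('a \<Rightarrow> real) \<Rightarrow> bool" where
  "square_integrable N g \<longleftrightarrow> g \<in> borel_measurable N \<and> integrable N (\<lambda>x. (g x)\<^sup>2)"

text \<open>In the following, \<open>Y z\<close> is the process started at \<open>z\<close>.\<close>

definition markov_semigroup ::
  "'w measure \<Rightarrow> ('a \<Rightarrow> real \<Rightarrow> 'w \<Rightarrow> 'a) \<Rightarrow> real \<Rightarrow> ('a \<Rightarrow> real) \<Rightarrow> 'a \<Rightarrow> real" where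
  "markov_semigroup M Y t g z = (\<integral>\<omega>. g (Y z t \<omega>) \<partial>M)"

text \<open>
  The graph of the \<open>L\<^sup>2(N)\<close> generator: \<open>\<phi>\<close> lies in its domain, with image (the class of) \<open>g\<close>.
  The squared \<open>L\<^sup>2\<close> distance is a nonnegative integral, so that a difference quotient outside
  \<open>L\<^sup>2\<close> has distance \<open>\<infinity>\<close>, not \<open>0\<close>.
\<close>

definition generator_graph ::
  "'w measure \<Rightarrow> 'a measure \<Rightarrow> ('a \<Rightarrow> real \<Rightarrow> 'w \<Rightarrow> 'a) \<Rightarrow> ('a \<Rightarrow> real) \<Rightarrow> ('a \<Rightarrow> real) \<Rightarrow> bool" where
  "generator_graph M N Y \<phi> g \<longleftrightarrow>
     square_integrable N \<phi> \<and> square_integrable N g \<and>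
     ((\<lambda>t. \<integral>\<^sup>+z. ennreal (((markov_semigroup M Y t \<phi> z - \<phi> z) / t - g z)\<^sup>2) \<partial>N) \<longlongrightarrow> 0) (at_right 0)"

definition poisson_solution ::
  "'w measure \<Rightarrow> 'a measure \<Rightarrow> ('a \<Rightarrow> real \<Rightarrow> 'w \<Rightarrow> 'a) \<Rightarrow> ('a \<Rightarrow> real) \<Rightarrow> ('a \<Rightarrow> real) \<Rightarrow> bool" where
  "poisson_solution M N Y f \<phi> \<longleftrightarrow>
     generator_graph M N Y \<phi> (\<lambda>z. - f z) \<and> (\<integral>z. \<phi> z \<partial>N) = 0"

text \<open>
  The observable \<open>f\<close> depends on \<open>q\<close> only.  The solution \<open>\<phi>\<close> is unique as an element of \<open>L\<^sup>2\<close>; the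
  choice operator picks one of its representatives, on which the integral does not depend.
\<close>

definition asymptotic_variance ::
  "'w measure \<Rightarrow> ((real^'n) \<times> (real^'n) \<Rightarrow> real \<Rightarrow> 'w \<Rightarrow> (real^'n) \<times> (real^'n))
     \<Rightarrow> (real^'n \<Rightarrow> real) \<Rightarrow> real" where
  "asymptotic_variance M Y f =
     (let \<phi> = (SOME \<phi>. poisson_solution M (gaussian 1) Y (\<lambda>z. f (fst z)) \<phi>)
      in \<integral>z. \<phi> z * f (fst z) \<partial>gaussian 1)"

end

theory Submission imports Defs begin

text \<open>
  On quadratic functions the generator acts by linear algebra.  Writing a quadratic \<open>\<chi>\<close> in blocks
  \<open>X\<close>, \<open>Y\<close>, \<open>Z\<close> and \<open>D = [J, _]\<close>, which is antisymmetric for the Frobenius inner product, the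
  Poisson equation becomes \<open>\<mu> D X - 2 Y = - K\<close>, \<open>\<mu> D Y + X - \<gamma> Y - Z = 0\<close>,
  \<open>\<mu> D Z + 2 Y - 2 \<gamma> Z = 0\<close>, and the asymptotic variance is \<open>2 \<langle>K, X\<rangle>\<close>.  Split \<open>K = K0 + D S\<close>
  with \<open>D K0 = 0\<close>.  The part \<open>K0\<close> contributes \<open>(\<gamma> + 1 / \<gamma>) |K0|\<^sup>2\<close> for every \<open>\<mu>\<close>, and an energy
  estimate shows that \<open>D S\<close> contributes \<open>O(1 / \<mu>\<^sup>2)\<close>.  Since \<open>K0\<close> has the trace of \<open>K\<close>, the limit is
  smallest when \<open>K0\<close> is a multiple of the identity.  This is attained: a symmetric traceless matrix has zero
  diagonal in some orthonormal basis, and is then the commutator of an antisymmetric matrix with a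
  diagonal one.

  Any solution of the Poisson equation in \<open>L\<^sup>2\<close>, quadratic or not, has the same inner product
  with \<open>f\<close>: this follows by duality from the quadratic solution of the adjoint equation.
  The adjoint semigroup is the semigroup with \<open>\<mu>\<close> and the sign of the positions reversed.  This, and the
  invariance of the Gaussian, is proved for a splitting scheme whose single step is part of an
  orthogonal map, so that it is exactly reversible, and which converges pathwise to the solution.
\<close>

section \<open>Gaussian measures\<close>

text \<open>The variance is defined through a choice among all L^2 solutions, for processes given as
  almost sure solutions from each fixed starting point. Regularity in the starting point and
  uniqueness for the Poisson equation are not assumed. Linearity and additive noise replace them:
  solutions with the same noise differ by a deterministic linear flow, so the semigroup averages
  translates of a function over one law, and the moments of that law are read off from invariance.
  The factor \<gamma> + 1/\<gamma> comes from the block equations without commutators: Y = K/2, Z =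
  Y/\<gamma>, X = \<gamma> Y + Z. In the energy estimate, pairing the three equations with X, Y and
  Z removes D and leaves <K, X> = 2 \<gamma> (|Y|^2 + |Z|^2). The minimisation is Cauchy-Schwarz
  against the identity: |K0|^2 \<ge> (Tr K)^2 / d = |K1|^2.\<close>

lemma linear_borel_measurable:
  fixes f :: "'a::euclidean_space \<Rightarrow> 'b::euclidean_space"
  shows "linear f \<Longrightarrow> f \<in> borel_measurable borel"
  by (simp add: borel_measurable_continuous_onI linear_continuous_on linear_conv_bounded_linear)

lemma borel_measurable_fst_snd [measurable]:
  "(fst :: 'a::euclidean_space \<times> 'b::euclidean_space \<Rightarrow> 'a) \<in> borel_measurable borel"
  "(snd :: 'a::euclidean_space \<times> 'b::euclidean_space \<Rightarrow> 'b) \<in> borel_measurable borel"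
  by (auto intro!: borel_measurable_continuous_onI continuous_intros)

lemma sets_gaussian [measurable_cong, simp]: "sets (gaussian v) = sets borel"
  by (simp add: gaussian_def)

lemma space_gaussian [simp]: "space (gaussian v) = UNIV"
  by (simp add: gaussian_def)

text \<open>The radial definition is matched to the one-dimensional \<open>normal_density\<close>,
  so that integrals of products over coordinates factor.\<close>

lemma gaussian_density_eq_prod:
  fixes x :: "'a::euclidean_space"
  assumes "v > 0"
  shows "(2 * pi * v) powr (- (real DIM('a) / 2)) * exp (- (norm x)\<^sup>2 / (2 * v))
           = (\<Prod>b\<in>Basis. normal_density 0 (sqrt v) (x \<bullet> b))"
proof -
  have "(\<Prod>b\<in>(Basis::'a set). normal_density 0 (sqrt v) (x \<bullet> b))
      = (1 / sqrt (2 * pi * v)) ^ DIM('a) * exp (\<Sum>b\<in>(Basis::'a set). - (x \<bullet> b)\<^sup>2 / (2 * v))"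
  proof -
    have "normal_density 0 (sqrt v) y = 1 / sqrt (2 * pi * v) * exp (- y\<^sup>2 / (2 * v))" for y
      using assms by (simp add: normal_density_def)
    then show ?thesis by (simp only: prod.distrib exp_sum[OF finite_Basis] prod_constant)
  qed
  moreover have "(1 / sqrt (2 * pi * v)) ^ DIM('a) = (2 * pi * v) powr (- (real DIM('a) / 2))"
  proof -
    have "1 / sqrt (2 * pi * v) = (2 * pi * v) powr (- (1 / 2))"
      using assms powr_half_sqrt[of "2 * pi * v"] by (simp only: powr_minus) (simp add: inverse_eq_divide)
    then have "(1 / sqrt (2 * pi * v)) ^ DIM('a) = ((2 * pi * v) powr (- (1 / 2))) powr real DIM('a)"
      using assms powr_realpow[of "(2 * pi * v) powr (- (1 / 2))" "DIM('a)"] by simp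
    then show ?thesis by (simp only: powr_powr) simp
  qed
  moreover have "(\<Sum>b\<in>(Basis::'a set). - (x \<bullet> b)\<^sup>2 / (2 * v)) = - (norm x)\<^sup>2 / (2 * v)"
    unfolding power2_norm_eq_inner euclidean_inner[of x x]
    by (simp add: power2_eq_square sum_negf flip: sum_divide_distrib)
  ultimately show ?thesis by simp
qed

lemma nn_integral_gaussian:
  fixes f :: "'a::euclidean_space \<Rightarrow> ennreal"
  assumes "v > 0" and [measurable]: "f \<in> borel_measurable borel"
  shows "(\<integral>\<^sup>+x. f x \<partial>gaussian v) =
    (\<integral>\<^sup>+x. ennreal ((2 * pi * v) powr (- (real DIM('a) / 2)) * exp (- (norm x)\<^sup>2 / (2 * v))) * f x \<partial>lborel)"
  unfolding gaussian_def by (subst nn_integral_density) auto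

lemma nn_integral_gaussian_prod:
  fixes f :: "'a::euclidean_space \<Rightarrow> real \<Rightarrow> ennreal"
  assumes v: "v > 0" and [measurable]: "\<And>b. b \<in> Basis \<Longrightarrow> f b \<in> borel_measurable borel"
  shows "(\<integral>\<^sup>+x. (\<Prod>b\<in>Basis. f b (x \<bullet> b)) \<partial>gaussian v)
       = (\<Prod>b\<in>Basis. \<integral>\<^sup>+x. ennreal (normal_density 0 (sqrt v) x) * f b x \<partial>lborel)"
proof -
  have "(\<integral>\<^sup>+x. (\<Prod>b\<in>Basis. f b (x \<bullet> b)) \<partial>gaussian v)
      = (\<integral>\<^sup>+x. (\<Prod>b\<in>Basis. ennreal (normal_density 0 (sqrt v) (x \<bullet> b)) * f b (x \<bullet> b)) \<partial>lborel)"
    using v by (subst nn_integral_gaussian)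
      (simp_all only: gaussian_density_eq_prod prod_ennreal[symmetric] prod.distrib normal_density_nonneg,
       measurable)
  also have "\<dots> = (\<Prod>b\<in>Basis. \<integral>\<^sup>+x. ennreal (normal_density 0 (sqrt v) x) * f b x \<partial>lborel)"
    by (subst nn_integral_lborel_prod) auto
  finally show ?thesis .
qed

lemma nn_integral_normal_density:
  "v > 0 \<Longrightarrow> (\<integral>\<^sup>+x. ennreal (normal_density 0 (sqrt v) x) \<partial>lborel) = 1"
  by (subst nn_integral_eq_integral) auto

lemma prob_space_gaussian:
  assumes "v > 0"
  shows "prob_space (gaussian v :: 'a::euclidean_space measure)"
proof
  have "(\<integral>\<^sup>+x. (\<Prod>b\<in>(Basis::'a set). 1) \<partial>(gaussian v :: 'a measure)) = (1::ennreal)"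
    using nn_integral_gaussian_prod[OF assms, of "\<lambda>(_::'a) _. 1", OF borel_measurable_const] assms
    by (simp only: mult_1_right prod.neutral_const nn_integral_normal_density)
  then show "emeasure (gaussian v :: 'a measure) (space (gaussian v)) = 1"
    by (simp only: nn_integral_const mult_1_left prod.neutral_const)
qed

text \<open>Squared norm and dimension are both additive over a pair, so the densities multiply.
  This gives Fubini for two independent copies, and for a phase point together with its
  noise.\<close>

lemma gaussian_pair:
  fixes v :: real
  assumes "v > 0"
  shows "(gaussian v :: ('a::euclidean_space \<times> 'b::euclidean_space) measure) = gaussian v \<Otimes>\<^sub>M gaussian v"
proof -
  interpret A: prob_space "gaussian v :: 'a measure" by (rule prob_space_gaussian[OF assms])
  interpret B: prob_space "gaussian v :: 'b measure" by (rule prob_space_gaussian[OF assms])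
  have "gaussian v \<Otimes>\<^sub>M gaussian v =
    density (lborel \<Otimes>\<^sub>M lborel) (\<lambda>(x::'a, y::'b).
      ennreal ((2 * pi * v) powr (- (real DIM('a) / 2)) * exp (- (norm x)\<^sup>2 / (2 * v))) *
      ennreal ((2 * pi * v) powr (- (real DIM('b) / 2)) * exp (- (norm y)\<^sup>2 / (2 * v))))"
    unfolding gaussian_def
    by (rule pair_measure_density)
      (use B.sigma_finite_measure_axioms in \<open>auto simp: gaussian_def intro: sigma_finite_lborel\<close>)
  also have "\<dots> = gaussian v"
    unfolding gaussian_def lborel_prod
  proof (rule density_cong)
    show "AE x in lborel. (case x of (x::'a, y::'b) \<Rightarrow>
      ennreal ((2 * pi * v) powr (- (real DIM('a) / 2)) * exp (- (norm x)\<^sup>2 / (2 * v))) *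
      ennreal ((2 * pi * v) powr (- (real DIM('b) / 2)) * exp (- (norm y)\<^sup>2 / (2 * v)))) =
      ennreal ((2 * pi * v) powr (- (real DIM('a \<times> 'b) / 2)) * exp (- (norm x)\<^sup>2 / (2 * v)))"
    proof (intro AE_I2, safe)
      fix x :: 'a and y :: 'b
      have e: "exp (- (norm x)\<^sup>2 / (2 * v)) * exp (- (norm y)\<^sup>2 / (2 * v)) = exp (- (norm (x, y))\<^sup>2 / (2 * v))"
        by (simp add: norm_Pair exp_add[symmetric] add_divide_distrib diff_divide_distrib)
      have p: "(2 * pi * v) powr (- (real DIM('a) / 2)) * (2 * pi * v) powr (- (real DIM('b) / 2))
        = (2 * pi * v) powr (- (real DIM('a \<times> 'b) / 2))"
        by (simp add: powr_add[symmetric] add_divide_distrib)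
      have m: "(c * e) * (c' * e') = (c * c') * (e * e')" for c e c' e' :: real
        by (simp only: mult_ac)
      show "ennreal ((2 * pi * v) powr (- (real DIM('a) / 2)) * exp (- (norm x)\<^sup>2 / (2 * v))) *
          ennreal ((2 * pi * v) powr (- (real DIM('b) / 2)) * exp (- (norm y)\<^sup>2 / (2 * v))) =
          ennreal ((2 * pi * v) powr (- (real DIM('a \<times> 'b) / 2)) * exp (- (norm (x, y))\<^sup>2 / (2 * v)))"
        by (subst ennreal_mult'[symmetric], simp, subst m, simp only: e p)
    qed
    show "(\<lambda>(x::'a, y::'b). ennreal ((2 * pi * v) powr (- (real DIM('a) / 2)) * exp (- (norm x)\<^sup>2 / (2 * v))) *
        ennreal ((2 * pi * v) powr (- (real DIM('b) / 2)) * exp (- (norm y)\<^sup>2 / (2 * v))))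
        \<in> borel_measurable lborel"
      unfolding case_prod_beta by measurable
    show "(\<lambda>x::'a \<times> 'b. ennreal ((2 * pi * v) powr (- (real DIM('a \<times> 'b) / 2)) * exp (- (norm x)\<^sup>2 / (2 * v))))
        \<in> borel_measurable lborel"
      by measurable
  qed
  finally show ?thesis by (rule sym)
qed

text \<open>Haar uniqueness: two translation invariant measures that agree on the unit ball are equal, and
  the image of \<open>lborel\<close> under a linear isometry is translation invariant.\<close>

lemma distr_lborel_isometry:
  fixes f :: "'a::euclidean_space \<Rightarrow> 'a"
  assumes "linear f" and iso: "\<And>x. norm (f x) = norm x"
  shows "distr lborel borel f = lborel"
proof -
  define m where "m = distr lborel borel f"
  have [measurable]: "f \<in> borel_measurable borel"
    by (rule linear_borel_measurable) fact
  have inj: "inj f"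
    using linear_injective_0[OF \<open>linear f\<close>] iso by (metis norm_eq_zero)
  then have surj: "surj f"
    using \<open>linear f\<close> linear_injective_imp_surjective by blast
  have sm [measurable_cong, simp]: "sets m = sets borel" and spm [simp]: "space m = UNIV"
    by (auto simp: m_def)
  have minv: "(\<integral>\<^sup>+x. g (x + a) \<partial>m) = (\<integral>\<^sup>+x. g x \<partial>m)"
    if [measurable]: "g \<in> borel_measurable borel" for g :: "'a \<Rightarrow> ennreal" and a
  proof -
    obtain b where b: "a = f b" using surj by blast
    have "(\<integral>\<^sup>+x. g (x + a) \<partial>m) = (\<integral>\<^sup>+x. g (f (b + x)) \<partial>lborel)"
      by (simp add: m_def nn_integral_distr b linear_add[OF \<open>linear f\<close>] add.commute)
    also have "\<dots> = (\<integral>\<^sup>+x. g (f x) \<partial>distr lborel borel ((+) b))"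
      by (subst nn_integral_distr) auto
    also have "\<dots> = (\<integral>\<^sup>+x. g x \<partial>m)"
      by (simp add: lborel_distr_plus m_def nn_integral_distr)
    finally show ?thesis .
  qed
  have linv: "(\<integral>\<^sup>+x. g (x + a) \<partial>lborel) = (\<integral>\<^sup>+x. g x \<partial>lborel)"
    if [measurable]: "g \<in> borel_measurable borel" for g :: "'a \<Rightarrow> ennreal" and a
  proof -
    have "(\<integral>\<^sup>+x. g x \<partial>lborel) = (\<integral>\<^sup>+x. g x \<partial>distr lborel borel ((+) a))"
      by (simp add: lborel_distr_plus)
    then show ?thesis by (simp add: nn_integral_distr add.commute)
  qed
  have fball: "f -` ball 0 1 = ball 0 1" using iso by auto
  have mball: "emeasure m (ball 0 1) = emeasure lborel (ball (0::'a) 1)"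
    by (simp add: m_def emeasure_distr fball)
  interpret m: sigma_finite_measure m
  proof
    have "(\<Union>n::nat. ball (0::'a) (real n)) = UNIV"
      by (auto simp: dist_norm) (meson reals_Archimedean2)
    moreover have "f -` ball 0 r = ball 0 r" for r using iso by auto
    ultimately show "\<exists>A. countable A \<and> A \<subseteq> sets m \<and> \<Union> A = space m \<and> (\<forall>a\<in>A. emeasure m a \<noteq> \<infinity>)"
      by (intro exI[of _ "range (\<lambda>n::nat. ball 0 (real n))"])
        (use emeasure_lborel_ball_finite[of "0::'a"] in \<open>auto simp: m_def emeasure_distr top.not_eq_extremum\<close>)
  qed
  interpret P: pair_sigma_finite m lborel ..
  have "m = lborel"
  proof (rule measure_eqI)
    fix B assume B: "B \<in> sets m"
    then have [measurable]: "B \<in> sets borel" by simp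
    define w :: "'a \<Rightarrow> ennreal" where "w = indicator (ball 0 1)"
    have [measurable]: "w \<in> borel_measurable borel" unfolding w_def by (intro borel_measurable_indicator) simp
    have ws: "w (y - x) = w (x - y)" for x y by (auto simp: w_def indicator_def norm_minus_commute)
    let ?I = "indicator B :: 'a \<Rightarrow> ennreal"
    \<comment> \<open>The double integral of \<open>w y * ?I (x + y)\<close> is evaluated in two
      orders. Shifting \<open>x\<close> under \<open>m\<close> gives the volume of the ball times
      \<open>emeasure m B\<close>. Shifting \<open>y\<close> under \<open>lborel\<close>, then
      \<open>x\<close> under \<open>m\<close>, and using the symmetry of the ball gives the
      \<open>m\<close>-measure of the ball times \<open>emeasure lborel B\<close>. The ball has the
      same measure under both.\<close>
    have "emeasure lborel (ball (0::'a) 1) * emeasure m B = (\<integral>\<^sup>+y. w y * (\<integral>\<^sup>+x. ?I x \<partial>m) \<partial>lborel)"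
      by (subst nn_integral_multc) (measurable, simp add: w_def)
    also have "\<dots> = (\<integral>\<^sup>+y. w y * (\<integral>\<^sup>+x. ?I (x + y) \<partial>m) \<partial>lborel)"
      by (subst minv) auto
    also have "\<dots> = (\<integral>\<^sup>+y. \<integral>\<^sup>+x. w y * ?I (x + y) \<partial>m \<partial>lborel)"
      by (simp add: nn_integral_cmult)
    also have "\<dots> = (\<integral>\<^sup>+x. \<integral>\<^sup>+y. w y * ?I (x + y) \<partial>lborel \<partial>m)"
      by (rule P.Fubini') measurable
    also have "\<dots> = (\<integral>\<^sup>+x. \<integral>\<^sup>+y. w (y - x) * ?I y \<partial>lborel \<partial>m)"
    proof (rule nn_integral_cong)
      fix x
      show "(\<integral>\<^sup>+y. w y * ?I (x + y) \<partial>lborel) = (\<integral>\<^sup>+y. w (y - x) * ?I y \<partial>lborel)"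
        using linv[of "\<lambda>y. w (y - x) * ?I y" x] by (simp add: add.commute)
    qed
    also have "\<dots> = (\<integral>\<^sup>+y. \<integral>\<^sup>+x. w (y - x) * ?I y \<partial>m \<partial>lborel)"
      by (rule P.Fubini'[symmetric]) measurable
    also have "\<dots> = (\<integral>\<^sup>+y. (\<integral>\<^sup>+x. w (x - y) \<partial>m) * ?I y \<partial>lborel)"
      by (simp add: nn_integral_multc ws)
    also have "\<dots> = (\<integral>\<^sup>+y. (\<integral>\<^sup>+x. w x \<partial>m) * ?I y \<partial>lborel)"
      using minv[of w "- _"] by simp
    also have "\<dots> = emeasure lborel (ball (0::'a) 1) * emeasure lborel B"
      by (simp add: nn_integral_cmult w_def mball)
    finally have *: "emeasure lborel (ball (0::'a) 1) * emeasure m B = emeasure lborel (ball (0::'a) 1) * emeasure lborel B" .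
    have "emeasure lborel (ball (0::'a) 1) \<noteq> 0"
      using content_ball_pos[of 1 "0::'a"] by (auto simp: measure_def)
    moreover have "emeasure lborel (ball (0::'a) 1) \<noteq> top"
      using emeasure_lborel_ball_finite[of "0::'a" 1] by simp
    ultimately show "emeasure m B = emeasure lborel B"
      using * by (simp add: ennreal_mult_cancel_left)
  qed simp
  then show ?thesis by (simp add: m_def)
qed

lemma distr_gaussian_isometry:
  fixes f :: "'a::euclidean_space \<Rightarrow> 'a"
  assumes "linear f" and iso: "\<And>x. norm (f x) = norm x"
  shows "distr (gaussian v) borel f = gaussian v"
proof -
  have [measurable]: "f \<in> borel_measurable borel"
    by (rule linear_borel_measurable) fact
  let ?d = "\<lambda>x::'a. ennreal ((2 * pi * v) powr (- (real DIM('a) / 2)) * exp (- (norm x)\<^sup>2 / (2 * v)))"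
  have "gaussian v = density (distr lborel borel f) ?d"
    by (simp add: distr_lborel_isometry[OF assms] gaussian_def)
  also have "\<dots> = distr (density lborel (\<lambda>x. ?d (f x))) borel f"
    by (subst density_distr) auto
  finally show ?thesis by (simp add: iso gaussian_def)
qed

lemma nn_integral_gaussian_isometry:
  fixes f :: "'a::euclidean_space \<Rightarrow> 'a"
  assumes "linear f" and iso: "\<And>x. norm (f x) = norm x" and [measurable]: "g \<in> borel_measurable borel"
  shows "(\<integral>\<^sup>+x. g (f x) \<partial>gaussian v) = (\<integral>\<^sup>+x. g x \<partial>gaussian v)"
proof -
  have [measurable]: "f \<in> borel_measurable borel"
    by (rule linear_borel_measurable) fact
  show ?thesis
    by (subst (2) distr_gaussian_isometry[OF assms(1,2), symmetric]) (simp add: nn_integral_distr)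
qed

lemma integral_gaussian_isometry:
  fixes f :: "'a::euclidean_space \<Rightarrow> 'a" and g :: "'a \<Rightarrow> real"
  assumes "linear f" and iso: "\<And>x. norm (f x) = norm x" and [measurable]: "g \<in> borel_measurable borel"
  shows "(\<integral>x. g (f x) \<partial>gaussian v) = (\<integral>x. g x \<partial>gaussian v)"
proof -
  have [measurable]: "f \<in> borel_measurable borel"
    by (rule linear_borel_measurable) fact
  show ?thesis
    by (subst (2) distr_gaussian_isometry[OF assms(1,2), symmetric]) (simp add: integral_distr)
qed

text \<open>Brownian increments over a step \<open>h\<close> have variance \<open>h\<close>.
  Rescaling gives the noise the same standard law as position and momentum, which the orthogonality
  argument in \<open>transition_duality\<close> requires.\<close>

lemma nn_integral_gaussian_scale:
  fixes g :: "'a::euclidean_space \<Rightarrow> ennreal"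
  assumes h: "h > 0" and [measurable]: "g \<in> borel_measurable borel"
  shows "(\<integral>\<^sup>+x. g x \<partial>gaussian h) = (\<integral>\<^sup>+x. g (sqrt h *\<^sub>R x) \<partial>gaussian 1)"
proof -
  let ?n = "real DIM('a)"
  have "sqrt h \<noteq> 0" using h by simp
  have "(\<integral>\<^sup>+x. g x \<partial>gaussian h) =
     (\<integral>\<^sup>+x. ennreal ((2 * pi * h) powr (- (?n / 2)) * exp (- (norm x)\<^sup>2 / (2 * h))) * g x
        \<partial>density (distr lborel borel (\<lambda>x. 0 + sqrt h *\<^sub>R x)) (\<lambda>_. ennreal (\<bar>sqrt h\<bar>^DIM('a))))"
    using h by (subst lborel_affine[of "sqrt h" 0, symmetric]) (auto simp: nn_integral_gaussian)
  also have "\<dots> = (\<integral>\<^sup>+x. ennreal (\<bar>sqrt h\<bar>^DIM('a)) * (ennreal ((2 * pi * h) powr (- (?n / 2)) *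
       exp (- (norm (sqrt h *\<^sub>R x))\<^sup>2 / (2 * h))) * g (sqrt h *\<^sub>R x)) \<partial>lborel)"
    by (subst nn_integral_density) (auto simp: nn_integral_distr)
  also have "\<dots> = (\<integral>\<^sup>+x. ennreal ((2 * pi) powr (- (?n / 2)) * exp (- (norm x)\<^sup>2 / 2)) * g (sqrt h *\<^sub>R x) \<partial>lborel)"
  proof (rule nn_integral_cong)
    fix x :: 'a
    have "\<bar>sqrt h\<bar>^DIM('a) * (2 * pi * h) powr (- (?n / 2)) = (2 * pi) powr (- (?n / 2))"
      using h by (simp add: powr_half_sqrt[symmetric] powr_powr powr_mult powr_add[symmetric]
          flip: powr_realpow)
    then show "ennreal (\<bar>sqrt h\<bar>^DIM('a)) * (ennreal ((2 * pi * h) powr (- (?n / 2)) *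
       exp (- (norm (sqrt h *\<^sub>R x))\<^sup>2 / (2 * h))) * g (sqrt h *\<^sub>R x))
       = ennreal ((2 * pi) powr (- (?n / 2)) * exp (- (norm x)\<^sup>2 / 2)) * g (sqrt h *\<^sub>R x)"
      using h by (simp add: mult.assoc[symmetric] ennreal_mult'[symmetric] power_mult_distrib)
  qed
  also have "\<dots> = (\<integral>\<^sup>+x. g (sqrt h *\<^sub>R x) \<partial>gaussian 1)"
    by (subst nn_integral_gaussian) auto
  finally show ?thesis .
qed


text \<open>Half of the exponent absorbs the fourth power, and what is left is a multiple of the
  density of \<open>gaussian 2\<close>, a probability measure. Fourth moments suffice for products
  of two quadratic forms.\<close>

lemma integrable_gaussian_norm4: "integrable (gaussian 1) (\<lambda>x::'a::euclidean_space. norm x ^ 4)"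
proof (rule integrableI_nonneg)
  let ?n = "real DIM('a)"
  let ?C = "32 * (2 * pi * 1) powr (- (?n / 2)) * (2 * pi * 2) powr (?n / 2)"
  have "(\<integral>\<^sup>+x. ennreal (norm (x::'a) ^ 4) \<partial>gaussian 1)
      \<le> (\<integral>\<^sup>+x. ennreal ((2 * pi * 2) powr (- (?n / 2)) * exp (- (norm (x::'a))\<^sup>2 / (2 * 2))) * ennreal ?C \<partial>lborel)"
  proof (subst nn_integral_gaussian, simp, simp, rule nn_integral_mono)
    fix x :: 'a
    have "norm x ^ 4 * exp (- (norm x)\<^sup>2 / 2) \<le> 32 * exp (- (norm x)\<^sup>2 / 4)"
    proof -
      \<comment> \<open>For this \<open>u\<close> the term u^2/2 of the exponential series is the
        fourth power of the norm divided by 32, hence the factor 32.\<close>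
      define u where "u = (norm x)\<^sup>2 / 4"
      have "u\<^sup>2 / 2 \<le> exp u"
        using exp_lower_Taylor_quadratic[of u] zero_le_power2[of "norm x"] unfolding u_def by linarith
      then have "u\<^sup>2 / 2 * exp (- u) * exp (- u) \<le> exp u * exp (- u) * exp (- u)"
        by (intro mult_right_mono) auto
      also have "\<dots> = exp (- u)" by (simp add: exp_minus)
      finally have "u\<^sup>2 / 2 * exp (- 2 * u) \<le> exp (- u)"
        by (simp add: exp_add[symmetric] mult.assoc)
      then show ?thesis by (simp add: u_def power_divide field_simps)
    qed
    then have "(2 * pi) powr (- (?n / 2)) * (norm x ^ 4 * exp (- (norm x)\<^sup>2 / 2))
        \<le> (2 * pi) powr (- (?n / 2)) * (32 * exp (- (norm x)\<^sup>2 / 4))"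
      by (rule mult_left_mono) auto
    moreover have "(2 * pi * 2) powr (- (?n / 2)) * (2 * pi * 2) powr (?n / 2) = 1"
      by (simp add: powr_minus)
    ultimately show "ennreal ((2 * pi * 1) powr (- (?n / 2)) * exp (- (norm x)\<^sup>2 / (2 * 1))) * ennreal (norm x ^ 4)
       \<le> ennreal ((2 * pi * 2) powr (- (?n / 2)) * exp (- (norm x)\<^sup>2 / (2 * 2))) * ennreal ?C"
      by (simp add: ennreal_mult'[symmetric] mult_ac)
  qed
  also have "\<dots> = (\<integral>\<^sup>+x. ennreal ?C \<partial>(gaussian 2 :: 'a measure))"
    by (subst nn_integral_gaussian) auto
  also have "\<dots> < \<infinity>"
    using prob_space.emeasure_space_1[OF prob_space_gaussian[of 2, where 'a='a]] by simp
  finally show "(\<integral>\<^sup>+x. ennreal (norm (x::'a) ^ 4) \<partial>gaussian 1) < \<infinity>" .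
qed auto

lemma integrable_gaussian_quartic:
  fixes f :: "'a::euclidean_space \<Rightarrow> real"
  assumes [measurable]: "f \<in> borel_measurable borel" and b: "\<And>x. \<bar>f x\<bar> \<le> C * (1 + norm x ^ 4)"
  shows "integrable (gaussian 1) f"
proof (rule Bochner_Integration.integrable_bound)
  interpret prob_space "gaussian 1 :: 'a measure" by (rule prob_space_gaussian) simp
  show "integrable (gaussian 1) (\<lambda>x::'a. C * (1 + norm x ^ 4))"
    using integrable_gaussian_norm4[where 'a='a] by auto
  show "AE x in gaussian 1. norm (f x) \<le> norm (C * (1 + norm x ^ 4))"
    using b by (intro AE_I2) (metis abs_ge_self order_trans real_norm_def)
qed auto

lemma power_le_1_add_power4:
  fixes r :: real
  assumes "0 \<le> r" "k \<le> 4"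
  shows "r ^ k \<le> 1 + r ^ 4"
proof (cases "r \<le> 1")
  case True
  then have "r ^ k \<le> 1" using assms by (simp add: power_le_one)
  moreover have "0 \<le> r ^ 4" by simp
  ultimately show ?thesis by linarith
next
  case False
  then have "r ^ k \<le> r ^ 4" using assms by (intro power_increasing) auto
  then show ?thesis by simp
qed

lemma integrable_gaussian_power_bound:
  fixes f :: "'a::euclidean_space \<Rightarrow> real"
  assumes "f \<in> borel_measurable borel" and b: "\<And>x. \<bar>f x\<bar> \<le> C * norm x ^ k" and "k \<le> 4"
  shows "integrable (gaussian 1) f"
proof (rule integrable_gaussian_quartic[OF assms(1)])
  fix x :: 'a
  have "C * norm x ^ k \<le> \<bar>C\<bar> * (1 + norm x ^ 4)"
    using power_le_1_add_power4[of "norm x" k] \<open>k \<le> 4\<close> by (intro mult_mono) auto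
  then show "\<bar>f x\<bar> \<le> \<bar>C\<bar> * (1 + norm x ^ 4)" using b[of x] by linarith
qed

lemma integrable_gaussian_inner_mult:
  "integrable (gaussian 1) (\<lambda>x::'a::euclidean_space. (x \<bullet> a) * (x \<bullet> b))"
proof (rule integrable_gaussian_power_bound[where k=2])
  fix x :: 'a
  have "\<bar>x \<bullet> a\<bar> * \<bar>x \<bullet> b\<bar> \<le> (norm x * norm a) * (norm x * norm b)"
    by (intro mult_mono Cauchy_Schwarz_ineq2) auto
  then show "\<bar>(x \<bullet> a) * (x \<bullet> b)\<bar> \<le> (norm a * norm b) * (norm x)^2"
    by (simp add: abs_mult power2_eq_square mult_ac)
qed auto

lemma gaussian_second_moment_Basis:
  fixes a b :: "'a::euclidean_space"
  assumes a: "a \<in> Basis" and b: "b \<in> Basis"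
  shows "(\<integral>x. (x \<bullet> a) * (x \<bullet> b) \<partial>gaussian 1) = (if a = b then 1 else 0)"
proof (cases "a = b")
  case True
  have 1: "(\<integral>\<^sup>+x. ennreal (normal_density 0 1 x) * ennreal (x\<^sup>2) \<partial>lborel) = 1"
    using std_normal_moment_even[of 1]
    by (auto simp: has_bochner_integral_iff ennreal_mult'[symmetric] nn_integral_eq_integral)
  have "(\<integral>\<^sup>+x. ennreal ((x \<bullet> a)\<^sup>2) \<partial>gaussian 1)
      = (\<integral>\<^sup>+x. (\<Prod>c\<in>Basis. (\<lambda>c y. if c = a then ennreal (y\<^sup>2) else 1) c (x \<bullet> c)) \<partial>(gaussian 1 :: 'a measure))"
    using a by (simp add: prod.delta)
  also have "\<dots> = (\<Prod>c\<in>(Basis::'a set). \<integral>\<^sup>+x. ennreal (normal_density 0 (sqrt 1) x) * (if c = a then ennreal (x\<^sup>2) else 1) \<partial>lborel)"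
    by (rule nn_integral_gaussian_prod) auto
  also have "\<dots> = (\<Prod>c\<in>(Basis::'a set). 1)"
  proof (intro prod.cong refl)
    fix c :: 'a
    show "(\<integral>\<^sup>+x. ennreal (normal_density 0 (sqrt 1) x) * (if c = a then ennreal (x\<^sup>2) else 1) \<partial>lborel) = 1"
      using 1 nn_integral_normal_density[of 1] by (cases "c = a") auto
  qed
  finally have "(\<integral>\<^sup>+x. ennreal ((x \<bullet> a)\<^sup>2) \<partial>gaussian 1) = 1" by simp
  then show ?thesis
    using True by (simp add: integral_eq_nn_integral flip: power2_eq_square)
next
  case False
  \<comment> \<open>Reflection in the hyperplane orthogonal to \<open>a\<close> preserves the
    Gaussian and reverses the sign of the integrand.\<close>
  let ?f = "\<lambda>x::'a. x - (2 * (x \<bullet> a)) *\<^sub>R a"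
  have aa: "a \<bullet> a = 1" and ab: "a \<bullet> b = 0"
    using a b False by (auto simp: inner_Basis)
  have "linear ?f"
    by (rule linearI) (auto simp: inner_simps algebra_simps)
  moreover have "norm (?f x) = norm x" for x
    unfolding norm_eq_sqrt_inner
    by (simp add: inner_diff_left inner_diff_right aa inner_commute algebra_simps)
  ultimately have "(\<integral>x. (?f x \<bullet> a) * (?f x \<bullet> b) \<partial>gaussian 1) = (\<integral>x. (x \<bullet> a) * (x \<bullet> b) \<partial>gaussian 1)"
    by (intro integral_gaussian_isometry[where g="\<lambda>x. (x \<bullet> a) * (x \<bullet> b)"]) auto
  moreover have "(?f x \<bullet> a) * (?f x \<bullet> b) = - ((x \<bullet> a) * (x \<bullet> b))" for x
    by (simp add: inner_diff_left aa ab)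
  ultimately show ?thesis using False by simp
qed

section \<open>Bilinear and quadratic forms of Gaussian vectors\<close>

lemma bilinear_expansion:
  fixes B :: "'a::euclidean_space \<Rightarrow> 'b::euclidean_space \<Rightarrow> real"
  assumes "bilinear B"
  shows "B x y = (\<Sum>a\<in>Basis. \<Sum>b\<in>Basis. (x \<bullet> a) * (y \<bullet> b) * B a b)"
proof -
  have "B x y = B (\<Sum>a\<in>Basis. (x \<bullet> a) *\<^sub>R a) (\<Sum>b\<in>Basis. (y \<bullet> b) *\<^sub>R b)"
    by (simp add: euclidean_representation)
  also have "\<dots> = (\<Sum>(a, b)\<in>Basis \<times> Basis. (x \<bullet> a) * (y \<bullet> b) * B a b)"
    by (subst bilinear_sum[OF assms])
      (auto simp: bilinear_lmul[OF assms] bilinear_rmul[OF assms] intro!: sum.cong)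
  finally show ?thesis by (simp add: sum.cartesian_product)
qed

lemma bilinear_measurable:
  fixes B :: "'a::euclidean_space \<Rightarrow> 'b::euclidean_space \<Rightarrow> real"
  assumes "bilinear B" and [measurable]: "f \<in> borel_measurable M" "g \<in> borel_measurable M"
  shows "(\<lambda>x. B (f x) (g x)) \<in> borel_measurable M"
proof -
  have "(\<lambda>x. B (f x) (g x)) = (\<lambda>x. \<Sum>a\<in>Basis. \<Sum>b\<in>Basis. (f x \<bullet> a) * (g x \<bullet> b) * B a b)"
    by (rule ext) (rule bilinear_expansion[OF assms(1)])
  then show ?thesis by simp
qed

lemma bilinear_bound:
  fixes B :: "'a::euclidean_space \<Rightarrow> 'b::euclidean_space \<Rightarrow> real"
  assumes "bilinear B"
  obtains C where "C \<ge> 0" "\<And>x y. \<bar>B x y\<bar> \<le> C * norm x * norm y"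
proof -
  obtain C where "C > 0" "\<And>x y. norm (B x y) \<le> C * norm x * norm y"
    using bilinear_bounded_pos[OF assms] by blast
  then show thesis by (intro that[of C]) auto
qed

lemma integrable_gaussian_bilinear:
  assumes "bilinear B"
  shows "integrable (gaussian 1) (\<lambda>x::'a::euclidean_space. B x x :: real)"
  by (subst bilinear_expansion[OF assms], intro Bochner_Integration.integrable_sum integrable_mult_left integrable_gaussian_inner_mult)

lemma integral_gaussian_bilinear:
  fixes B :: "'a::euclidean_space \<Rightarrow> 'a \<Rightarrow> real"
  assumes "bilinear B"
  shows "(\<integral>x. B x x \<partial>gaussian 1) = (\<Sum>b\<in>Basis. B b b)"
proof -
  have "(\<integral>x. B x x \<partial>gaussian 1) = (\<Sum>a\<in>Basis. \<Sum>b\<in>Basis. (\<integral>x. (x \<bullet> a) * (x \<bullet> b) \<partial>gaussian 1) * B a b)"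
    by (subst bilinear_expansion[OF assms])
      (simp add: integral_sum integrable_gaussian_inner_mult)
  also have "\<dots> = (\<Sum>a\<in>Basis. \<Sum>b\<in>Basis. if a = b then B a b else 0)"
    by (intro sum.cong refl) (simp add: gaussian_second_moment_Basis)
  finally show ?thesis by simp
qed

lemma
  fixes g :: "'a::euclidean_space \<Rightarrow> real"
  assumes "integrable (gaussian 1) g"
  shows integral_gaussian_fst: "(\<integral>z. g (fst z) \<partial>(gaussian 1 :: ('a \<times> 'b::euclidean_space) measure)) = (\<integral>x. g x \<partial>gaussian 1)"
    and integral_gaussian_snd: "(\<integral>z. g (snd z) \<partial>(gaussian 1 :: ('b \<times> 'a) measure)) = (\<integral>x. g x \<partial>gaussian 1)"
proof -
  interpret A: prob_space "gaussian 1 :: 'a measure" by (rule prob_space_gaussian) simp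
  interpret B: prob_space "gaussian 1 :: 'b measure" by (rule prob_space_gaussian) simp
  have [measurable]: "g \<in> borel_measurable borel" using assms by auto
  have 1: "distr (gaussian 1 :: ('a \<times> 'b) measure) borel fst = gaussian 1"
    unfolding gaussian_pair[OF zero_less_one] using B.distr_pair_fst[of "gaussian 1 :: 'a measure"]
    by (simp cong: distr_cong)
  show "(\<integral>z. g (fst z) \<partial>(gaussian 1 :: ('a \<times> 'b) measure)) = (\<integral>x. g x \<partial>gaussian 1)"
    using integral_distr[of fst "gaussian 1 :: ('a \<times> 'b) measure" borel g] 1 by simp
  have "distr (gaussian 1 \<Otimes>\<^sub>M gaussian 1) (gaussian 1 \<Otimes>\<^sub>M gaussian 1) (\<lambda>(x, y). (y, x))
      = (gaussian 1 \<Otimes>\<^sub>M gaussian 1 :: ('a \<times> 'b) measure)"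
    by (intro pair_sigma_finite.distr_pair_swap[symmetric])
      (simp add: pair_sigma_finite_def A.sigma_finite_measure_axioms B.sigma_finite_measure_axioms)
  from arg_cong[OF this, of "\<lambda>N. distr N borel fst"]
  have 2: "distr (gaussian 1 :: ('b \<times> 'a) measure) borel snd = gaussian 1"
    using 1 by (subst (asm) distr_distr) (auto simp: o_def gaussian_pair case_prod_beta)
  show "(\<integral>z. g (snd z) \<partial>(gaussian 1 :: ('b \<times> 'a) measure)) = (\<integral>x. g x \<partial>gaussian 1)"
    using integral_distr[of snd "gaussian 1 :: ('b \<times> 'a) measure" borel g] 2 by simp
qed

lemma integral_gaussian_fst_snd:
  fixes g :: "'a::euclidean_space \<Rightarrow> real" and h :: "'b::euclidean_space \<Rightarrow> real"
  assumes "integrable (gaussian 1) g" "integrable (gaussian 1) h"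
    and "integrable (gaussian 1) (\<lambda>z::'a \<times> 'b. g (fst z) * h (snd z))"
  shows "(\<integral>z. g (fst z) * h (snd z) \<partial>gaussian 1) = (\<integral>x. g x \<partial>gaussian 1) * (\<integral>x. h x \<partial>gaussian 1)"
proof -
  interpret A: prob_space "gaussian 1 :: 'a measure" by (rule prob_space_gaussian) simp
  interpret B: prob_space "gaussian 1 :: 'b measure" by (rule prob_space_gaussian) simp
  interpret AB: pair_prob_space "gaussian 1 :: 'a measure" "gaussian 1 :: 'b measure" ..
  show ?thesis
    using AB.integral_fst'[of "\<lambda>z. g (fst z) * h (snd z)"] assms(3)
    by (simp add: gaussian_pair mult.commute)
qed

text \<open>The subtracted trace is the mean of \<open>B x x\<close> under
  \<open>gaussian 1\<close>. The semigroup and its generator map the family of these centred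
  functions into itself, acting on \<open>B\<close> alone.\<close>

definition quad_form :: "('a::euclidean_space \<Rightarrow> 'a \<Rightarrow> real) \<Rightarrow> 'a \<Rightarrow> real" where
  "quad_form B x = B x x - (\<Sum>b\<in>Basis. B b b)"

lemma integral_quad_form:
  assumes "bilinear B"
  shows "(\<integral>x. quad_form B x \<partial>gaussian 1) = 0"
proof -
  interpret prob_space "gaussian 1 :: 'a measure" by (rule prob_space_gaussian) simp
  show ?thesis
    using prob_space unfolding quad_form_def
    by (subst Bochner_Integration.integral_diff)
      (simp_all add: integrable_gaussian_bilinear integral_gaussian_bilinear assms)
qed

lemma quad_form_measurable: "bilinear B \<Longrightarrow> quad_form B \<in> borel_measurable borel"
  unfolding quad_form_def using bilinear_measurable[of B "\<lambda>x. x" borel "\<lambda>x. x"] by simp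

lemma quad_form_bound:
  assumes "bilinear B" and B: "\<And>x y. \<bar>B x y\<bar> \<le> C * norm x * norm y"
  shows "\<bar>quad_form B (x::'a::euclidean_space)\<bar> \<le> C * ((norm x)\<^sup>2 + DIM('a))"
proof -
  have "\<bar>\<Sum>b\<in>(Basis::'a set). B b b\<bar> \<le> (\<Sum>b\<in>(Basis::'a set). C)"
    using B by (intro order_trans[OF sum_abs] sum_mono) (metis mult.right_neutral norm_Basis)
  then show ?thesis
    using B[of x x] unfolding quad_form_def by (simp add: power2_eq_square algebra_simps)
qed

text \<open>The maps \<open>f1\<close> to \<open>f4\<close> stand for the identity,
  \<open>fst\<close> and \<open>snd\<close>, so that one estimate covers every product arising in
  the fourth moment computation.\<close>

lemma integrable_gaussian_bilinear_mult:
  fixes B D :: "'a::euclidean_space \<Rightarrow> 'a \<Rightarrow> real"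
  assumes B: "bilinear B" and D: "bilinear D"
    and [measurable]: "f1 \<in> borel_measurable borel" "f2 \<in> borel_measurable borel"
      "f3 \<in> borel_measurable borel" "f4 \<in> borel_measurable borel"
    and f: "\<And>z::'b::euclidean_space. norm (f1 z) \<le> norm z" "\<And>z. norm (f2 z) \<le> norm z"
      "\<And>z. norm (f3 z) \<le> norm z" "\<And>z. norm (f4 z) \<le> norm z"
  shows "integrable (gaussian 1) (\<lambda>z. B (f1 z) (f2 z) * D (f3 z) (f4 z))"
proof -
  obtain b where b: "b \<ge> 0" "\<And>x y. \<bar>B x y\<bar> \<le> b * norm x * norm y" using bilinear_bound[OF B] by blast
  obtain d where d: "d \<ge> 0" "\<And>x y. \<bar>D x y\<bar> \<le> d * norm x * norm y" using bilinear_bound[OF D] by blast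
  note [measurable] = bilinear_measurable[OF B] bilinear_measurable[OF D]
  show ?thesis
  proof (rule integrable_gaussian_power_bound[where k=4 and C="b * d"])
    fix z
    have "\<bar>B (f1 z) (f2 z)\<bar> \<le> b * norm z * norm z"
      by (rule order_trans[OF b(2)]) (intro mult_mono f b(1) mult_nonneg_nonneg norm_ge_zero order_refl)
    moreover have "\<bar>D (f3 z) (f4 z)\<bar> \<le> d * norm z * norm z"
      by (rule order_trans[OF d(2)]) (intro mult_mono f d(1) mult_nonneg_nonneg norm_ge_zero order_refl)
    ultimately have "\<bar>B (f1 z) (f2 z)\<bar> * \<bar>D (f3 z) (f4 z)\<bar> \<le> (b * norm z * norm z) * (d * norm z * norm z)"
      by (intro mult_mono) (auto simp: b)
    then show "\<bar>B (f1 z) (f2 z) * D (f3 z) (f4 z)\<bar> \<le> b * d * norm z ^ 4"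
      by (simp add: abs_mult power4_eq_xxxx mult_ac)
  qed auto
qed

text \<open>With independent arguments only second moments occur: for fixed first argument the
  product is a bilinear form in the second, and its trace is a bilinear form in the first.\<close>

lemma integral_gaussian_bilinear_mult:
  fixes B D :: "'a::euclidean_space \<Rightarrow> 'a \<Rightarrow> real"
  assumes B: "bilinear B" and D: "bilinear D"
  shows "(\<integral>z. B (fst z) (snd z) * D (fst z) (snd z) \<partial>gaussian 1) = (\<Sum>a\<in>Basis. \<Sum>b\<in>Basis. B a b * D a b)"
proof -
  interpret A: prob_space "gaussian 1 :: 'a measure" by (rule prob_space_gaussian) simp
  interpret AB: pair_prob_space "gaussian 1 :: 'a measure" "gaussian 1 :: 'a measure" ..
  have "integrable (gaussian 1) (\<lambda>z. B (fst z) (snd z) * D (fst z) (snd z))"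
    by (rule integrable_gaussian_bilinear_mult[OF B D]) (auto simp: norm_fst_le norm_snd_le)
  then have "(\<integral>z. B (fst z) (snd z) * D (fst z) (snd z) \<partial>gaussian 1)
    = (\<integral>x. (\<integral>y. B x y * D x y \<partial>gaussian 1) \<partial>gaussian 1)"
    using AB.integral_fst'[of "\<lambda>z. B (fst z) (snd z) * D (fst z) (snd z)"] by (simp add: gaussian_pair)
  also have "\<dots> = (\<integral>x. (\<Sum>b\<in>Basis. B x b * D x b) \<partial>gaussian 1)"
  proof (rule Bochner_Integration.integral_cong[OF refl])
    fix x :: 'a
    have "bilinear (\<lambda>y y'. B x y * D x y')"
      using B D by (auto simp: bilinear_def intro!: linearI)
        (auto simp: linear_iff algebra_simps)
    from integral_gaussian_bilinear[OF this]
    show "(\<integral>y. B x y * D x y \<partial>gaussian 1) = (\<Sum>b\<in>Basis. B x b * D x b)" by simp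
  qed
  also have "\<dots> = (\<Sum>a\<in>Basis. \<Sum>b\<in>Basis. B a b * D a b)"
  proof -
    have "bilinear (\<lambda>x x'. \<Sum>b\<in>Basis. B x b * D x' b)"
      using B D by (auto simp: bilinear_def intro!: linearI)
        (auto simp: linear_iff algebra_simps sum.distrib sum_distrib_left)
    from integral_gaussian_bilinear[OF this] show ?thesis by simp
  qed
  finally show ?thesis .
qed

text \<open>Fourth moments without coordinates: evaluate the product of two quadratic forms at
  \<open>(x + y) / sqrt 2\<close>, which is again standard Gaussian when \<open>x\<close> and \<open>y\<close> are independent, and
  solve the resulting linear equation.\<close>

lemma integral_quad_form_mult:
  fixes B D :: "'a::euclidean_space \<Rightarrow> 'a \<Rightarrow> real"
  assumes B: "bilinear B" and D: "bilinear D"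
  shows "(\<integral>x. quad_form B x * quad_form D x \<partial>gaussian 1)
    = (\<Sum>a\<in>Basis. \<Sum>b\<in>Basis. (B a b + B b a) * (D a b + D b a)) / 2"
proof -
  interpret prob_space "gaussian 1 :: 'a measure" by (rule prob_space_gaussian) simp
  note [measurable] = bilinear_measurable[OF B] bilinear_measurable[OF D]
  define S where "S x y = B x y + B y x" for x y
  define T where "T x y = D x y + D y x" for x y
  have S: "bilinear S" and T: "bilinear T"
    using B D by (auto simp: bilinear_def S_def T_def linear_iff algebra_simps)
  note [measurable] = bilinear_measurable[OF S] bilinear_measurable[OF T]
  let ?G = "gaussian 1 :: ('a \<times> 'a) measure"
  define F where "F x = B x x" for x
  define H where "H x = D x x" for x
  have iFH: "integrable (gaussian 1) (\<lambda>x. F x * H x)"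
    unfolding F_def H_def by (rule integrable_gaussian_bilinear_mult[OF B D]) auto
  have iF: "integrable (gaussian 1) F" and iH: "integrable (gaussian 1) H"
    unfolding F_def H_def by (simp_all add: integrable_gaussian_bilinear B D)
  have i2: "integrable ?G (\<lambda>z. F (fst z) * H (fst z))" "integrable ?G (\<lambda>z. F (fst z) * H (snd z))"
    "integrable ?G (\<lambda>z. F (snd z) * H (fst z))" "integrable ?G (\<lambda>z. F (snd z) * H (snd z))"
    unfolding F_def H_def
    by (rule integrable_gaussian_bilinear_mult[OF B D]; auto simp: norm_fst_le norm_snd_le)+
  have i3: "integrable ?G (\<lambda>z. F (fst z) * T (fst z) (snd z))" "integrable ?G (\<lambda>z. F (snd z) * T (fst z) (snd z))"
    unfolding F_def
    by (rule integrable_gaussian_bilinear_mult[OF B T]; auto simp: norm_fst_le norm_snd_le)+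
  have i4: "integrable ?G (\<lambda>z. S (fst z) (snd z) * H (fst z))" "integrable ?G (\<lambda>z. S (fst z) (snd z) * H (snd z))"
    unfolding H_def
    by (rule integrable_gaussian_bilinear_mult[OF S D]; auto simp: norm_fst_le norm_snd_le)+
  have i5: "integrable ?G (\<lambda>z. S (fst z) (snd z) * T (fst z) (snd z))"
    by (rule integrable_gaussian_bilinear_mult[OF S T]; auto simp: norm_fst_le norm_snd_le)+
  have m: "F \<in> borel_measurable borel" "H \<in> borel_measurable borel"
    unfolding F_def H_def by measurable
  note [measurable] = m
  have FH1: "(\<integral>z. F (fst z) * H (fst z) \<partial>?G) = (\<integral>x. F x * H x \<partial>gaussian 1)"
    by (rule integral_gaussian_fst[OF iFH])
  have FH2: "(\<integral>z. F (snd z) * H (snd z) \<partial>?G) = (\<integral>x. F x * H x \<partial>gaussian 1)"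
    by (rule integral_gaussian_snd[OF iFH])
  have FH3: "(\<integral>z. F (fst z) * H (snd z) \<partial>?G) = (\<integral>x. F x \<partial>gaussian 1) * (\<integral>x. H x \<partial>gaussian 1)"
    by (rule integral_gaussian_fst_snd[OF iF iH i2(2)])
  have FH4: "(\<integral>z. F (snd z) * H (fst z) \<partial>?G) = (\<integral>x. F x \<partial>gaussian 1) * (\<integral>x. H x \<partial>gaussian 1)"
    using integral_gaussian_fst_snd[OF iH iF] i2(3) by (simp add: mult.commute)
  \<comment> \<open>Among the terms of the expansion at x + y, those odd in \<open>y\<close> are
    removed by the reflection of \<open>y\<close>.\<close>
  have odd: "(\<integral>z. f z \<partial>?G) = 0" if [measurable]: "f \<in> borel_measurable borel" and "\<And>x y. f (x, - y) = - f (x, y)"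
    for f :: "'a \<times> 'a \<Rightarrow> real"
  proof -
    have "(\<integral>z. f (fst z, - snd z) \<partial>?G) = (\<integral>z. f z \<partial>?G)"
      by (rule integral_gaussian_isometry[where f="\<lambda>z. (fst z, - snd z)"])
        (auto intro!: linearI simp: norm_prod_def)
    then show ?thesis using that(2) by simp
  qed
  have Sneg: "S x (- y) = - S x y" "T x (- y) = - T x y" "F (- y) = F y" "H (- y) = H y" for x y
    using bilinear_rneg[OF S] bilinear_rneg[OF T] bilinear_rneg[OF B] bilinear_lneg[OF B]
      bilinear_rneg[OF D] bilinear_lneg[OF D] by (auto simp: F_def H_def)
  have O1: "(\<integral>z. F (fst z) * T (fst z) (snd z) \<partial>?G) = 0" "(\<integral>z. F (snd z) * T (fst z) (snd z) \<partial>?G) = 0"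
     "(\<integral>z. S (fst z) (snd z) * H (fst z) \<partial>?G) = 0" "(\<integral>z. S (fst z) (snd z) * H (snd z) \<partial>?G) = 0"
    by (rule odd; simp add: Sneg)+
  let ?c = "1 / sqrt 2"
  \<comment> \<open>The second component completes (x + y) / sqrt 2 to an isometry of the
    pair.\<close>
  let ?r = "\<lambda>z::'a \<times> 'a. (?c *\<^sub>R (fst z + snd z), ?c *\<^sub>R (fst z - snd z))"
  have "(\<integral>z. F (fst (?r z)) * H (fst (?r z)) \<partial>?G) = (\<integral>z. F (fst z) * H (fst z) \<partial>?G)"
  proof (rule integral_gaussian_isometry[where f="?r" and g="\<lambda>z. F (fst z) * H (fst z)"])
    show "linear ?r" by (rule linearI) (auto simp: algebra_simps)
    show "norm (?r z) = norm z" for z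
    proof -
      have "(norm (?c *\<^sub>R (fst z + snd z)))\<^sup>2 + (norm (?c *\<^sub>R (fst z - snd z)))\<^sup>2 = (norm (fst z))\<^sup>2 + (norm (snd z))\<^sup>2"
        unfolding power2_norm_eq_inner
        by (simp add: inner_simps inner_commute field_simps)
      then show ?thesis by (simp add: norm_prod_def)
    qed
  qed measurable
  moreover have "F (?c *\<^sub>R (x + y)) * H (?c *\<^sub>R (x + y)) = 1/4 * (F x * H x + F x * H y + F y * H x + F y * H y
     + S x y * T x y + F x * T x y + F y * T x y + S x y * H x + S x y * H y)" for x y
  proof -
    have "F (?c *\<^sub>R (x + y)) = 1/2 * (F x + F y + S x y)"
      unfolding F_def S_def
      by (simp add: bilinear_ladd[OF B] bilinear_radd[OF B] bilinear_lmul[OF B] bilinear_rmul[OF B] field_simps)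
    moreover have "H (?c *\<^sub>R (x + y)) = 1/2 * (H x + H y + T x y)"
      unfolding H_def T_def
      by (simp add: bilinear_ladd[OF D] bilinear_radd[OF D] bilinear_lmul[OF D] bilinear_rmul[OF D] field_simps)
    ultimately show ?thesis by (simp only:) (simp add: algebra_simps)
  qed
  \<comment> \<open>The unknown fourth moment returns on the right with weight 2/4, once from each
    copy, so half of it remains on the left and is thereby determined.\<close>
  ultimately have "(\<integral>x. F x * H x \<partial>gaussian 1) = 1/4 * (2 * (\<integral>x. F x * H x \<partial>gaussian 1)
      + 2 * ((\<integral>x. F x \<partial>gaussian 1) * (\<integral>x. H x \<partial>gaussian 1)) + (\<integral>z. S (fst z) (snd z) * T (fst z) (snd z) \<partial>?G))"
    using FH1 FH2 FH3 FH4 O1 i2 i3 i4 i5 by simp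
  then have *: "(\<integral>x. F x * H x \<partial>gaussian 1) = (\<integral>x. F x \<partial>gaussian 1) * (\<integral>x. H x \<partial>gaussian 1)
      + (\<Sum>a\<in>Basis. \<Sum>b\<in>Basis. S a b * T a b) / 2"
    by (simp add: integral_gaussian_bilinear_mult[OF S T])
  define f where "f = (\<Sum>b\<in>Basis. B b b)"
  define h where "h = (\<Sum>b\<in>Basis. D b b)"
  have f: "(\<integral>x. F x \<partial>gaussian 1) = f" and h: "(\<integral>x. H x \<partial>gaussian 1) = h"
    by (simp_all add: F_def H_def f_def h_def integral_gaussian_bilinear B D)
  have "(\<integral>x. quad_form B x * quad_form D x \<partial>gaussian 1) = (\<integral>x. F x * H x - f * H x - h * F x + f * h \<partial>gaussian 1)"
    by (intro Bochner_Integration.integral_cong refl)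
      (simp add: quad_form_def F_def H_def f_def h_def algebra_simps)
  also have "\<dots> = (\<integral>x. F x * H x \<partial>gaussian 1) - f * h"
    using iF iH iFH f h prob_space by simp
  finally show ?thesis
    using * f h by (simp add: S_def T_def)
qed

section \<open>The splitting scheme\<close>

text \<open>This is the conservative part of a drift in abstract form. The reversed dynamics, with
  \<open>R\<close> negated, is an instance of the same locale.\<close>

locale skew_linear =
  fixes R :: "'b::euclidean_space \<Rightarrow> 'b"
  assumes linear_R: "linear R" and skew_R: "x \<bullet> R x = 0"
begin

lemma skew_R': "R x \<bullet> x = 0"
  using skew_R by (simp add: inner_commute)

lemma skew_linear_neg: "skew_linear (\<lambda>x. - R x)"
  by unfold_locales (use linear_R skew_R in \<open>auto simp: linear_iff\<close>)

end

text \<open>This is the rational map (I - k R)^(-1) (I + k R), an approximation of exp(2 k R) that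
  is exactly orthogonal for skew \<open>R\<close>. Because of the factor 2, the parameter
  \<open>h / 4\<close> corresponds to half a time step.\<close>

definition cayley :: "real \<Rightarrow> ('b::euclidean_space \<Rightarrow> 'b) \<Rightarrow> 'b \<Rightarrow> 'b" where
  "cayley k R x = (THE y. y - k *\<^sub>R R y = x + k *\<^sub>R R x)"

context skew_linear begin

lemma linear_resolvent: "linear (\<lambda>y. y - k *\<^sub>R R y)"
  using linear_R by (intro linear_compose_sub linear_compose_scale_right) (auto intro: linear_ident)

lemma inj_resolvent: "inj (\<lambda>y. y - k *\<^sub>R R y)"
proof -
  have "y = 0" if "y - k *\<^sub>R R y = 0" for y
  proof -
    have "y \<bullet> (y - k *\<^sub>R R y) = 0" using that by simp
    then show "y = 0" by (simp add: inner_diff_right skew_R)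
  qed
  then show ?thesis using linear_injective_0[OF linear_resolvent[of k]] by blast
qed

lemma ex1_cayley: "\<exists>!y. y - k *\<^sub>R R y = x + k *\<^sub>R R x"
proof -
  have "surj (\<lambda>y. y - k *\<^sub>R R y)"
    using linear_injective_imp_surjective[OF linear_resolvent inj_resolvent] by simp
  then obtain y where "x + k *\<^sub>R R x = y - k *\<^sub>R R y" by (rule surjE)
  moreover have "y' = y" if "y' - k *\<^sub>R R y' = y - k *\<^sub>R R y" for y y'
    using inj_resolvent[of k] that by (auto dest: injD)
  ultimately show ?thesis by metis
qed

lemma cayley_eq: "cayley k R x - k *\<^sub>R R (cayley k R x) = x + k *\<^sub>R R x"
  unfolding cayley_def by (rule theI'[OF ex1_cayley])

lemma cayley_unique: "y - k *\<^sub>R R y = x + k *\<^sub>R R x \<Longrightarrow> cayley k R x = y"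
  unfolding cayley_def by (rule the1_equality[OF ex1_cayley])

lemma cayley_diff: "cayley k R x - x = k *\<^sub>R R (cayley k R x + x)"
  using cayley_eq[of k x] linear_add[OF linear_R, of "cayley k R x" x] by (simp add: algebra_simps)

lemma linear_cayley: "linear (cayley k R)"
proof (rule linearI)
  show "cayley k R (x + y) = cayley k R x + cayley k R y" for x y
  proof (rule cayley_unique)
    show "cayley k R x + cayley k R y - k *\<^sub>R R (cayley k R x + cayley k R y) = x + y + k *\<^sub>R R (x + y)"
      by (simp add: linear_add[OF linear_R] scaleR_right_distrib add_diff_add cayley_eq add_ac)
  qed
  show "cayley k R (c *\<^sub>R x) = c *\<^sub>R cayley k R x" for c x
  proof (rule cayley_unique)
    have "c *\<^sub>R (cayley k R x - k *\<^sub>R R (cayley k R x)) = c *\<^sub>R (x + k *\<^sub>R R x)" by (simp add: cayley_eq)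
    then show "c *\<^sub>R cayley k R x - k *\<^sub>R R (c *\<^sub>R cayley k R x) = c *\<^sub>R x + k *\<^sub>R R (c *\<^sub>R x)"
      by (simp add: linear_scale[OF linear_R] scaleR_right_diff_distrib scaleR_right_distrib mult.commute)
  qed
qed

text \<open>The difference of image and argument is a multiple of \<open>R\<close> applied to their
  sum, and skewness makes it orthogonal to that sum.\<close>

lemma norm_cayley: "norm (cayley k R x) = norm x"
proof -
  have "(cayley k R x - x) \<bullet> (cayley k R x + x) = 0"
    by (simp add: cayley_diff skew_R')
  then have "cayley k R x \<bullet> cayley k R x = x \<bullet> x"
    by (simp add: inner_diff_left inner_diff_right inner_add_right inner_add_left inner_commute)
  then show ?thesis by (simp add: norm_eq_sqrt_inner)
qed

lemma cayley_neg_cayley: "cayley k (\<lambda>x. - R x) (cayley k R x) = x"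
  using cayley_eq[of k x]
  by (intro skew_linear.cayley_unique[OF skew_linear_neg]) (simp add: algebra_simps)

lemma norm_cayley_diff:
  assumes r: "\<And>x. norm (R x) \<le> r * norm x" and "k \<ge> 0"
  shows "norm (cayley k R x - x) \<le> 2 * k * r * norm x"
proof -
  have "0 \<le> r * norm x" using r[of x] norm_ge_zero[of "R x"] by linarith
  have "norm (cayley k R x - x) \<le> k * (norm (R (cayley k R x)) + norm (R x))"
    using \<open>k \<ge> 0\<close> norm_triangle_ineq[of "R (cayley k R x)" "R x"]
    by (simp add: cayley_diff linear_add[OF linear_R] mult_left_mono)
  also have "\<dots> \<le> k * (r * norm x + r * norm x)"
    using \<open>k \<ge> 0\<close> r[of "cayley k R x"] r[of x] by (intro mult_left_mono add_mono) (auto simp: norm_cayley)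
  finally show ?thesis by (simp add: algebra_simps)
qed

text \<open>By \<open>cayley_diff\<close> the remainder is \<open>k\<close> times \<open>R\<close>
  applied to the first-order error, so the first-order bound is simply used once more.\<close>

lemma norm_cayley_diff2:
  assumes r: "\<And>x. norm (R x) \<le> r * norm x" and "k \<ge> 0"
  shows "norm (cayley k R x - x - (2 * k) *\<^sub>R R x) \<le> 2 * k\<^sup>2 * r\<^sup>2 * norm x"
proof (cases "x = 0")
  case True
  then show ?thesis using linear_0[OF linear_cayley] linear_0[OF linear_R] by simp
next
  case False
  then have "r \<ge> 0" using r[of x] norm_ge_zero[of "R x"] by (metis order_trans zero_le_mult_iff
      norm_le_zero_iff)
  have "cayley k R x - x - (2 * k) *\<^sub>R R x = k *\<^sub>R R (cayley k R x - x)"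
    by (subst cayley_diff)
      (simp add: linear_add[OF linear_R] linear_diff[OF linear_R] algebra_simps flip: scaleR_left_distrib)
  also have "norm \<dots> \<le> k * (r * (2 * k * r * norm x))"
    using \<open>k \<ge> 0\<close> \<open>r \<ge> 0\<close> norm_cayley_diff[OF r \<open>k \<ge> 0\<close>, of x] r[of "cayley k R x - x"]
    by (simp add: mult_left_mono order_trans[OF r])
  finally show ?thesis by (simp add: power2_eq_square mult_ac)
qed

end

definition damp :: "real \<Rightarrow> real \<Rightarrow> 'a::euclidean_space \<times> 'a \<Rightarrow> 'a \<times> 'a" where
  "damp \<gamma> h z = (fst z, sqrt (1 - 2 * \<gamma> * h) *\<^sub>R snd z)"

definition noise :: "real \<Rightarrow> 'a::euclidean_space \<Rightarrow> 'a \<times> 'a" where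
  "noise \<gamma> w = (0, sqrt (2 * \<gamma>) *\<^sub>R w)"

text \<open>One step of a symmetric splitting scheme.  The variances \<open>1 - 2 * \<gamma> * h\<close> and \<open>2 * \<gamma> * h\<close> of the
  damped momentum and of the noise add up to 1 and the Cayley transform is orthogonal, so that the
  scheme preserves the standard Gaussian exactly, and reversing it in time replaces \<open>R\<close> by \<open>- R\<close>.\<close>

definition step :: "real \<Rightarrow> real \<Rightarrow> ('a::euclidean_space \<times> 'a \<Rightarrow> 'a \<times> 'a) \<Rightarrow> 'a \<times> 'a \<Rightarrow> 'a \<Rightarrow> 'a \<times> 'a" where
  "step \<gamma> h R z w = cayley (h / 4) R (damp \<gamma> h (cayley (h / 4) R z) + noise \<gamma> w)"

primrec scheme :: "real \<Rightarrow> real \<Rightarrow> ('a::euclidean_space \<times> 'a \<Rightarrow> 'a \<times> 'a) \<Rightarrow> 'a \<times> 'a \<Rightarrow> (nat \<Rightarrow> 'a) \<Rightarrow> nat \<Rightarrow> 'a \<times> 'a" where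
  "scheme \<gamma> h R z w 0 = z"
| "scheme \<gamma> h R z w (Suc n) = step \<gamma> h R (scheme \<gamma> h R z w n) (w n)"

definition drift :: "real \<Rightarrow> ('a::euclidean_space \<times> 'a \<Rightarrow> 'a \<times> 'a) \<Rightarrow> 'a \<times> 'a \<Rightarrow> 'a \<times> 'a" where
  "drift \<gamma> R z = R z - (0, \<gamma> *\<^sub>R snd z)"

section \<open>Stability and local error of one step\<close>

lemma linear_damp: "linear (damp \<gamma> h)"
  by (rule linearI) (auto simp: damp_def algebra_simps)

lemma linear_noise: "linear (noise \<gamma>)"
  by (rule linearI) (auto simp: noise_def algebra_simps)

lemma norm_noise: "\<gamma> \<ge> 0 \<Longrightarrow> norm (noise \<gamma> w) = sqrt (2 * \<gamma>) * norm w"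
  by (simp add: noise_def norm_Pair)

lemma norm_snd_le': "norm (snd z) \<le> norm z"
  by (metis norm_snd_le surjective_pairing)

lemma norm_momentum: "norm (0, \<gamma> *\<^sub>R snd z) \<le> \<bar>\<gamma>\<bar> * norm (z :: 'a::euclidean_space \<times> 'a)"
  using norm_snd_le'[of z] by (simp add: norm_Pair mult_left_mono)

lemma norm_damp:
  assumes "0 \<le> \<gamma> * h" "2 * \<gamma> * h \<le> 1"
  shows "norm (damp \<gamma> h z) \<le> norm z"
  unfolding damp_def norm_Pair norm_prod_def[of z]
proof (rule real_sqrt_le_mono)
  have "norm (sqrt (1 - 2 * \<gamma> * h) *\<^sub>R snd z) \<le> norm (snd z)"
    using assms by (simp add: mult_left_le_one_le)
  then show "(norm (fst z))\<^sup>2 + (norm (sqrt (1 - 2 * \<gamma> * h) *\<^sub>R snd z))\<^sup>2 \<le> (norm (fst z))\<^sup>2 + (norm (snd z))\<^sup>2"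
    by (intro add_left_mono power_mono) auto
qed

text \<open>Put g = \<gamma> h and c = sqrt (1 - 2 g). Then (1 - c) (1 + c) = 2 g gives 1 - c \<le>
  2 g, and 1 - c - g is exactly (1 - c)^2 / 2, hence between 0 and 2 g^2. Damping thus agrees with
  linear friction up to second order.\<close>

lemma norm_damp_diff:
  assumes "0 \<le> \<gamma> * h" "2 * \<gamma> * h \<le> 1"
  shows "norm (damp \<gamma> h z - z) \<le> 2 * \<gamma> * h * norm z"
    and "norm (damp \<gamma> h z - z + h *\<^sub>R (0, \<gamma> *\<^sub>R snd z)) \<le> 2 * \<gamma>\<^sup>2 * h\<^sup>2 * norm z"
proof -
  define g where "g = \<gamma> * h"
  define c where "c = sqrt (1 - 2 * \<gamma> * h)"
  have c: "c \<ge> 0" "c \<le> 1" and c2: "c * c = 1 - 2 * g"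
    using assms by (auto simp: c_def g_def)
  have g: "0 \<le> g" using assms by (simp add: g_def)
  have c1: "(1 - c) * (1 + c) = 2 * g" using c2 by (simp add: algebra_simps)
  moreover have "(1 - c) * 1 \<le> (1 - c) * (1 + c)" using c by (intro mult_left_mono) auto
  ultimately have c3: "1 - c \<le> 2 * g" by simp
  have "2 * (1 - c - g) = (1 - c) * (1 - c)" using c1 by (simp add: algebra_simps c2)
  also have "\<dots> \<le> (2 * g) * (2 * g)" using c c3 g by (intro mult_mono) auto
  finally have c4: "1 - c - g \<le> 2 * g\<^sup>2" by (simp add: power2_eq_square)
  have c5: "0 \<le> 1 - c - g"
  proof -
    have "0 \<le> 2 * (1 - c - g)" unfolding \<open>2 * (1 - c - g) = (1 - c) * (1 - c)\<close> by simp
    then show ?thesis by simp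
  qed
  have "damp \<gamma> h z - z = (0, (c - 1) *\<^sub>R snd z)"
    by (simp add: damp_def c_def prod_eq_iff algebra_simps)
  then have "norm (damp \<gamma> h z - z) = (1 - c) * norm (snd z)"
    using c by (simp add: norm_Pair)
  also have "\<dots> \<le> (2 * g) * norm z" using c c3 by (intro mult_mono norm_snd_le') auto
  finally show "norm (damp \<gamma> h z - z) \<le> 2 * \<gamma> * h * norm z" by (simp add: g_def)
  have "damp \<gamma> h z - z + h *\<^sub>R (0, \<gamma> *\<^sub>R snd z) = (0, - (1 - c - g) *\<^sub>R snd z)"
    by (simp add: damp_def c_def g_def prod_eq_iff algebra_simps)
  then have "norm (damp \<gamma> h z - z + h *\<^sub>R (0, \<gamma> *\<^sub>R snd z)) = (1 - c - g) * norm (snd z)"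
    using c5 by (simp only: norm_Pair) simp
  also have "\<dots> \<le> (2 * g\<^sup>2) * norm z" using c4 c5 by (intro mult_mono norm_snd_le') auto
  finally show "norm (damp \<gamma> h z - z + h *\<^sub>R (0, \<gamma> *\<^sub>R snd z)) \<le> 2 * \<gamma>\<^sup>2 * h\<^sup>2 * norm z"
    by (simp add: g_def power_mult_distrib)
qed

locale langevin_drift = skew_linear R
  for R :: "'a::euclidean_space \<times> 'a \<Rightarrow> 'a \<times> 'a" +
  fixes \<gamma> :: real
  assumes \<gamma>_pos: "\<gamma> > 0"
begin

lemma langevin_drift_neg: "langevin_drift (\<lambda>x. - R x) \<gamma>"
  using skew_linear_neg \<gamma>_pos by (simp add: langevin_drift_def langevin_drift_axioms_def)

lemma linear_drift: "linear (drift \<gamma> R)"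
  using linear_R unfolding linear_iff by (auto simp: drift_def algebra_simps)

lemma step_noise_free: "step \<gamma> h R z w = step \<gamma> h R z 0 + cayley (h / 4) R (noise \<gamma> w)"
  by (simp add: step_def linear_add[OF linear_cayley] linear_0[OF linear_noise] linear_0[OF linear_cayley])

lemma linear_step: "linear (\<lambda>z. step \<gamma> h R z 0)"
  using linear_compose[OF linear_compose[OF linear_cayley linear_damp] linear_cayley, of "h/4" "\<gamma>" h "h/4"]
  by (simp add: step_def linear_0[OF linear_noise] o_def)

lemma norm_step: "\<lbrakk>0 \<le> h; 2 * \<gamma> * h \<le> 1\<rbrakk> \<Longrightarrow> norm (step \<gamma> h R z 0) \<le> norm z"
  using norm_damp[of \<gamma> h "cayley (h / 4) R z"] \<gamma>_pos
  by (simp add: step_def linear_0[OF linear_noise] norm_cayley)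

lemma step_consistent:
  obtains C where "C \<ge> 0" "\<And>h z. \<lbrakk>0 \<le> h; 2 * \<gamma> * h \<le> 1\<rbrakk> \<Longrightarrow>
    norm (step \<gamma> h R z 0 - z - h *\<^sub>R drift \<gamma> R z) \<le> C * h\<^sup>2 * norm z"
proof -
  obtain r where r0: "r > 0" and r: "\<And>x. norm (R x) \<le> r * norm x"
    using linear_bounded_pos[OF linear_R] by blast
  \<comment> \<open>The two half rotations contribute r^2/8 each and the damping 2 \<gamma>^2. The
    last two summands pay for \<open>R\<close> being evaluated at the damped point \<open>v\<close>,
    and friction at the rotated point \<open>u\<close>, instead of \<open>z\<close>.\<close>
  let ?C = "2 * (r\<^sup>2 / 8) + 2 * \<gamma>\<^sup>2 + r * (2 * \<gamma> + r / 2) / 2 + \<gamma> * r / 2"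
  show thesis
  proof (rule that[of ?C])
    show "?C \<ge> 0" using r0 \<gamma>_pos by simp
    fix h :: real and z :: "'a \<times> 'a"
    assume h: "0 \<le> h" "2 * \<gamma> * h \<le> 1"
    have gh: "0 \<le> \<gamma> * h" using h \<gamma>_pos by simp
    let ?V = "cayley (h / 4) R" and ?G = "\<lambda>x. (0, \<gamma> *\<^sub>R snd x) :: 'a \<times> 'a"
    define u where "u = ?V z"
    define v where "v = damp \<gamma> h u"
    have st: "step \<gamma> h R z 0 = ?V v"
      by (simp add: step_def linear_0[OF linear_noise] u_def v_def)
    have nu: "norm u = norm z" by (simp add: u_def norm_cayley)
    have nv: "norm v \<le> norm z" using norm_damp[OF gh h(2), of u] nu by (simp add: v_def)
    have 1: "norm (u - z) \<le> r / 2 * h * norm z"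
      using norm_cayley_diff[OF r, of "h / 4" z] h by (simp add: u_def mult_ac)
    have 2: "norm (u - z - (h / 2) *\<^sub>R R z) \<le> r\<^sup>2 / 8 * h\<^sup>2 * norm z"
      using norm_cayley_diff2[OF r, of "h / 4" z] h by (simp add: u_def power_divide field_simps)
    have 3: "norm (?V v - v - (h / 2) *\<^sub>R R v) \<le> r\<^sup>2 / 8 * h\<^sup>2 * norm z"
    proof -
      have "norm (?V v - v - (h / 2) *\<^sub>R R v) \<le> r\<^sup>2 / 8 * h\<^sup>2 * norm v"
        using norm_cayley_diff2[OF r, of "h / 4" v] h by (simp add: power_divide field_simps)
      also have "\<dots> \<le> r\<^sup>2 / 8 * h\<^sup>2 * norm z" using nv by (intro mult_left_mono) auto
      finally show ?thesis .
    qed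
    have 4: "norm (v - u) \<le> 2 * \<gamma> * h * norm z" "norm (v - u + h *\<^sub>R ?G u) \<le> 2 * \<gamma>\<^sup>2 * h\<^sup>2 * norm z"
      using norm_damp_diff[OF gh h(2), of u] nu by (auto simp: v_def)
    have 5: "norm (v - z) \<le> (2 * \<gamma> + r / 2) * h * norm z"
      using norm_triangle_ineq[of "v - u" "u - z"] 1 4(1) by (simp add: algebra_simps)
    have 6: "norm ((h / 2) *\<^sub>R R (v - z)) \<le> r * (2 * \<gamma> + r / 2) / 2 * h\<^sup>2 * norm z"
    proof -
      have "norm ((h / 2) *\<^sub>R R (v - z)) \<le> (h / 2) * (r * ((2 * \<gamma> + r / 2) * h * norm z))"
        using h r0 by (auto intro!: mult_left_mono order_trans[OF r] 5)
      then show ?thesis by (simp add: power2_eq_square mult_ac)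
    qed
    have 7: "norm (h *\<^sub>R ?G (u - z)) \<le> \<gamma> * r / 2 * h\<^sup>2 * norm z"
    proof -
      have "norm (h *\<^sub>R ?G (u - z)) = h * norm (?G (u - z))" using h by (simp only: norm_scaleR)
      also have "\<dots> \<le> h * (\<gamma> * norm (u - z))"
        using h \<gamma>_pos norm_momentum[of \<gamma> "u - z"] by (intro mult_left_mono) auto
      also have "\<dots> \<le> h * (\<gamma> * (r / 2 * h * norm z))"
        using h \<gamma>_pos 1 by (intro mult_left_mono) auto
      finally show ?thesis by (simp add: power2_eq_square mult_ac)
    qed
    \<comment> \<open>The increments telescope along \<open>z\<close>, \<open>u\<close>,
      \<open>v\<close> and \<open>?V v\<close>; the last two terms move \<open>R\<close> and
      friction back to \<open>z\<close>.\<close>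
    have "step \<gamma> h R z 0 - z - h *\<^sub>R drift \<gamma> R z =
      ((((?V v - v - (h / 2) *\<^sub>R R v) + (v - u + h *\<^sub>R ?G u)) + (u - z - (h / 2) *\<^sub>R R z))
        + (h / 2) *\<^sub>R R (v - z)) - h *\<^sub>R ?G (u - z)"
      by (simp add: st drift_def linear_diff[OF linear_R] prod_eq_iff scaleR_right_diff_distrib
          algebra_simps flip: scaleR_left_distrib)
    also have "norm \<dots> \<le> (((r\<^sup>2 / 8 * h\<^sup>2 * norm z + 2 * \<gamma>\<^sup>2 * h\<^sup>2 * norm z) + r\<^sup>2 / 8 * h\<^sup>2 * norm z)
       + r * (2 * \<gamma> + r / 2) / 2 * h\<^sup>2 * norm z) + \<gamma> * r / 2 * h\<^sup>2 * norm z"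
      by (intro order_trans[OF norm_triangle_ineq4] order_trans[OF norm_triangle_ineq] add_mono 2 3 4 6 7)
    finally show "norm (step \<gamma> h R z 0 - z - h *\<^sub>R drift \<gamma> R z) \<le> ?C * h\<^sup>2 * norm z"
      by (simp add: algebra_simps)
  qed
qed

end

section \<open>Pathwise convergence of the scheme\<close>

text \<open>Since the noise is additive, the equation makes sense for a single path
  \<open>w\<close>, and probability can be left out until the laws are compared.\<close>

definition path_solution :: "real \<Rightarrow> ('a::euclidean_space \<times> 'a \<Rightarrow> 'a \<times> 'a) \<Rightarrow> (real \<Rightarrow> 'a) \<Rightarrow> 'a \<times> 'a
    \<Rightarrow> (real \<Rightarrow> 'a \<times> 'a) \<Rightarrow> bool" where
  "path_solution \<gamma> R w z x \<longleftrightarrow> continuous_on {0..} x \<and>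
     (\<forall>t\<ge>0. ((\<lambda>s. drift \<gamma> R (x s)) has_integral (x t - z - noise \<gamma> (w t))) {0..t})"

lemma has_integral_increment:
  fixes f F :: "real \<Rightarrow> 'b::euclidean_space"
  assumes f: "\<And>t. t \<ge> 0 \<Longrightarrow> (f has_integral F t) {0..t}" and ab: "0 \<le> a" "a \<le> b"
  shows "(f has_integral F b - F a) {a..b}"
proof -
  have i: "f integrable_on {0..b}" using f[of b] ab by (auto simp: has_integral_integrable)
  then have "f integrable_on {a..b}"
    by (rule integrable_on_subinterval) (use ab in auto)
  moreover have "integral {0..a} f + integral {a..b} f = integral {0..b} f"
    by (rule Henstock_Kurzweil_Integration.integral_combine[OF ab i])
  moreover have "integral {0..a} f = F a" "integral {0..b} f = F b"
    using f[of a] f[of b] ab by (auto intro!: integral_unique)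
  ultimately show ?thesis
    by (metis add_diff_cancel_left' has_integral_integral)
qed

context langevin_drift begin

lemma drift_bound:
  obtains a where "a > 0" "\<And>x. norm (drift \<gamma> R x) \<le> a * norm x"
  using linear_bounded_pos[OF linear_drift] by blast

lemma path_solution_0: "path_solution \<gamma> R w z x \<Longrightarrow> x 0 = z + noise \<gamma> (w 0)"
proof -
  assume "path_solution \<gamma> R w z x"
  then have "((\<lambda>s. drift \<gamma> R (x s)) has_integral (x 0 - z - noise \<gamma> (w 0))) {0..0}"
    by (auto simp: path_solution_def)
  then have "x 0 - z - noise \<gamma> (w 0) = 0"
    by (intro has_integral_unique[OF _ has_integral_refl(2)[of "\<lambda>s. drift \<gamma> R (x s)" 0]]) simp
  then show ?thesis by (simp add: algebra_simps)
qed

text \<open>Stability and consistency: the noise-free step does not increase norms, so local errors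
  merely add up. As \<open>w\<close> is only continuous, the local error is not of order h^2 but
  \<open>h * E\<close> with \<open>E\<close> small by uniform continuity, and no rate is
  obtained.\<close>

lemma scheme_converges:
  assumes sol: "path_solution \<gamma> R w z x" and w: "continuous_on {0..} w" "w 0 = 0" and t: "t > 0"
  shows "(\<lambda>n. scheme \<gamma> (t / real n) R z
      (\<lambda>i. w (real (Suc i) * (t / real n)) - w (real i * (t / real n))) n) \<longlonglongrightarrow> x t"
proof -
  obtain r where r0: "r > 0" and r: "\<And>x. norm (R x) \<le> r * norm x"
    using linear_bounded_pos[OF linear_R] by blast
  obtain a where a0: "a > 0" and a: "\<And>x. norm (drift \<gamma> R x) \<le> a * norm x"
    using drift_bound by blast
  obtain C where C0: "C \<ge> 0" and C: "\<And>h z. \<lbrakk>0 \<le> h; 2 * \<gamma> * h \<le> 1\<rbrakk> \<Longrightarrow>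
    norm (step \<gamma> h R z 0 - z - h *\<^sub>R drift \<gamma> R z) \<le> C * h\<^sup>2 * norm z"
    using step_consistent by blast
  have xc: "continuous_on {0..t} x" and wc: "continuous_on {0..t} w"
    using sol w by (auto simp: path_solution_def elim: continuous_on_subset)
  obtain M where M: "\<And>s. s \<in> {0..t} \<Longrightarrow> norm (x s) \<le> M" and M0: "M > 0"
  proof -
    have "bounded (x ` {0..t})" using compact_continuous_image[OF xc compact_Icc] by (rule compact_imp_bounded)
    then show thesis using that unfolding bounded_pos by (meson image_eqI)
  qed
  have inc: "((\<lambda>s. drift \<gamma> R (x s)) has_integral (x v - noise \<gamma> (w v)) - (x u - noise \<gamma> (w u))) {u..v}"
    if "0 \<le> u" "u \<le> v" for u v
    using has_integral_increment[of "\<lambda>s. drift \<gamma> R (x s)" "\<lambda>t. x t - z - noise \<gamma> (w t)" u v] sol that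
    by (simp add: path_solution_def algebra_simps)
  let ?q = "sqrt (2 * \<gamma>)"
  have q: "?q > 0" using \<gamma>_pos by simp
  show ?thesis
  proof (rule LIMSEQ_I)
    fix e :: real assume e: "e > 0"
    \<comment> \<open>The summand \<open>a\<close> pays for freezing the drift at the left end of a
      step, and \<open>r * ?q / 2\<close> for the half rotation that the scheme applies to the
      noise. The choice of \<open>\<eta>\<close> makes their joint contribution over the whole time
      e/4.\<close>
    define k where "k = a + r * ?q / 2"
    have k: "k > 0" using a0 r0 q by (simp add: k_def add_pos_pos)
    define \<eta> where "\<eta> = e / (4 * t * k)"
    have \<eta>: "\<eta> > 0" "t * (k * \<eta>) = e / 4" using e t k by (auto simp: \<eta>_def)
    obtain d1 where d1: "d1 > 0" "\<And>u v. \<lbrakk>u \<in> {0..t}; v \<in> {0..t}; dist v u < d1\<rbrakk> \<Longrightarrow> dist (x v) (x u) < \<eta>"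
      using compact_uniformly_continuous[OF xc compact_Icc] \<eta>(1) unfolding uniformly_continuous_on_def by metis
    obtain d2 where d2: "d2 > 0" "\<And>u v. \<lbrakk>u \<in> {0..t}; v \<in> {0..t}; dist v u < d2\<rbrakk> \<Longrightarrow> dist (w v) (w u) < \<eta>"
      using compact_uniformly_continuous[OF wc compact_Icc] \<eta>(1) unfolding uniformly_continuous_on_def by metis
    \<comment> \<open>The four entries control the oscillation of \<open>x\<close>, the oscillation
      of \<open>w\<close>, the stability of the step, and its local error. Adding 1 to
      \<open>C * M\<close> keeps the last denominator positive when \<open>C\<close> is 0.\<close>
    define d where "d = Min {d1, d2, 1 / (2 * \<gamma>), e / (4 * t * (C * M + 1))}"
    have CM: "C * M + 1 > 0" using C0 M0 by (simp add: add_nonneg_pos)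
    have d0: "d > 0" using d1 d2 e t CM \<gamma>_pos by (simp add: d_def)
    have "(\<lambda>n. t / real n) \<longlonglongrightarrow> 0" by (rule lim_const_over_n)
    then have "eventually (\<lambda>n. t / real n < d) sequentially"
      using d0 order_tendstoD(2) by blast
    then obtain N where N: "\<And>n. n \<ge> N \<Longrightarrow> t / real n < d" by (auto simp: eventually_sequentially)
    show "\<exists>no. \<forall>n\<ge>no. norm (scheme \<gamma> (t / real n) R z
      (\<lambda>i. w (real (Suc i) * (t / real n)) - w (real i * (t / real n))) n - x t) < e"
    proof (intro exI[of _ "max N 1"] allI impI)
      fix n :: nat assume n: "max N 1 \<le> n"
      define h where "h = t / real n"
      have h0: "h > 0" and nh: "real n * h = t" using n t by (auto simp: h_def)
      have hd: "h < d" using N n by (simp add: h_def)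
      have h1: "h < d1" "h < d2" "h < 1 / (2 * \<gamma>)" "h < e / (4 * t * (C * M + 1))"
        using hd by (auto simp: d_def)
      have h\<gamma>: "2 * \<gamma> * h \<le> 1" using h1(3) \<gamma>_pos by (simp add: field_simps)
      have hCM: "t * (C * M * h) \<le> e / 4"
      proof -
        have "t * (C * M * h) \<le> t * ((C * M + 1) * h)" using t h0 by (intro mult_left_mono mult_right_mono) auto
        also have "\<dots> = (t * (C * M + 1)) * h" by simp
        also have "\<dots> \<le> (t * (C * M + 1)) * (e / (4 * t * (C * M + 1)))"
          using h1(4) t CM by (intro mult_left_mono) auto
        also have "\<dots> = e / 4"
        proof -
          have "t * D * (e / (4 * t * D)) = e / 4" if "D > 0" for D using t that by simp
          then show ?thesis using CM .
        qed
        finally show ?thesis .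
      qed
      let ?w = "\<lambda>i. w (real (Suc i) * h) - w (real i * h)"
      let ?S = "scheme \<gamma> h R z ?w"
      define E where "E = C * M * h + k * \<eta>"
      have main: "norm (x (real j * h) - ?S j) \<le> real j * (h * E)" if "j \<le> n" for j
        using that
      proof (induction j)
        case 0
        then show ?case using path_solution_0[OF sol] w linear_0[OF linear_noise] by simp
      next
        case (Suc j)
        define u where "u = real j * h"
        define v where "v = real (Suc j) * h"
        have uv: "0 \<le> u" "u \<le> v" "v - u = h" using h0 by (auto simp: u_def v_def algebra_simps)
        have "v \<le> t"
          using Suc.prems h0 nh mult_right_mono[of "real (Suc j)" "real n" h] by (simp add: v_def)
        then have ut: "u \<in> {0..t}" and vt: "v \<in> {0..t}" using uv by auto
        define \<Delta> where "\<Delta> = w v - w u"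
        have n\<Delta>: "norm \<Delta> \<le> \<eta>"
          using d2(2)[OF ut vt] uv h0 h1 by (simp add: \<Delta>_def dist_norm)
        have A: "norm (step \<gamma> h R (x u) 0 - x u - h *\<^sub>R drift \<gamma> R (x u)) \<le> C * h\<^sup>2 * M"
          using C[of h "x u"] h0 h\<gamma> M[OF ut] C0 by (meson less_imp_le mult_left_mono mult_nonneg_nonneg order_trans zero_le_power2)
        have B: "norm ((x v - x u - noise \<gamma> \<Delta>) - h *\<^sub>R drift \<gamma> R (x u)) \<le> (a * \<eta>) * h"
        proof -
          have "((\<lambda>s. drift \<gamma> R (x s) - drift \<gamma> R (x u)) has_integral
              ((x v - noise \<gamma> (w v)) - (x u - noise \<gamma> (w u))) - (v - u) *\<^sub>R drift \<gamma> R (x u)) {u..v}"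
            using has_integral_diff[OF inc[OF uv(1,2)] has_integral_const_real[of "drift \<gamma> R (x u)" u v]] uv by simp
          moreover have "norm (drift \<gamma> R (x s) - drift \<gamma> R (x u)) \<le> a * \<eta>" if "s \<in> {u..v}" for s
          proof -
            have "dist (x s) (x u) < \<eta>"
              using that uv h1 vt by (intro d1(2)[OF ut]) (auto simp: dist_norm)
            then have "a * norm (x s - x u) \<le> a * \<eta>" using a0 by (simp add: dist_norm)
            then show ?thesis using a[of "x s - x u"] by (simp add: linear_diff[OF linear_drift])
          qed
          ultimately have "norm (((x v - noise \<gamma> (w v)) - (x u - noise \<gamma> (w u))) - (v - u) *\<^sub>R drift \<gamma> R (x u))
              \<le> (a * \<eta>) * measure lborel {u..v}"
            using a0 \<eta> by (intro has_integral_bound_real[where f="\<lambda>s. drift \<gamma> R (x s) - drift \<gamma> R (x u)" and S="{}"]) auto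
          then show ?thesis using uv
            by (simp add: \<Delta>_def linear_diff[OF linear_noise] algebra_simps)
        qed
        have D: "norm (cayley (h / 4) R (noise \<gamma> \<Delta>) - noise \<gamma> \<Delta>) \<le> (r * ?q / 2 * \<eta>) * h"
        proof -
          have "norm (cayley (h / 4) R (noise \<gamma> \<Delta>) - noise \<gamma> \<Delta>) \<le> 2 * (h / 4) * r * (?q * norm \<Delta>)"
            using norm_cayley_diff[OF r, of "h / 4" "noise \<gamma> \<Delta>"] h0 \<gamma>_pos by (simp add: norm_noise)
          also have "\<dots> \<le> 2 * (h / 4) * r * (?q * \<eta>)"
            using h0 r0 q n\<Delta> by (intro mult_left_mono) auto
          finally show ?thesis by (simp add: field_simps)
        qed
        have S: "?S (Suc j) = step \<gamma> h R (?S j) 0 + cayley (h / 4) R (noise \<gamma> \<Delta>)"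
          using step_noise_free[of h "?S j" "?w j"] by (simp add: \<Delta>_def u_def v_def)
        have IH: "norm (x u - ?S j) \<le> real j * (h * E)" using Suc by (simp add: u_def)
        have G: "norm (step \<gamma> h R (x u - ?S j) 0) \<le> real j * (h * E)"
          using norm_step[of h "x u - ?S j"] h0 h\<gamma> IH by simp
        \<comment> \<open>The four terms are the propagated error, the local error of the step at
          the exact solution, the oscillation of the drift, and the rotation of the noise.\<close>
        have "x v - ?S (Suc j) = step \<gamma> h R (x u - ?S j) 0
           - (step \<gamma> h R (x u) 0 - x u - h *\<^sub>R drift \<gamma> R (x u))
           + ((x v - x u - noise \<gamma> \<Delta>) - h *\<^sub>R drift \<gamma> R (x u))
           - (cayley (h / 4) R (noise \<gamma> \<Delta>) - noise \<gamma> \<Delta>)"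
          unfolding S linear_diff[OF linear_step] by simp
        also have "norm \<dots> \<le> real j * (h * E) + C * h\<^sup>2 * M + (a * \<eta>) * h + (r * ?q / 2 * \<eta>) * h"
          by (intro order_trans[OF norm_triangle_ineq4] order_trans[OF norm_triangle_ineq] add_mono A B D G)
        also have "\<dots> = real (Suc j) * (h * E)"
          by (simp add: E_def k_def power2_eq_square algebra_simps)
        finally show ?case by (simp add: v_def)
      qed
      have "norm (x t - ?S n) \<le> t * E" using main[of n] nh by (simp add: mult.assoc[symmetric])
      also have "\<dots> = t * (C * M * h) + t * (k * \<eta>)" by (simp add: E_def algebra_simps)
      also have "\<dots> < e" using hCM \<eta> e by simp
      finally show "norm (scheme \<gamma> (t / real n) R z
      (\<lambda>i. w (real (Suc i) * (t / real n)) - w (real i * (t / real n))) n - x t) < e"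
        by (simp add: h_def norm_minus_commute)
    qed
  qed
qed

section \<open>The flow without noise\<close>

definition noise_free :: "real \<Rightarrow> nat \<Rightarrow> 'a \<times> 'a \<Rightarrow> 'a \<times> 'a" where
  "noise_free h n = (\<lambda>y. step \<gamma> h R y 0) ^^ n"

text \<open>The step is affine, so the initial value and the noise separate. For two solutions with
  the same noise the noise cancels already in the scheme.\<close>

lemma scheme_noise_free: "scheme \<gamma> h R z w n = noise_free h n z + scheme \<gamma> h R 0 w n"
proof (induction n)
  case 0
  then show ?case by (simp add: noise_free_def)
next
  case (Suc n)
  then show ?case
    using step_noise_free[of h "scheme \<gamma> h R 0 w n" "w n"]
    by (simp add: step_noise_free[of h _ "w n"] linear_add[OF linear_step] noise_free_def)
qed

lemma linear_noise_free: "linear (noise_free h n)"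
  unfolding noise_free_def
proof (induction n)
  case (Suc n)
  then show ?case using linear_compose[OF Suc linear_step] by (simp add: o_def)
qed (simp add: linear_iff)

lemma norm_noise_free: "\<lbrakk>0 \<le> h; 2 * \<gamma> * h \<le> 1\<rbrakk> \<Longrightarrow> norm (noise_free h n z) \<le> norm z"
  unfolding noise_free_def by (induction n) (auto intro: order_trans[OF norm_step])

text \<open>Defined as a limit of the scheme; \<open>flow_eq\<close> identifies it as the flow of the equation without noise.\<close>

definition flow :: "real \<Rightarrow> 'a \<times> 'a \<Rightarrow> 'a \<times> 'a" where
  "flow t z = lim (\<lambda>n. noise_free (t / real n) n z)"

lemma noise_free_converges:
  assumes "path_solution \<gamma> R w z x" "path_solution \<gamma> R w 0 x0"
    and w: "continuous_on {0..} w" "w 0 = 0" and t: "t > 0"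
  shows "(\<lambda>n. noise_free (t / real n) n z) \<longlonglongrightarrow> x t - x0 t"
proof -
  have "(\<lambda>n. scheme \<gamma> (t / real n) R z
      (\<lambda>i. w (real (Suc i) * (t / real n)) - w (real i * (t / real n))) n - scheme \<gamma> (t / real n) R 0
      (\<lambda>i. w (real (Suc i) * (t / real n)) - w (real i * (t / real n))) n) \<longlonglongrightarrow> x t - x0 t"
    by (intro tendsto_diff scheme_converges assms)
  then show ?thesis by (simp add: scheme_noise_free[of _ z])
qed

lemma flow_eq:
  assumes "path_solution \<gamma> R w z x" "path_solution \<gamma> R w 0 x0"
    and "continuous_on {0..} w" "w 0 = 0" and "t > 0"
  shows "flow t z = x t - x0 t"
  unfolding flow_def by (rule limI[OF noise_free_converges[OF assms]])

end

text \<open>Existence of the flow is taken from the given process instead of the theory of ordinary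
  differential equations: for each \<open>z\<close> a single noise path carrying solutions from
  \<open>z\<close> and from 0 suffices, and their difference solves the noise-free equation.\<close>

locale langevin_flow = langevin_drift R \<gamma>
  for R :: "'a::euclidean_space \<times> 'a \<Rightarrow> 'a \<times> 'a" and \<gamma> :: real +
  assumes ex_path: "\<exists>w x x0. continuous_on {0..} w \<and> w 0 = 0 \<and> path_solution \<gamma> R w z x \<and> path_solution \<gamma> R w 0 x0"
begin

lemma flow_limit:
  assumes "t > 0"
  shows "(\<lambda>n. noise_free (t / real n) n z) \<longlonglongrightarrow> flow t z"
proof -
  obtain w x x0 where "continuous_on {0..} w" "w 0 = 0" "path_solution \<gamma> R w z x" "path_solution \<gamma> R w 0 x0"
    using ex_path by blast
  with assms show ?thesis
    using noise_free_converges[of w z x x0 t] flow_eq[of w z x x0 t] by simp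
qed

lemma linear_flow:
  assumes "t > 0"
  shows "linear (flow t)"
proof (rule linearI)
  fix x y c
  show "flow t (x + y) = flow t x + flow t y"
    using tendsto_add[OF flow_limit[OF assms, of x] flow_limit[OF assms, of y]]
    by (intro LIMSEQ_unique[OF flow_limit[OF assms]]) (simp add: linear_add[OF linear_noise_free])
  show "flow t (c *\<^sub>R x) = c *\<^sub>R flow t x"
    using tendsto_scaleR[OF tendsto_const flow_limit[OF assms, of x]]
    by (intro LIMSEQ_unique[OF flow_limit[OF assms]]) (simp add: linear_scale[OF linear_noise_free])
qed

lemma norm_flow:
  assumes t: "t > 0"
  shows "norm (flow t z) \<le> norm z"
proof (rule LIMSEQ_le_const2[OF tendsto_norm[OF flow_limit[OF t]]])
  have "(\<lambda>n. t / real n) \<longlonglongrightarrow> 0" by (rule lim_const_over_n)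
  then have "eventually (\<lambda>n. t / real n < 1 / (2 * \<gamma>)) sequentially"
    using \<gamma>_pos order_tendstoD(2) by (metis divide_pos_pos mult_pos_pos zero_less_numeral zero_less_one)
  then obtain N where N: "\<And>n. n \<ge> N \<Longrightarrow> t / real n < 1 / (2 * \<gamma>)" by (auto simp: eventually_sequentially)
  show "\<exists>N. \<forall>n\<ge>N. norm (noise_free (t / real n) n z) \<le> norm z"
  proof (intro exI[of _ N] allI impI)
    fix n assume "n \<ge> N"
    then have "2 * \<gamma> * (t / real n) \<le> 1"
      using N[of n] \<gamma>_pos by (metis less_imp_le mult.commute pos_le_divide_eq mult_pos_pos zero_less_numeral)
    then show "norm (noise_free (t / real n) n z) \<le> norm z"
      using t by (intro norm_noise_free) auto
  qed
qed

text \<open>In the difference of two solutions with common noise the noise cancels. The integrand is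
  bounded through \<open>norm_flow\<close>, which gives the first estimate; inserting that estimate
  into the integral equation gives the second.\<close>

lemma flow_derivative:
  assumes a: "\<And>x. norm (drift \<gamma> R x) \<le> a * norm x" and a0: "a \<ge> 0" and t: "t > 0"
  shows "norm (flow t z - z) \<le> a * t * norm z"
    and "norm (flow t z - z - t *\<^sub>R drift \<gamma> R z) \<le> a\<^sup>2 * t\<^sup>2 * norm z"
proof -
  obtain w x x0 where p: "continuous_on {0..} w" "w 0 = 0" "path_solution \<gamma> R w z x" "path_solution \<gamma> R w 0 x0"
    using ex_path by blast
  define v where "v s = x s - x0 s" for s
  have v: "v s = flow s z" if "s > 0" for s
    using flow_eq[OF p(3,4,1,2) that] by (simp add: v_def)
  have v0: "v 0 = z"
    using path_solution_0[OF p(3)] path_solution_0[OF p(4)] by (simp add: v_def)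
  have nv: "norm (v s) \<le> norm z" if "s \<ge> 0" for s
    using norm_flow[of s z] v[of s] v0 that by (cases "s = 0") auto
  have hi: "((\<lambda>s. drift \<gamma> R (v s)) has_integral (v s - z)) {0..s}" if "s \<ge> 0" for s
  proof -
    have "((\<lambda>s. drift \<gamma> R (x s) - drift \<gamma> R (x0 s)) has_integral
        (x s - z - noise \<gamma> (w s)) - (x0 s - 0 - noise \<gamma> (w s))) {0..s}"
      using p(3,4) that unfolding path_solution_def by (intro has_integral_diff) auto
    then show ?thesis by (simp add: v_def linear_diff[OF linear_drift] algebra_simps)
  qed
  have b: "norm (v s - z) \<le> a * s * norm z" if s: "s \<ge> 0" for s
  proof -
    have "norm (v s - z) \<le> (a * norm z) * measure lborel {0..s}"
    proof (rule has_integral_bound_real[where S="{}", OF _ _ hi[OF s]])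
      show "norm (drift \<gamma> R (v u)) \<le> a * norm z" if "u \<in> {0..s} - {}" for u
        using that nv[of u] a[of "v u"] a0 by (meson Diff_iff atLeastAtMost_iff mult_left_mono order_trans)
    qed (use a0 in auto)
    then show ?thesis using s by (simp add: mult_ac)
  qed
  show "norm (flow t z - z) \<le> a * t * norm z"
    using b[of t] t v[of t] by simp
  have "((\<lambda>s. drift \<gamma> R (v s) - drift \<gamma> R z) has_integral (v t - z) - t *\<^sub>R drift \<gamma> R z) {0..t}"
    using has_integral_diff[OF hi[of t] has_integral_const_real[of "drift \<gamma> R z" 0 t]] t by simp
  note hi2 = this
  have "norm ((v t - z) - t *\<^sub>R drift \<gamma> R z) \<le> (a * (a * t * norm z)) * measure lborel {0..t}"
  proof (rule has_integral_bound_real[where S="{}", OF _ _ hi2])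
    fix u assume u: "u \<in> {0..t} - {}"
    have "norm (drift \<gamma> R (v u) - drift \<gamma> R z) \<le> a * norm (v u - z)"
      using a[of "v u - z"] by (simp add: linear_diff[OF linear_drift])
    also have "\<dots> \<le> a * (a * u * norm z)" using b[of u] u a0 by (intro mult_left_mono) auto
    also have "\<dots> \<le> a * (a * t * norm z)" using u a0 by (intro mult_left_mono mult_right_mono) auto
    finally show "norm (drift \<gamma> R (v u) - drift \<gamma> R z) \<le> a * (a * t * norm z)" .
  qed (use a0 t in auto)
  then show "norm (flow t z - z - t *\<^sub>R drift \<gamma> R z) \<le> a\<^sup>2 * t\<^sup>2 * norm z"
    using t v[of t] by (simp add: power2_eq_square mult_ac)
qed

end

section \<open>The law of the process\<close>

context langevin_drift begin

lemma step_measurable [measurable (raw)]: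
  assumes [measurable]: "f \<in> borel_measurable N" "g \<in> borel_measurable N"
  shows "(\<lambda>x. step \<gamma> h R (f x) (g x)) \<in> borel_measurable N"
proof -
  note [measurable] = linear_borel_measurable[OF linear_cayley] linear_borel_measurable[OF linear_damp]
    linear_borel_measurable[OF linear_noise]
  show ?thesis unfolding step_def by measurable
qed

text \<open>This is the Markov operator of one step. Values in \<open>ennreal\<close> let duality
  and iteration proceed without integrability conditions.\<close>

definition transition :: "real \<Rightarrow> ('a \<times> 'a \<Rightarrow> ennreal) \<Rightarrow> 'a \<times> 'a \<Rightarrow> ennreal" where
  "transition h \<psi> z = (\<integral>\<^sup>+w. \<psi> (step \<gamma> h R z w) \<partial>gaussian h)"

lemma transition_measurable [measurable]:
  assumes "h > 0" and [measurable]: "\<psi> \<in> borel_measurable borel"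
  shows "transition h \<psi> \<in> borel_measurable borel"
proof -
  interpret prob_space "gaussian h :: 'a measure" by (rule prob_space_gaussian) fact
  show ?thesis unfolding transition_def by measurable
qed

lemma transition_funpow_measurable:
  "\<lbrakk>h > 0; \<psi> \<in> borel_measurable borel\<rbrakk> \<Longrightarrow> (transition h ^^ n) \<psi> \<in> borel_measurable borel"
  by (induction n) (auto intro: transition_measurable)

text \<open>The step, completed by a second noise component, is an orthogonal map of the triple (position,
  momentum, noise), and its inverse is the step for \<open>- R\<close>.\<close>

lemma transition_duality:
  assumes h: "h > 0" "2 * \<gamma> * h \<le> 1"
    and [measurable]: "g \<in> borel_measurable borel" "\<psi> \<in> borel_measurable borel"
  shows "(\<integral>\<^sup>+z. g z * transition h \<psi> z \<partial>gaussian 1)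
       = (\<integral>\<^sup>+z. langevin_drift.transition (\<lambda>x. - R x) \<gamma> h g z * \<psi> z \<partial>gaussian 1)"
proof -
  interpret dual: langevin_drift "\<lambda>x. - R x" \<gamma> by (rule langevin_drift_neg)
  interpret A: prob_space "gaussian 1 :: 'a measure" by (rule prob_space_gaussian) simp
  interpret B: prob_space "gaussian 1 :: ('a \<times> 'a) measure" by (rule prob_space_gaussian) simp
  interpret BA: pair_prob_space "gaussian 1 :: ('a \<times> 'a) measure" "gaussian 1 :: 'a measure" ..
  define c where "c = sqrt (1 - 2 * \<gamma> * h)"
  define s where "s = sqrt (2 * \<gamma> * h)"
  have cs: "c * c + s * s = 1" using h \<gamma>_pos by (simp add: c_def s_def)
  let ?V = "cayley (h / 4) R" and ?V' = "cayley (h / 4) (\<lambda>x. - R x)"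
  have ns: "noise \<gamma> (sqrt h *\<^sub>R w) = (0, s *\<^sub>R w)" for w :: 'a
    by (simp add: noise_def s_def real_sqrt_mult)
  \<comment> \<open>Momentum and noise are mixed by the matrix with rows (c, s) and (s, -c), a
    reflection and so its own inverse. This is why the reversed step has the same damping and the
    same noise strength.\<close>
  define U where "U x = (let y = ?V (fst x) in
      (?V (fst y, c *\<^sub>R snd y + s *\<^sub>R snd x), s *\<^sub>R snd y - c *\<^sub>R snd x))" for x
  have linU: "linear U"
  proof (rule linearI)
    fix x y :: "('a \<times> 'a) \<times> 'a" and k :: real
    note a = linear_add[OF linear_cayley, of "h/4"] and m = linear_scale[OF linear_cayley, of "h/4"]
    define u where "u x = (fst (?V (fst x)), c *\<^sub>R snd (?V (fst x)) + s *\<^sub>R snd x)" for x :: "('a \<times> 'a) \<times> 'a"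
    have U: "U x = (?V (u x), s *\<^sub>R snd (?V (fst x)) - c *\<^sub>R snd x)" for x
      by (simp add: U_def u_def Let_def)
    have "u (x + y) = u x + u y" "u (k *\<^sub>R x) = k *\<^sub>R u x"
      by (simp_all add: u_def a m algebra_simps)
    then show "U (x + y) = U x + U y" "U (k *\<^sub>R x) = k *\<^sub>R U x"
      by (simp_all add: U a m algebra_simps)
  qed
  have normU: "norm (U x) = norm x" for x
  proof -
    define y where "y = ?V (fst x)"
    have "(norm (c *\<^sub>R snd y + s *\<^sub>R snd x))\<^sup>2 + (norm (s *\<^sub>R snd y - c *\<^sub>R snd x))\<^sup>2
       = (c * c + s * s) * (norm (snd y))\<^sup>2 + (c * c + s * s) * (norm (snd x))\<^sup>2"
      unfolding power2_norm_eq_inner by (simp add: inner_simps inner_commute algebra_simps)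
    then have "(norm (U x))\<^sup>2 = (norm y)\<^sup>2 + (norm (snd x))\<^sup>2"
      unfolding cs by (simp add: U_def Let_def y_def[symmetric] norm_Pair norm_cayley norm_prod_def[of y])
    also have "\<dots> = (norm x)\<^sup>2" by (simp add: y_def norm_cayley norm_prod_def[of x])
    finally show ?thesis by simp
  qed
  define G where "G x = g (step \<gamma> h (\<lambda>x. - R x) (fst x) (sqrt h *\<^sub>R snd x)) * \<psi> (fst x)" for x
  have [measurable]: "G \<in> borel_measurable borel" unfolding G_def by measurable
  \<comment> \<open>Fed with the last component of \<open>U (z, w)\<close> as its noise, the
    reversed step returns to \<open>z\<close>.\<close>
  have GU: "G (U (z, w)) = g z * \<psi> (step \<gamma> h R z (sqrt h *\<^sub>R w))" for z w
  proof -
    define y where "y = ?V z"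
    define u where "u = (fst y, c *\<^sub>R snd y + s *\<^sub>R w)"
    have U: "U (z, w) = (?V u, s *\<^sub>R snd y - c *\<^sub>R w)" by (simp add: U_def Let_def y_def u_def)
    have 1: "step \<gamma> h R z (sqrt h *\<^sub>R w) = ?V u"
      by (simp add: step_def ns damp_def y_def u_def c_def)
    have "c *\<^sub>R (c *\<^sub>R snd y + s *\<^sub>R w) + s *\<^sub>R (s *\<^sub>R snd y - c *\<^sub>R w) = (c * c + s * s) *\<^sub>R snd y"
      by (simp add: algebra_simps)
    then have "damp \<gamma> h u + noise \<gamma> (sqrt h *\<^sub>R (s *\<^sub>R snd y - c *\<^sub>R w)) = y"
      unfolding ns cs by (simp add: damp_def u_def c_def[symmetric] prod_eq_iff)
    then have "step \<gamma> h (\<lambda>x. - R x) (?V u) (sqrt h *\<^sub>R (s *\<^sub>R snd y - c *\<^sub>R w)) = ?V' y"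
      by (simp add: step_def cayley_neg_cayley)
    also have "\<dots> = z" by (simp add: y_def cayley_neg_cayley)
    finally show ?thesis by (simp add: G_def U 1)
  qed
  have "(\<integral>\<^sup>+z. g z * transition h \<psi> z \<partial>gaussian 1) = (\<integral>\<^sup>+z. \<integral>\<^sup>+w. G (U (z, w)) \<partial>gaussian 1 \<partial>gaussian 1)"
    unfolding transition_def GU using h
    by (intro nn_integral_cong, subst nn_integral_gaussian_scale) (auto simp: nn_integral_cmult)
  also have "\<dots> = (\<integral>\<^sup>+x. G (U x) \<partial>gaussian 1)"
    unfolding gaussian_pair[OF zero_less_one, where 'a="'a \<times> 'a" and 'b='a]
    using linear_borel_measurable[OF linU] by (subst A.nn_integral_fst) (auto simp flip: gaussian_pair)
  also have "\<dots> = (\<integral>\<^sup>+x. G x \<partial>gaussian 1)"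
    by (rule nn_integral_gaussian_isometry[OF linU normU]) measurable
  also have "\<dots> = (\<integral>\<^sup>+z. \<integral>\<^sup>+w. G (z, w) \<partial>gaussian 1 \<partial>gaussian 1)"
    unfolding gaussian_pair[OF zero_less_one, where 'a="'a \<times> 'a" and 'b='a]
    by (subst A.nn_integral_fst) (auto simp flip: gaussian_pair)
  also have "\<dots> = (\<integral>\<^sup>+z. dual.transition h g z * \<psi> z \<partial>gaussian 1)"
    unfolding dual.transition_def G_def fst_conv snd_conv using h
    by (intro nn_integral_cong, subst nn_integral_gaussian_scale) (auto simp: nn_integral_multc)
  finally show ?thesis .
qed

lemma transition_funpow_duality:
  assumes h: "h > 0" "2 * \<gamma> * h \<le> 1"
    and "g \<in> borel_measurable borel" "\<psi> \<in> borel_measurable borel"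
  shows "(\<integral>\<^sup>+z. g z * (transition h ^^ n) \<psi> z \<partial>gaussian 1)
       = (\<integral>\<^sup>+z. (langevin_drift.transition (\<lambda>x. - R x) \<gamma> h ^^ n) g z * \<psi> z \<partial>gaussian 1)"
  using assms(3)
proof (induction n arbitrary: g)
  case (Suc n)
  interpret dual: langevin_drift "\<lambda>x. - R x" \<gamma> by (rule langevin_drift_neg)
  show ?case
    using transition_duality[OF h Suc.prems transition_funpow_measurable[OF h(1) assms(4)]]
      Suc.IH[OF dual.transition_measurable[OF h(1) Suc.prems]]
    by (simp add: funpow_swap1)
qed simp

end

section \<open>The scheme as a Markov chain\<close>

lemma brownian_increments:
  fixes W :: "real \<Rightarrow> 'w \<Rightarrow> 'a::euclidean_space"
  assumes "brownian_motion M W" and h: "h > 0"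
  defines "\<Delta> \<equiv> \<lambda>i::nat. \<lambda>\<omega>. W (real (Suc i) * h) \<omega> - W (real i * h) \<omega>"
  shows "prob_space.indep_vars M (\<lambda>_. borel) \<Delta> UNIV"
    and "distr M borel (\<Delta> i) = gaussian h" and "\<Delta> i \<in> borel_measurable M"
proof -
  have "incseq (\<lambda>i. real i * h)" using h by (auto simp: incseq_def intro!: mult_right_mono)
  then show "prob_space.indep_vars M (\<lambda>_. borel) \<Delta> UNIV"
    using assms(1) unfolding brownian_motion_def \<Delta>_def by (auto dest!: spec[of _ "\<lambda>i::nat. real i * h"])
  have "\<forall>s t. 0 \<le> s \<and> s < t \<longrightarrow> distr M borel (\<lambda>\<omega>. W t \<omega> - W s \<omega>) = gaussian (t - s)"
    using assms(1) by (simp add: brownian_motion_def)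
  from this[rule_format, of "real i * h" "real (Suc i) * h"] show "distr M borel (\<Delta> i) = gaussian h"
    using h by (simp add: \<Delta>_def algebra_simps)
  have "W t \<in> borel_measurable M" if "t \<ge> 0" for t
    using assms(1) that by (simp add: brownian_motion_def)
  then show "\<Delta> i \<in> borel_measurable M" using h unfolding \<Delta>_def by (intro borel_measurable_diff) auto
qed

context langevin_drift begin

lemma scheme_measurable:
  assumes "{..<n} \<subseteq> I"
  shows "(\<lambda>w. scheme \<gamma> h R z w n) \<in> borel_measurable (PiM I (\<lambda>_. borel))"
  using assms
proof (induction n)
  case (Suc n)
  have [measurable]: "(\<lambda>w. w n) \<in> borel_measurable (PiM I (\<lambda>_. borel))"
    using Suc.prems by (intro measurable_component_singleton) auto
  have [measurable]: "(\<lambda>w. scheme \<gamma> h R z w n) \<in> borel_measurable (PiM I (\<lambda>_. borel))"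
    using Suc.IH Suc.prems by (meson lessThan_subset_iff le_SucI order_refl order_trans)
  show ?case unfolding scheme.simps by measurable
qed simp

lemma scheme_cong: "(\<And>i. i < n \<Longrightarrow> w i = w' i) \<Longrightarrow> scheme \<gamma> h R z w n = scheme \<gamma> h R z w' n"
  by (induction n) auto

text \<open>The last increment is independent of the earlier ones, which determine the state it acts
  on. Integrating it out replaces \<open>\<psi>\<close> by \<open>transition h \<psi>\<close>, so
  the induction must leave \<open>\<psi>\<close> arbitrary.\<close>

lemma expectation_scheme:
  fixes W :: "real \<Rightarrow> 'w \<Rightarrow> 'a"
  assumes bm: "brownian_motion M W" and h: "h > 0" and "\<psi> \<in> borel_measurable borel"
  shows "(\<integral>\<^sup>+\<omega>. \<psi> (scheme \<gamma> h R z (\<lambda>i. W (real (Suc i) * h) \<omega> - W (real i * h) \<omega>) n) \<partial>M)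
    = (transition h ^^ n) \<psi> z"
  using assms(3)
proof (induction n arbitrary: \<psi>)
  case 0
  interpret prob_space M using bm by (simp add: brownian_motion_def)
  show ?case by (simp add: emeasure_space_1)
next
  case (Suc n)
  note [measurable] = Suc.prems
  interpret prob_space M using bm by (simp add: brownian_motion_def)
  define \<Delta> where "\<Delta> = (\<lambda>i::nat. \<lambda>\<omega>. W (real (Suc i) * h) \<omega> - W (real i * h) \<omega>)"
  have B: "indep_vars (\<lambda>_. borel) \<Delta> UNIV" "distr M borel (\<Delta> n) = gaussian h" "\<Delta> n \<in> borel_measurable M"
    using brownian_increments[OF bm h] unfolding \<Delta>_def by blast+
  define S where "S \<omega> = scheme \<gamma> h R z (\<lambda>i. \<Delta> i \<omega>) n" for \<omega>
  have "indep_var (PiM {..<n} (\<lambda>_. borel)) (\<lambda>\<omega>. restrict (\<lambda>i. \<Delta> i \<omega>) {..<n})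
      (PiM {n} (\<lambda>_. borel)) (\<lambda>\<omega>. restrict (\<lambda>i. \<Delta> i \<omega>) {n})"
    by (rule indep_var_restrict[OF B(1)]) auto
  moreover have "(\<lambda>w. scheme \<gamma> h R z w n) \<in> borel_measurable (PiM {..<n} (\<lambda>_. borel))"
    by (rule scheme_measurable) simp
  \<comment> \<open>\<open>indep_var\<close> takes two variables with values in one type, so the
    increment is padded with a zero to a point of phase space.\<close>
  moreover have "(\<lambda>w. (0 :: 'a, w n)) \<in> borel_measurable (PiM {n} (\<lambda>_. borel :: 'a measure))"
    by (intro borel_measurable_Pair measurable_component_singleton) auto
  ultimately have "indep_var borel ((\<lambda>w. scheme \<gamma> h R z w n) \<circ> (\<lambda>\<omega>. restrict (\<lambda>i. \<Delta> i \<omega>) {..<n}))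
      borel ((\<lambda>w. (0 :: 'a, w n)) \<circ> (\<lambda>\<omega>. restrict (\<lambda>i. \<Delta> i \<omega>) {n}))"
    by (rule indep_var_compose)
  moreover have "(\<lambda>w. scheme \<gamma> h R z w n) \<circ> (\<lambda>\<omega>. restrict (\<lambda>i. \<Delta> i \<omega>) {..<n}) = S"
    by (rule ext) (auto simp: S_def intro!: scheme_cong)
  ultimately have "indep_var borel S borel (\<lambda>\<omega>. (0 :: 'a, \<Delta> n \<omega>))"
    by (simp add: o_def)
  then have ind: "S \<in> borel_measurable M"
      "distr M borel S \<Otimes>\<^sub>M distr M borel (\<lambda>\<omega>. (0 :: 'a, \<Delta> n \<omega>)) = distr M (borel \<Otimes>\<^sub>M borel) (\<lambda>\<omega>. (S \<omega>, (0 :: 'a, \<Delta> n \<omega>)))"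
    by (simp_all only: indep_var_distribution_eq)
  note [measurable] = ind(1) B(3)
  have [measurable]: "(\<lambda>\<omega>. (0 :: 'a, \<Delta> n \<omega>)) \<in> borel_measurable M"
    by (intro borel_measurable_Pair borel_measurable_const B(3))
  interpret G: prob_space "distr M borel (\<lambda>\<omega>. (0 :: 'a, \<Delta> n \<omega>))" by (rule prob_space_distr) simp
  have "(\<integral>\<^sup>+\<omega>. \<psi> (step \<gamma> h R (S \<omega>) (\<Delta> n \<omega>)) \<partial>M)
      = (\<integral>\<^sup>+x. \<psi> (step \<gamma> h R (fst x) (snd (snd x))) \<partial>distr M (borel \<Otimes>\<^sub>M borel) (\<lambda>\<omega>. (S \<omega>, (0 :: 'a, \<Delta> n \<omega>))))"
    by (subst nn_integral_distr) auto
  also have "\<dots> = (\<integral>\<^sup>+x. \<psi> (step \<gamma> h R (fst x) (snd (snd x))) \<partial>(distr M borel S \<Otimes>\<^sub>M distr M borel (\<lambda>\<omega>. (0 :: 'a, \<Delta> n \<omega>))))"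
    by (simp only: ind(2))
  also have "\<dots> = (\<integral>\<^sup>+x. (\<integral>\<^sup>+y. \<psi> (step \<gamma> h R x (snd y)) \<partial>distr M borel (\<lambda>\<omega>. (0 :: 'a, \<Delta> n \<omega>))) \<partial>distr M borel S)"
    by (subst G.nn_integral_fst[symmetric]) auto
  also have "\<dots> = (\<integral>\<^sup>+x. transition h \<psi> x \<partial>distr M borel S)"
  proof (rule nn_integral_cong)
    fix x
    have "(\<integral>\<^sup>+y. \<psi> (step \<gamma> h R x (snd y)) \<partial>distr M borel (\<lambda>\<omega>. (0 :: 'a, \<Delta> n \<omega>)))
       = (\<integral>\<^sup>+\<omega>. \<psi> (step \<gamma> h R x (\<Delta> n \<omega>)) \<partial>M)"
      by (subst nn_integral_distr) auto
    also have "\<dots> = transition h \<psi> x"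
      unfolding transition_def B(2)[symmetric] by (subst nn_integral_distr) auto
    finally show "(\<integral>\<^sup>+y. \<psi> (step \<gamma> h R x (snd y)) \<partial>distr M borel (\<lambda>\<omega>. (0 :: 'a, \<Delta> n \<omega>))) = transition h \<psi> x" .
  qed
  also have "\<dots> = (\<integral>\<^sup>+\<omega>. transition h \<psi> (S \<omega>) \<partial>M)"
    using transition_measurable[OF h Suc.prems] by (subst nn_integral_distr) auto
  also have "\<dots> = (transition h ^^ n) (transition h \<psi>) z"
    using Suc.IH[OF transition_measurable[OF h Suc.prems]] by (simp add: S_def \<Delta>_def)
  finally show ?case by (simp add: S_def \<Delta>_def funpow_swap1)
qed

end

text \<open>Closed sets are an intersection-stable generator, and the indicator of a nonempty closed
  set is a pointwise limit of continuous cut-offs built from the distance to it.\<close>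

lemma finite_measure_eqI_continuous:
  fixes M N :: "'b::euclidean_space measure"
  assumes M: "finite_measure M" "sets M = sets borel" and N: "finite_measure N" "sets N = sets borel"
    and eq: "\<And>\<psi> :: 'b \<Rightarrow> real. \<lbrakk>continuous_on UNIV \<psi>; \<And>x. 0 \<le> \<psi> x; \<And>x. \<psi> x \<le> 1\<rbrakk>
      \<Longrightarrow> (\<integral>\<^sup>+x. ennreal (\<psi> x) \<partial>M) = (\<integral>\<^sup>+x. ennreal (\<psi> x) \<partial>N)"
  shows "M = N"
proof -
  interpret M: finite_measure M by fact
  interpret N: finite_measure N by fact
  have lim: "(\<lambda>k. \<integral>\<^sup>+x. ennreal (max 0 (1 - real k * infdist x A)) \<partial>L) \<longlonglongrightarrow> emeasure L A"
    if A: "closed A" "A \<noteq> {}" and L: "finite_measure L" and s: "sets L = sets borel" for A and L :: "'b measure"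
  proof -
    interpret L: finite_measure L by fact
    have [measurable]: "A \<in> sets L" using A s by auto
    have inf[measurable]: "(\<lambda>x. infdist x A) \<in> borel_measurable L"
      unfolding measurable_cong_sets[OF s refl]
      by (intro borel_measurable_continuous_onI continuous_intros)
    have "(\<lambda>k. \<integral>\<^sup>+x. ennreal (max 0 (1 - real k * infdist x A)) \<partial>L) \<longlonglongrightarrow> (\<integral>\<^sup>+x. indicator A x \<partial>L)"
    proof (rule nn_integral_dominated_convergence[where w="\<lambda>_. 1"])
      show "AE x in L. (\<lambda>k. ennreal (max 0 (1 - real k * infdist x A))) \<longlonglongrightarrow> indicator A x"
      proof (rule AE_I2)
        fix x
        show "(\<lambda>k. ennreal (max 0 (1 - real k * infdist x A))) \<longlonglongrightarrow> indicator A x"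
        proof (cases "x \<in> A")
          case True
          then show ?thesis by simp
        next
          case False
          then have d: "infdist x A > 0" using A infdist_pos_not_in_closed by blast
          then obtain k0 :: nat where k0: "1 < real k0 * infdist x A" using reals_Archimedean3 by blast
          have "ennreal (max 0 (1 - real k * infdist x A)) = indicator A x" if "k \<ge> k0" for k
          proof -
            have "real k0 * infdist x A \<le> real k * infdist x A" using that d by (intro mult_right_mono) auto
            then have "max 0 (1 - real k * infdist x A) = 0" using k0 by simp
            then show ?thesis using False by simp
          qed
          then show ?thesis by (intro tendsto_eventually) (auto simp: eventually_sequentially)
        qed
      qed
      show "AE x in L. ennreal (max 0 (1 - real j * infdist x A)) \<le> 1" for j
        by (intro AE_I2) (auto simp: infdist_nonneg simp flip: ennreal_1)
    qed (auto simp: L.emeasure_finite top.not_eq_extremum[symmetric])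
    then show ?thesis by simp
  qed
  show ?thesis
  proof (rule measure_eqI_generator_eq[where E="{A. closed A}" and \<Omega>=UNIV and A="\<lambda>_. UNIV"])
    show "Int_stable {A :: 'b set. closed A}" by (auto simp: Int_stable_def)
    show "sets M = sigma_sets UNIV {A. closed A}" "sets N = sigma_sets UNIV {A. closed A}"
      using M N by (simp_all add: borel_eq_closed)
    \<comment> \<open>The empty set is treated apart, since \<open>infdist x {}\<close> is 0 by
      convention and the cut-offs would be constantly 1.\<close>
    show "emeasure M A = emeasure N A" if "A \<in> {A. closed A}" for A
    proof (cases "A = {}")
      case False
      have "(\<integral>\<^sup>+x. ennreal (max 0 (1 - real k * infdist x A)) \<partial>M) = (\<integral>\<^sup>+x. ennreal (max 0 (1 - real k * infdist x A)) \<partial>N)" for k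
        by (rule eq[of "\<lambda>x. max 0 (1 - real k * infdist x A)"]) (auto intro!: continuous_intros simp: infdist_nonneg)
      with lim[of A M] lim[of A N] that False M N show ?thesis
        by (auto intro: LIMSEQ_unique)
    qed simp
  qed (auto simp: M.emeasure_finite)
qed

text \<open>The null set in \<open>X_path\<close> may depend on \<open>z\<close>, and measurability
  of \<open>X z t\<close> in \<open>z\<close> is not assumed. Both points are settled by
  \<open>X_flow\<close>: the law of \<open>X z t\<close> is that of \<open>X 0 t\<close> translated
  by \<open>flow t z\<close>, which is linear in \<open>z\<close>.\<close>

locale langevin_process = langevin_drift R \<gamma>
  for R :: "'a::euclidean_space \<times> 'a \<Rightarrow> 'a \<times> 'a" and \<gamma> :: real +
  fixes M :: "'w measure" and W :: "real \<Rightarrow> 'w \<Rightarrow> 'a" and X :: "'a \<times> 'a \<Rightarrow> real \<Rightarrow> 'w \<Rightarrow> 'a \<times> 'a"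
  assumes bm: "brownian_motion M W"
    and X_measurable: "t \<ge> 0 \<Longrightarrow> X z t \<in> borel_measurable M"
    and X_path: "AE \<omega> in M. path_solution \<gamma> R (\<lambda>t. W t \<omega>) z (\<lambda>t. X z t \<omega>)"
begin

sublocale prob_space M
  using bm by (simp add: brownian_motion_def)

lemma W_path: "AE \<omega> in M. continuous_on {0..} (\<lambda>t. W t \<omega>) \<and> W 0 \<omega> = 0"
  using bm by (simp add: brownian_motion_def)

sublocale langevin_flow R \<gamma>
proof
  fix z
  have "AE \<omega> in M. (continuous_on {0..} (\<lambda>t. W t \<omega>) \<and> W 0 \<omega> = 0) \<and>
      path_solution \<gamma> R (\<lambda>t. W t \<omega>) z (\<lambda>t. X z t \<omega>) \<and> path_solution \<gamma> R (\<lambda>t. W t \<omega>) 0 (\<lambda>t. X 0 t \<omega>)"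
    using W_path X_path[of z] X_path[of 0] by eventually_elim auto
  moreover have "ae_filter M \<noteq> bot" by (simp add: ae_filter_eq_bot_iff emeasure_space_1)
  ultimately show "\<exists>w x x0. continuous_on {0..} w \<and> w 0 = 0 \<and> path_solution \<gamma> R w z x \<and> path_solution \<gamma> R w 0 x0"
    using eventually_happens by (metis (mono_tags, lifting))
qed

lemma X_flow: "t > 0 \<Longrightarrow> AE \<omega> in M. X z t \<omega> = flow t z + X 0 t \<omega>"
  using W_path X_path[of z] X_path[of 0]
proof eventually_elim
  case (elim \<omega>)
  then show ?case using flow_eq[OF elim(3,4), of t] by simp
qed

definition law :: "real \<Rightarrow> ('a \<times> 'a) measure" where
  "law t = distr M borel (X 0 t)"

lemma sets_law [measurable_cong, simp]: "sets (law t) = sets borel"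
  by (simp add: law_def)

lemma space_law [simp]: "space (law t) = UNIV"
  by (simp add: law_def)

lemma prob_space_law: "t \<ge> 0 \<Longrightarrow> prob_space (law t)"
  unfolding law_def by (rule prob_space_distr) (rule X_measurable)

lemma flow_measurable: "t > 0 \<Longrightarrow> flow t \<in> borel_measurable borel"
  by (rule linear_borel_measurable) (rule linear_flow)

lemma nn_integral_X:
  assumes t: "t > 0" and [measurable]: "\<psi> \<in> borel_measurable borel"
  shows "(\<integral>\<^sup>+\<omega>. \<psi> (X z t \<omega>) \<partial>M) = (\<integral>\<^sup>+y. \<psi> (flow t z + y) \<partial>law t)"
proof -
  have [measurable]: "X 0 t \<in> borel_measurable M" using t by (intro X_measurable) simp
  have "(\<integral>\<^sup>+\<omega>. \<psi> (X z t \<omega>) \<partial>M) = (\<integral>\<^sup>+\<omega>. \<psi> (flow t z + X 0 t \<omega>) \<partial>M)"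
    using X_flow[OF t, of z] by (intro nn_integral_cong_AE) (auto elim: eventually_mono)
  also have "\<dots> = (\<integral>\<^sup>+y. \<psi> (flow t z + y) \<partial>law t)"
    unfolding law_def by (subst nn_integral_distr) auto
  finally show ?thesis .
qed

lemma markov_semigroup_X:
  assumes t: "t > 0" and [measurable]: "\<phi> \<in> borel_measurable borel"
  shows "markov_semigroup M X t \<phi> z = (\<integral>y. \<phi> (flow t z + y) \<partial>law t)"
proof -
  have [measurable]: "X z t \<in> borel_measurable M" "X 0 t \<in> borel_measurable M"
    using t by (auto intro!: X_measurable)
  have "(\<integral>\<omega>. \<phi> (X z t \<omega>) \<partial>M) = (\<integral>\<omega>. \<phi> (flow t z + X 0 t \<omega>) \<partial>M)"
    using X_flow[OF t, of z] by (intro integral_cong_AE) (auto elim: eventually_mono)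
  also have "\<dots> = (\<integral>y. \<phi> (flow t z + y) \<partial>law t)"
    unfolding law_def by (subst integral_distr) auto
  finally show ?thesis by (simp add: markov_semigroup_def)
qed

text \<open>This carries properties of the scheme over to the process: paths converge almost surely,
  and a continuous \<open>\<psi>\<close> with values in [0, 1] allows dominated convergence. The
  index \<open>Suc n\<close> keeps the step size positive.\<close>

lemma transition_funpow_limit:
  fixes \<psi> :: "'a \<times> 'a \<Rightarrow> real"
  assumes t: "t > 0" and c: "continuous_on UNIV \<psi>" and \<psi>: "\<And>x. 0 \<le> \<psi> x" "\<And>x. \<psi> x \<le> 1"
  shows "(\<lambda>n. (transition (t / real (Suc n)) ^^ Suc n) (\<lambda>x. ennreal (\<psi> x)) z) \<longlonglongrightarrow> (\<integral>\<^sup>+y. \<psi> (flow t z + y) \<partial>law t)"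
proof -
  have [measurable]: "\<psi> \<in> borel_measurable borel" using c by (rule borel_measurable_continuous_onI)
  define S where "S n \<omega> = scheme \<gamma> (t / real (Suc n)) R z
      (\<lambda>i. W (real (Suc i) * (t / real (Suc n))) \<omega> - W (real i * (t / real (Suc n))) \<omega>) (Suc n)" for n \<omega>
  have [measurable]: "S n \<in> borel_measurable M" for n
  proof -
    have m: "(\<lambda>\<omega>. \<lambda>i. W (real (Suc i) * (t / real (Suc n))) \<omega> - W (real i * (t / real (Suc n))) \<omega>)
        \<in> measurable M (PiM UNIV (\<lambda>_. borel))"
      using t brownian_increments(3)[OF bm, of "t / real (Suc n)"]
      by (intro measurable_PiM_single') (auto simp del: of_nat_Suc)
    show ?thesis unfolding S_def
      by (rule measurable_compose[OF m scheme_measurable[of _ UNIV]]) simp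
  qed
  have [measurable]: "X z t \<in> borel_measurable M" using t by (auto intro!: X_measurable)
  have "(\<lambda>n. \<integral>\<^sup>+\<omega>. ennreal (\<psi> (S n \<omega>)) \<partial>M) \<longlonglongrightarrow> (\<integral>\<^sup>+\<omega>. ennreal (\<psi> (X z t \<omega>)) \<partial>M)"
  proof (rule nn_integral_dominated_convergence[where w="\<lambda>_. 1"])
    show "AE \<omega> in M. (\<lambda>n. ennreal (\<psi> (S n \<omega>))) \<longlonglongrightarrow> ennreal (\<psi> (X z t \<omega>))"
      using W_path X_path[of z]
    proof eventually_elim
      case (elim \<omega>)
      have "(\<lambda>n. S n \<omega>) \<longlonglongrightarrow> X z t \<omega>"
        using LIMSEQ_Suc[OF scheme_converges[OF elim(2) _ _ t]] elim(1) by (simp add: S_def)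
      then show ?case
        using c by (intro tendsto_ennrealI continuous_on_tendsto_compose[OF c]) auto
    qed
    show "AE \<omega> in M. ennreal (\<psi> (S n \<omega>)) \<le> 1" for n
      using \<psi>(2) by (simp flip: ennreal_1)
  qed (auto simp: emeasure_space_1)
  moreover have "(\<integral>\<^sup>+\<omega>. ennreal (\<psi> (S n \<omega>)) \<partial>M) = (transition (t / real (Suc n)) ^^ Suc n) (\<lambda>x. ennreal (\<psi> x)) z" for n
    unfolding S_def using t by (intro expectation_scheme[OF bm]) auto
  ultimately show ?thesis using nn_integral_X[OF t, of "\<lambda>x. ennreal (\<psi> x)" z] by simp
qed

lemma law_nn_integral_measurable:
  assumes "t > 0" and [measurable]: "\<psi> \<in> borel_measurable borel"
  shows "(\<lambda>z. \<integral>\<^sup>+y. \<psi> (flow t z + y) \<partial>law t) \<in> borel_measurable borel"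
proof -
  interpret law: prob_space "law t" using assms by (intro prob_space_law) simp
  note [measurable] = flow_measurable[OF \<open>t > 0\<close>]
  show ?thesis by measurable
qed

end

section \<open>Time reversal\<close>

text \<open>Weighting by \<open>w\<close> and pushing forward along \<open>p\<close> gives finite
  measures, for which continuous test functions suffice. For the joint law this is applied twice,
  once per coordinate, with the test function of the other coordinate as weight.\<close>

lemma weighted_marginal_eqI:
  fixes J1 J2 :: "('b::euclidean_space \<times> 'c::euclidean_space) measure" and p :: "'b \<times> 'c \<Rightarrow> 'd::euclidean_space"
  assumes J1: "prob_space J1" "sets J1 = sets (borel \<Otimes>\<^sub>M borel)"
    and J2: "prob_space J2" "sets J2 = sets (borel \<Otimes>\<^sub>M borel)"
    and [measurable]: "w \<in> borel_measurable (borel \<Otimes>\<^sub>M borel)" "p \<in> borel \<Otimes>\<^sub>M borel \<rightarrow>\<^sub>M borel" "B \<in> sets borel"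
    and w: "\<And>x. w x \<le> 1"
    and eq: "\<And>\<psi> :: 'd \<Rightarrow> real. \<lbrakk>continuous_on UNIV \<psi>; \<And>x. 0 \<le> \<psi> x; \<And>x. \<psi> x \<le> 1\<rbrakk>
      \<Longrightarrow> (\<integral>\<^sup>+x. w x * ennreal (\<psi> (p x)) \<partial>J1) = (\<integral>\<^sup>+x. w x * ennreal (\<psi> (p x)) \<partial>J2)"
  shows "(\<integral>\<^sup>+x. w x * indicator B (p x) \<partial>J1) = (\<integral>\<^sup>+x. w x * indicator B (p x) \<partial>J2)"
proof -
  define N where "N J = distr (density J w) borel p" for J :: "('b \<times> 'c) measure"
  have int: "(\<integral>\<^sup>+y. \<psi> y \<partial>N J) = (\<integral>\<^sup>+x. w x * \<psi> (p x) \<partial>J)"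
    if [measurable]: "\<psi> \<in> borel_measurable borel" and [measurable_cong]: "sets J = sets (borel \<Otimes>\<^sub>M borel)" for J \<psi>
    unfolding N_def by (subst nn_integral_distr, measurable, subst nn_integral_density) auto
  have fin: "finite_measure (N J)" if "prob_space J" "sets J = sets (borel \<Otimes>\<^sub>M borel)" for J
  proof
    have "emeasure (N J) UNIV = (\<integral>\<^sup>+y. 1 \<partial>N J)" by (simp add: N_def)
    also have "\<dots> \<le> (\<integral>\<^sup>+x. 1 \<partial>J)" unfolding int[OF borel_measurable_const that(2)]
      using w by (intro nn_integral_mono) simp
    finally show "emeasure (N J) (space (N J)) \<noteq> \<infinity>"
      using that(1) by (auto simp: N_def top_unique prob_space.emeasure_space_1)
  qed
  have "N J1 = N J2"
  proof (rule finite_measure_eqI_continuous)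
    show "finite_measure (N J1)" "finite_measure (N J2)" using fin J1 J2 by auto
    show "sets (N J1) = sets borel" "sets (N J2) = sets borel" by (auto simp: N_def)
    fix \<psi> :: "'d \<Rightarrow> real"
    assume \<psi>: "continuous_on UNIV \<psi>" "\<And>x. 0 \<le> \<psi> x" "\<And>x. \<psi> x \<le> 1"
    then have [measurable]: "\<psi> \<in> borel_measurable borel" by (intro borel_measurable_continuous_onI)
    show "(\<integral>\<^sup>+y. ennreal (\<psi> y) \<partial>N J1) = (\<integral>\<^sup>+y. ennreal (\<psi> y) \<partial>N J2)"
      using eq[OF \<psi>] by (simp add: int J1 J2)
  qed
  then show ?thesis using int[of "indicator B" J1] int[of "indicator B" J2] J1 J2 by simp
qed

lemma pair_measure_eqI_continuous:
  fixes J1 J2 :: "('b::euclidean_space \<times> 'c::euclidean_space) measure"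
  assumes J1: "prob_space J1" "sets J1 = sets (borel \<Otimes>\<^sub>M borel)"
    and J2: "prob_space J2" "sets J2 = sets (borel \<Otimes>\<^sub>M borel)"
    and eq: "\<And>(g :: 'b \<Rightarrow> real) (\<psi> :: 'c \<Rightarrow> real). \<lbrakk>continuous_on UNIV g; \<And>x. 0 \<le> g x; \<And>x. g x \<le> 1;
        continuous_on UNIV \<psi>; \<And>x. 0 \<le> \<psi> x; \<And>x. \<psi> x \<le> 1\<rbrakk>
      \<Longrightarrow> (\<integral>\<^sup>+x. ennreal (g (fst x)) * ennreal (\<psi> (snd x)) \<partial>J1) = (\<integral>\<^sup>+x. ennreal (g (fst x)) * ennreal (\<psi> (snd x)) \<partial>J2)"
  shows "J1 = J2"
proof -
  interpret J1: prob_space J1 by fact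
  interpret J2: prob_space J2 by fact
  note [measurable_cong] = J1(2) J2(2)
  have eq1: "(\<integral>\<^sup>+x. ennreal (g (fst x)) * indicator B (snd x) \<partial>J1) = (\<integral>\<^sup>+x. ennreal (g (fst x)) * indicator B (snd x) \<partial>J2)"
    if g: "continuous_on UNIV g" "\<And>x. 0 \<le> g x" "\<And>x. g x \<le> 1" and [measurable]: "B \<in> sets borel"
    for g :: "'b \<Rightarrow> real" and B :: "'c set"
  proof -
    have [measurable]: "g \<in> borel_measurable borel" using g by (intro borel_measurable_continuous_onI)
    show ?thesis
      by (rule weighted_marginal_eqI[OF J1 J2]) (use eq g in \<open>auto simp: ennreal_le_1\<close>)
  qed
  have eq2: "(\<integral>\<^sup>+x. indicator B (snd x) * indicator A (fst x) \<partial>J1) = (\<integral>\<^sup>+x. indicator B (snd x) * indicator A (fst x) \<partial>J2)"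
    if [measurable]: "A \<in> sets borel" "B \<in> sets borel" for A :: "'b set" and B :: "'c set"
    by (rule weighted_marginal_eqI[OF J1 J2]) (use eq1 that in \<open>auto simp: mult.commute indicator_def\<close>)
  let ?E = "{a \<times> b |a b. a \<in> sets (borel :: 'b measure) \<and> b \<in> sets (borel :: 'c measure)}"
  show ?thesis
  proof (rule measure_eqI_generator_eq[where E="?E" and \<Omega>=UNIV and A="\<lambda>_. UNIV"])
    show "Int_stable ?E" by (rule Int_stable_pair_measure_generator)
    show "sets J1 = sigma_sets UNIV ?E" "sets J2 = sigma_sets UNIV ?E"
      unfolding J1(2) J2(2) by (simp_all add: sets_pair_measure)
    show "range (\<lambda>_. UNIV) \<subseteq> ?E" by (auto intro!: exI[of _ UNIV])
    fix X assume "X \<in> ?E"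
    then obtain A B where X: "X = A \<times> B" and [measurable]: "A \<in> sets borel" "B \<in> sets borel" by auto
    have *: "indicator X x = (indicator A (fst x) * indicator B (snd x) :: ennreal)" for x
      by (cases x) (simp add: X indicator_times)
    have "X \<in> sets (borel \<Otimes>\<^sub>M borel)" by (simp add: X)
    then have "emeasure J1 X = (\<integral>\<^sup>+x. indicator A (fst x) * indicator B (snd x) \<partial>J1)"
      "emeasure J2 X = (\<integral>\<^sup>+x. indicator A (fst x) * indicator B (snd x) \<partial>J2)"
      using J1(2) J2(2) by (simp_all flip: *)
    then show "emeasure J1 X = emeasure J2 X" using eq2[of A B] by (simp add: mult.commute)
  qed (auto simp: J1.emeasure_finite)
qed

lemma (in langevin_drift) transition_le_1:
  assumes h: "h > 0" and \<psi>: "\<And>x. \<psi> x \<le> 1"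
  shows "(transition h ^^ n) \<psi> z \<le> 1"
proof (induction n arbitrary: z)
  case (Suc n)
  have "transition h f z \<le> 1" if "\<And>x. f x \<le> 1" for f
  proof -
    have "transition h f z \<le> (\<integral>\<^sup>+w. 1 \<partial>(gaussian h :: 'a measure))"
      unfolding transition_def by (intro nn_integral_mono that)
    then show ?thesis
      using prob_space.emeasure_space_1[OF prob_space_gaussian[OF h, where 'a='a]] by simp
  qed
  then show ?case using Suc by simp
qed (use \<psi> in simp)

text \<open>The dual is required as an actual process so that convergence of the scheme is available
  for both signs of \<open>R\<close>. In the application \<open>X'\<close> is the given process for
  -\<mu>, seen through \<open>position_flip\<close>.\<close>

locale langevin_dual_pair = langevin_process R \<gamma> M W X + dual: langevin_process "\<lambda>x. - R x" \<gamma> M W X'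
  for R :: "'a::euclidean_space \<times> 'a \<Rightarrow> 'a \<times> 'a" and \<gamma> :: real
    and M :: "'w measure" and W :: "real \<Rightarrow> 'w \<Rightarrow> 'a" and X X' :: "'a \<times> 'a \<Rightarrow> real \<Rightarrow> 'w \<Rightarrow> 'a \<times> 'a"
begin

text \<open>The discrete duality is exact as soon as the step size satisfies the stability bound,
  hence eventually, and both sides pass to the limit by dominated convergence.\<close>

lemma law_duality_continuous:
  fixes g \<psi> :: "'a \<times> 'a \<Rightarrow> real"
  assumes t: "t > 0" and g: "continuous_on UNIV g" "\<And>x. 0 \<le> g x" "\<And>x. g x \<le> 1"
    and \<psi>: "continuous_on UNIV \<psi>" "\<And>x. 0 \<le> \<psi> x" "\<And>x. \<psi> x \<le> 1"
  shows "(\<integral>\<^sup>+z. ennreal (g z) * (\<integral>\<^sup>+y. ennreal (\<psi> (flow t z + y)) \<partial>law t) \<partial>gaussian 1)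
       = (\<integral>\<^sup>+z. (\<integral>\<^sup>+y. ennreal (g (dual.flow t z + y)) \<partial>dual.law t) * ennreal (\<psi> z) \<partial>gaussian 1)"
proof -
  interpret G: prob_space "gaussian 1 :: ('a \<times> 'a) measure" by (rule prob_space_gaussian) simp
  have [measurable]: "g \<in> borel_measurable borel" "\<psi> \<in> borel_measurable borel"
    using g \<psi> by (auto intro: borel_measurable_continuous_onI)
  let ?h = "\<lambda>n. t / real (Suc n)"
  let ?L = "\<lambda>n. \<integral>\<^sup>+z. ennreal (g z) * (transition (?h n) ^^ Suc n) (\<lambda>x. ennreal (\<psi> x)) z \<partial>gaussian 1"
  let ?D = "\<lambda>n. \<integral>\<^sup>+z. (dual.transition (?h n) ^^ Suc n) (\<lambda>x. ennreal (g x)) z * ennreal (\<psi> z) \<partial>gaussian 1"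
  have h: "?h n > 0" for n using t by simp
  have prod_le: "a * b \<le> 1" if "a \<le> 1" "b \<le> 1" for a b :: ennreal
    using mult_mono[OF that] by simp
  have L: "?L \<longlonglongrightarrow> (\<integral>\<^sup>+z. ennreal (g z) * (\<integral>\<^sup>+y. ennreal (\<psi> (flow t z + y)) \<partial>law t) \<partial>gaussian 1)"
  proof (rule nn_integral_dominated_convergence[where w="\<lambda>_. 1"])
    show "AE z in gaussian 1. (\<lambda>n. ennreal (g z) * (transition (?h n) ^^ Suc n) (\<lambda>x. ennreal (\<psi> x)) z)
        \<longlonglongrightarrow> ennreal (g z) * (\<integral>\<^sup>+y. ennreal (\<psi> (flow t z + y)) \<partial>law t)"
      by (intro AE_I2 ennreal_tendsto_cmult transition_funpow_limit[OF t \<psi>]) auto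
    show "AE z in gaussian 1. ennreal (g z) * (transition (?h n) ^^ Suc n) (\<lambda>x. ennreal (\<psi> x)) z \<le> 1" for n
      using \<psi> g by (intro AE_I2 prod_le transition_le_1 h) (auto simp flip: ennreal_1)
    show "(\<lambda>z. ennreal (g z) * (\<integral>\<^sup>+y. ennreal (\<psi> (flow t z + y)) \<partial>law t)) \<in> borel_measurable (gaussian 1)"
      using law_nn_integral_measurable[OF t, of "\<lambda>x. ennreal (\<psi> x)"] by simp
    show "(\<lambda>z. ennreal (g z) * (transition (?h n) ^^ Suc n) (\<lambda>x. ennreal (\<psi> x)) z) \<in> borel_measurable (gaussian 1)" for n
      using transition_funpow_measurable[OF h[of n], of "\<lambda>x. ennreal (\<psi> x)" "Suc n"]
      by (simp del: funpow.simps of_nat_Suc)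
  qed (auto simp: G.emeasure_space_1[simplified])
  have D: "?D \<longlonglongrightarrow> (\<integral>\<^sup>+z. (\<integral>\<^sup>+y. ennreal (g (dual.flow t z + y)) \<partial>dual.law t) * ennreal (\<psi> z) \<partial>gaussian 1)"
  proof (rule nn_integral_dominated_convergence[where w="\<lambda>_. 1"])
    show "AE z in gaussian 1. (\<lambda>n. (dual.transition (?h n) ^^ Suc n) (\<lambda>x. ennreal (g x)) z * ennreal (\<psi> z))
        \<longlonglongrightarrow> (\<integral>\<^sup>+y. ennreal (g (dual.flow t z + y)) \<partial>dual.law t) * ennreal (\<psi> z)"
      unfolding mult.commute[of _ "ennreal (\<psi> _)"]
      by (intro AE_I2 ennreal_tendsto_cmult dual.transition_funpow_limit[OF t g]) auto
    show "AE z in gaussian 1. (dual.transition (?h n) ^^ Suc n) (\<lambda>x. ennreal (g x)) z * ennreal (\<psi> z) \<le> 1" for n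
      using \<psi> g by (intro AE_I2 prod_le dual.transition_le_1 h) (auto simp flip: ennreal_1)
    show "(\<lambda>z. (\<integral>\<^sup>+y. ennreal (g (dual.flow t z + y)) \<partial>dual.law t) * ennreal (\<psi> z)) \<in> borel_measurable (gaussian 1)"
      using dual.law_nn_integral_measurable[OF t, of "\<lambda>x. ennreal (g x)"] by simp
    show "(\<lambda>z. (dual.transition (?h n) ^^ Suc n) (\<lambda>x. ennreal (g x)) z * ennreal (\<psi> z)) \<in> borel_measurable (gaussian 1)" for n
      using dual.transition_funpow_measurable[OF h[of n], of "\<lambda>x. ennreal (g x)" "Suc n"]
      by (simp del: funpow.simps of_nat_Suc)
  qed (auto simp: G.emeasure_space_1[simplified])
  have E: "eventually (\<lambda>n. ?L n = ?D n) sequentially"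
  proof -
    have "?h \<longlonglongrightarrow> 0" by (rule LIMSEQ_Suc) (rule lim_const_over_n)
    then have "eventually (\<lambda>n. ?h n < 1 / (2 * \<gamma>)) sequentially"
      using \<gamma>_pos by (intro order_tendstoD(2)) auto
    then show ?thesis
    proof eventually_elim
      case (elim n)
      then have "2 * \<gamma> * ?h n \<le> 1" using \<gamma>_pos by (simp add: field_simps)
      then show ?case by (intro transition_funpow_duality[OF h]) auto
    qed
  qed
  show ?thesis
    by (rule LIMSEQ_unique[OF Lim_transform_eventually[OF L E] D])
qed

end

text \<open>The image measure is the law of the process at the times 0 and \<open>t\<close> when it
  is started from the Gaussian.\<close>

lemma (in langevin_process) joint_law:
  assumes t: "t > 0"
  shows "prob_space (distr (gaussian 1 \<Otimes>\<^sub>M law t) (borel \<Otimes>\<^sub>M borel) (\<lambda>x. (fst x, flow t (fst x) + snd x)))"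
    and "f \<in> borel_measurable (borel \<Otimes>\<^sub>M borel) \<Longrightarrow>
     (\<integral>\<^sup>+x. f x \<partial>distr (gaussian 1 \<Otimes>\<^sub>M law t) (borel \<Otimes>\<^sub>M borel) (\<lambda>x. (fst x, flow t (fst x) + snd x)))
      = (\<integral>\<^sup>+z. \<integral>\<^sup>+y. f (z, flow t z + y) \<partial>law t \<partial>gaussian 1)"
    and "(\<lambda>x. (fst x, flow t (fst x) + snd x)) \<in> gaussian 1 \<Otimes>\<^sub>M law t \<rightarrow>\<^sub>M borel \<Otimes>\<^sub>M borel"
proof -
  interpret law: prob_space "law t" using t by (intro prob_space_law) simp
  interpret G: prob_space "gaussian 1 :: ('a \<times> 'a) measure" by (rule prob_space_gaussian) simp
  interpret P: pair_prob_space "gaussian 1 :: ('a \<times> 'a) measure" "law t" ..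
  note [measurable] = flow_measurable[OF t]
  show m: "(\<lambda>x. (fst x, flow t (fst x) + snd x)) \<in> gaussian 1 \<Otimes>\<^sub>M law t \<rightarrow>\<^sub>M borel \<Otimes>\<^sub>M borel"
    by measurable
  show "prob_space (distr (gaussian 1 \<Otimes>\<^sub>M law t) (borel \<Otimes>\<^sub>M borel) (\<lambda>x. (fst x, flow t (fst x) + snd x)))"
    by (rule P.prob_space_distr[OF m])
  assume [measurable]: "f \<in> borel_measurable (borel \<Otimes>\<^sub>M borel)"
  show "(\<integral>\<^sup>+x. f x \<partial>distr (gaussian 1 \<Otimes>\<^sub>M law t) (borel \<Otimes>\<^sub>M borel) (\<lambda>x. (fst x, flow t (fst x) + snd x)))
      = (\<integral>\<^sup>+z. \<integral>\<^sup>+y. f (z, flow t z + y) \<partial>law t \<partial>gaussian 1)"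
    by (subst nn_integral_distr[OF m]) (measurable, simp add: law.nn_integral_fst[symmetric])
qed

context langevin_dual_pair begin

text \<open>Time reversal: the stationary process and its dual, run backwards, have the same two-point law.\<close>

lemma joint_law_duality:
  assumes t: "t > 0"
  shows "distr (gaussian 1 \<Otimes>\<^sub>M law t) (borel \<Otimes>\<^sub>M borel) (\<lambda>x. (fst x, flow t (fst x) + snd x))
    = distr (gaussian 1 \<Otimes>\<^sub>M dual.law t) (borel \<Otimes>\<^sub>M borel) (\<lambda>x. (dual.flow t (fst x) + snd x, fst x))"
    (is "?J1 = ?J2")
proof -
  let ?J = "distr (gaussian 1 \<Otimes>\<^sub>M dual.law t) (borel \<Otimes>\<^sub>M borel) (\<lambda>x. (fst x, dual.flow t (fst x) + snd x))"
  note d = dual.joint_law[OF t]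
  have sw: "?J2 = distr ?J (borel \<Otimes>\<^sub>M borel) (\<lambda>x. (snd x, fst x))"
    by (subst distr_distr[OF _ d(3)]) (auto simp: o_def)
  interpret J: prob_space ?J by (rule d(1))
  show ?thesis
  proof (rule pair_measure_eqI_continuous)
    show "prob_space ?J1" by (rule joint_law(1)[OF t])
    show "prob_space ?J2" unfolding sw by (rule J.prob_space_distr) measurable
    fix g \<psi> :: "'a \<times> 'a \<Rightarrow> real"
    assume g: "continuous_on UNIV g" "\<And>x. 0 \<le> g x" "\<And>x. g x \<le> 1"
      and \<psi>: "continuous_on UNIV \<psi>" "\<And>x. 0 \<le> \<psi> x" "\<And>x. \<psi> x \<le> 1"
    have [measurable]: "g \<in> borel_measurable borel" "\<psi> \<in> borel_measurable borel"
      using g \<psi> by (auto intro: borel_measurable_continuous_onI)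
    note [measurable] = flow_measurable[OF t] dual.flow_measurable[OF t]
    have "(\<integral>\<^sup>+x. ennreal (g (fst x)) * ennreal (\<psi> (snd x)) \<partial>?J1)
       = (\<integral>\<^sup>+z. \<integral>\<^sup>+y. ennreal (g z) * ennreal (\<psi> (flow t z + y)) \<partial>law t \<partial>gaussian 1)"
      by (subst joint_law(2)[OF t]) auto
    also have "\<dots> = (\<integral>\<^sup>+z. ennreal (g z) * (\<integral>\<^sup>+y. ennreal (\<psi> (flow t z + y)) \<partial>law t) \<partial>gaussian 1)"
      by (simp add: nn_integral_cmult)
    also have "\<dots> = (\<integral>\<^sup>+z. (\<integral>\<^sup>+y. ennreal (g (dual.flow t z + y)) \<partial>dual.law t) * ennreal (\<psi> z) \<partial>gaussian 1)"
      by (rule law_duality_continuous[OF t g \<psi>])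
    also have "\<dots> = (\<integral>\<^sup>+z. \<integral>\<^sup>+y. ennreal (g (dual.flow t z + y)) * ennreal (\<psi> z) \<partial>dual.law t \<partial>gaussian 1)"
      by (simp add: nn_integral_multc)
    also have "\<dots> = (\<integral>\<^sup>+x. ennreal (g (snd x)) * ennreal (\<psi> (fst x)) \<partial>?J)"
      by (subst d(2)) auto
    also have "\<dots> = (\<integral>\<^sup>+x. ennreal (g (fst x)) * ennreal (\<psi> (snd x)) \<partial>?J2)"
      unfolding sw by (subst nn_integral_distr) auto
    finally show "(\<integral>\<^sup>+x. ennreal (g (fst x)) * ennreal (\<psi> (snd x)) \<partial>?J1)
       = (\<integral>\<^sup>+x. ennreal (g (fst x)) * ennreal (\<psi> (snd x)) \<partial>?J2)" .
  qed auto
qed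

text \<open>Under time reversal the law at time \<open>t\<close> becomes the initial law of the dual
  process, which is Gaussian by construction.\<close>

lemma invariant_measure:
  assumes t: "t > 0"
  shows "distr (gaussian 1 \<Otimes>\<^sub>M law t) borel (\<lambda>x. flow t (fst x) + snd x) = gaussian 1"
proof -
  interpret dlaw: prob_space "dual.law t" using t by (intro dual.prob_space_law) simp
  note [measurable] = flow_measurable[OF t] dual.flow_measurable[OF t]
  have "distr (gaussian 1 \<Otimes>\<^sub>M law t) borel (\<lambda>x. flow t (fst x) + snd x)
    = distr (distr (gaussian 1 \<Otimes>\<^sub>M law t) (borel \<Otimes>\<^sub>M borel) (\<lambda>x. (fst x, flow t (fst x) + snd x))) borel snd"
    by (subst distr_distr) (auto simp: o_def)
  also have "\<dots> = distr (gaussian 1 \<Otimes>\<^sub>M dual.law t) borel fst"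
    unfolding joint_law_duality[OF t] by (subst distr_distr) (auto simp: o_def)
  also have "\<dots> = distr (gaussian 1 \<Otimes>\<^sub>M dual.law t) (gaussian 1) fst"
    by (intro distr_cong) auto
  also have "\<dots> = gaussian 1" by (rule dlaw.distr_pair_fst)
  finally show ?thesis .
qed

end

section \<open>Quadratic functions under the semigroup\<close>

lemma square_integrable_mult:
  assumes "square_integrable N f" "square_integrable N g"
  shows "integrable N (\<lambda>x. f x * g x)"
proof (rule Bochner_Integration.integrable_bound)
  show "integrable N (\<lambda>x. (f x)\<^sup>2 + (g x)\<^sup>2)"
    using assms by (simp add: square_integrable_def)
  show "(\<lambda>x. f x * g x) \<in> borel_measurable N"
    using assms by (auto simp: square_integrable_def intro: borel_measurable_times)
  have "\<bar>f x * g x\<bar> \<le> (f x)\<^sup>2 + (g x)\<^sup>2" for x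
  proof -
    have "0 \<le> (\<bar>f x\<bar> - \<bar>g x\<bar>)\<^sup>2" by simp
    then have "2 * (\<bar>f x\<bar> * \<bar>g x\<bar>) \<le> (f x)\<^sup>2 + (g x)\<^sup>2" by (simp add: power2_diff)
    then show ?thesis using mult_nonneg_nonneg[OF abs_ge_zero abs_ge_zero, of "f x" "g x"]
      unfolding abs_mult by linarith
  qed
  then show "AE x in N. norm (f x * g x) \<le> norm ((f x)\<^sup>2 + (g x)\<^sup>2)" by (intro AE_I2) simp
qed

text \<open>Cauchy-Schwarz is applied in \<open>ennreal\<close>, because \<open>h t\<close> need not
  be square integrable and its distance to \<open>k\<close> may be infinite away from the
  limit.\<close>

lemma integral_mult_tendsto_L2:
  fixes h :: "real \<Rightarrow> 'b \<Rightarrow> real"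
  assumes g: "square_integrable N g" and k: "square_integrable N k"
    and h: "eventually (\<lambda>t. h t \<in> borel_measurable N \<and> integrable N (\<lambda>x. g x * h t x)) F"
    and lim: "((\<lambda>t. \<integral>\<^sup>+x. ennreal ((h t x - k x)\<^sup>2) \<partial>N) \<longlongrightarrow> 0) F"
  shows "((\<lambda>t. \<integral>x. g x * h t x \<partial>N) \<longlongrightarrow> (\<integral>x. g x * k x \<partial>N)) F"
proof -
  have [measurable]: "g \<in> borel_measurable N" "k \<in> borel_measurable N"
    using g k by (auto simp: square_integrable_def)
  define G where "G = (\<integral>\<^sup>+x. ennreal ((g x)\<^sup>2) \<partial>N)"
  have G: "G < top"
    using g by (simp add: square_integrable_def G_def nn_integral_eq_integral ennreal_less_top)
  let ?r = "\<lambda>t. (\<integral>x. g x * h t x \<partial>N) - (\<integral>x. g x * k x \<partial>N)"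
  have "eventually (\<lambda>t. ennreal ((?r t)\<^sup>2) \<le> G * (\<integral>\<^sup>+x. ennreal ((h t x - k x)\<^sup>2) \<partial>N)) F"
    using h
  proof eventually_elim
    case (elim t)
    then have [measurable]: "h t \<in> borel_measurable N" and i: "integrable N (\<lambda>x. g x * h t x)" by auto
    have ik: "integrable N (\<lambda>x. g x * k x)" by (rule square_integrable_mult[OF g k])
    have "ennreal (norm (?r t)) = ennreal (norm (\<integral>x. g x * (h t x - k x) \<partial>N))"
      using i ik by (simp add: right_diff_distrib)
    also have "\<dots> \<le> (\<integral>\<^sup>+x. ennreal (norm (g x * (h t x - k x))) \<partial>N)"
      using i ik by (intro integral_norm_bound_ennreal) (simp add: right_diff_distrib)
    also have "\<dots> = (\<integral>\<^sup>+x. ennreal \<bar>g x\<bar> * ennreal \<bar>h t x - k x\<bar> \<partial>N)"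
      by (simp add: abs_mult ennreal_mult)
    finally have "(ennreal (norm (?r t)))\<^sup>2 \<le> (\<integral>\<^sup>+x. ennreal \<bar>g x\<bar> * ennreal \<bar>h t x - k x\<bar> \<partial>N)\<^sup>2"
      by (rule power_mono) simp
    also have "\<dots> \<le> (\<integral>\<^sup>+x. (ennreal \<bar>g x\<bar>)\<^sup>2 \<partial>N) * (\<integral>\<^sup>+x. (ennreal \<bar>h t x - k x\<bar>)\<^sup>2 \<partial>N)"
      by (rule Cauchy_Schwarz_nn_integral) auto
    finally show ?case by (simp add: ennreal_power G_def)
  qed
  note ev = this
  have lim2: "((\<lambda>t. G * (\<integral>\<^sup>+x. ennreal ((h t x - k x)\<^sup>2) \<partial>N)) \<longlongrightarrow> ennreal 0) F"
    using ennreal_tendsto_cmult[OF G lim] by simp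
  have "((\<lambda>t. ennreal ((?r t)\<^sup>2)) \<longlongrightarrow> ennreal 0) F"
    by (rule tendsto_sandwich[OF _ ev tendsto_const lim2]) simp
  then have "((\<lambda>t. (?r t)\<^sup>2) \<longlongrightarrow> 0) F" by (subst (asm) tendsto_ennreal_iff) auto
  then have "((\<lambda>t. sqrt ((?r t)\<^sup>2)) \<longlongrightarrow> sqrt 0) F" by (rule tendsto_real_sqrt)
  then have "(?r \<longlongrightarrow> 0) F" by (simp add: tendsto_rabs_zero_iff)
  then show ?thesis by (simp add: LIM_zero_iff)
qed

lemma bilinear_linear:
  "bilinear B \<Longrightarrow> linear (B x)" "bilinear B \<Longrightarrow> linear (\<lambda>x. B x y)"
  by (auto simp: bilinear_def)

lemma integral_gaussian_linear:
  fixes f :: "'b::euclidean_space \<Rightarrow> real"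
  assumes "linear f"
  shows "(\<integral>x. f x \<partial>gaussian 1) = 0"
proof -
  have "(\<integral>x. f (- x) \<partial>gaussian 1) = (\<integral>x. f x \<partial>gaussian 1)"
    by (rule integral_gaussian_isometry) (auto intro: linear_uminus linear_borel_measurable assms)
  then show ?thesis by (simp add: linear_neg[OF assms])
qed

lemma integrable_gaussian_norm2: "integrable (gaussian 1) (\<lambda>x::'b::euclidean_space. (norm x)\<^sup>2)"
  by (rule integrable_gaussian_power_bound[where k=2 and C=1]) auto

lemma integrable_quad_bound_square:
  "integrable (gaussian 1) (\<lambda>x::'b::euclidean_space. ((norm x)\<^sup>2 + c)\<^sup>2)"
proof -
  interpret prob_space "gaussian 1 :: 'b measure" by (rule prob_space_gaussian) simp
  have "integrable (gaussian 1) (\<lambda>x::'b. norm x ^ 4 + 2 * c * (norm x)\<^sup>2 + c\<^sup>2)"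
    using integrable_gaussian_norm2[where 'b='b] integrable_gaussian_norm4[where 'a='b] by simp
  then show ?thesis by (simp add: power2_sum add_ac mult_ac flip: power_mult)
qed

lemma square_integrable_quad_form:
  assumes B: "bilinear B"
  shows "square_integrable (gaussian 1) (quad_form B)"
proof -
  obtain b where b: "b \<ge> 0" "\<And>x y. \<bar>B x y\<bar> \<le> b * norm x * norm y" using bilinear_bound[OF B] by blast
  show ?thesis
    unfolding square_integrable_def
  proof (intro conjI Bochner_Integration.integrable_bound[OF integrable_mult_right[OF integrable_quad_bound_square]])
    note [measurable] = quad_form_measurable[OF B]
    show "quad_form B \<in> borel_measurable (gaussian 1)" "(\<lambda>x. (quad_form B x)\<^sup>2) \<in> borel_measurable (gaussian 1)"
      by measurable
    show "AE x in gaussian 1. norm ((quad_form B x)\<^sup>2) \<le> norm (b\<^sup>2 * ((norm x)\<^sup>2 + DIM('a))\<^sup>2)"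
    proof (rule AE_I2)
      fix x
      have "\<bar>quad_form B x\<bar>\<^sup>2 \<le> (b * ((norm x)\<^sup>2 + DIM('a)))\<^sup>2"
        by (intro power_mono quad_form_bound B b) auto
      then show "norm ((quad_form B x)\<^sup>2) \<le> norm (b\<^sup>2 * ((norm x)\<^sup>2 + DIM('a))\<^sup>2)"
        by (simp add: power_mult_distrib)
    qed
  qed
qed

context langevin_dual_pair begin

lemma integrable_invariant:
  fixes f :: "'a \<times> 'a \<Rightarrow> real"
  assumes t: "t > 0" and f: "integrable (gaussian 1) f"
  shows "integrable (gaussian 1 \<Otimes>\<^sub>M law t) (\<lambda>x. f (flow t (fst x) + snd x))"
    and "(\<integral>x. f (flow t (fst x) + snd x) \<partial>(gaussian 1 \<Otimes>\<^sub>M law t)) = (\<integral>x. f x \<partial>gaussian 1)"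
proof -
  note [measurable] = flow_measurable[OF t]
  have [measurable]: "f \<in> borel_measurable borel" using f by auto
  show "integrable (gaussian 1 \<Otimes>\<^sub>M law t) (\<lambda>x. f (flow t (fst x) + snd x))"
    using f integrable_distr_eq[of "\<lambda>x. flow t (fst x) + snd x" "gaussian 1 \<Otimes>\<^sub>M law t" borel f]
    by (simp add: invariant_measure[OF t])
  show "(\<integral>x. f (flow t (fst x) + snd x) \<partial>(gaussian 1 \<Otimes>\<^sub>M law t)) = (\<integral>x. f x \<partial>gaussian 1)"
    using integral_distr[of "\<lambda>x. flow t (fst x) + snd x" "gaussian 1 \<Otimes>\<^sub>M law t" borel f]
    by (simp add: invariant_measure[OF t])
qed

text \<open>Under the product measure both flow t z + y and z have standard Gaussian law, and y is
  dominated by the two because the flow is a contraction. Fubini then gives integrability for almost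
  every \<open>z\<close>, in a statement where \<open>z\<close> does not occur.\<close>

lemma integrable_law_norm2:
  assumes t: "t > 0"
  shows "integrable (law t) (\<lambda>y. (norm y)\<^sup>2)"
proof -
  interpret G: prob_space "gaussian 1 :: ('a \<times> 'a) measure" by (rule prob_space_gaussian) simp
  interpret law: prob_space "law t" using t by (intro prob_space_law) simp
  interpret P: pair_prob_space "gaussian 1 :: ('a \<times> 'a) measure" "law t" ..
  note [measurable] = flow_measurable[OF t]
  have 1: "integrable ((gaussian 1 :: ('a \<times> 'a) measure) \<Otimes>\<^sub>M law t) (\<lambda>x. (norm (flow t (fst x) + snd x))\<^sup>2)"
    by (rule integrable_invariant(1)[OF t]) (rule integrable_gaussian_norm2)
  have "distr (gaussian 1 \<Otimes>\<^sub>M law t) (gaussian 1) fst = (gaussian 1 :: ('a \<times> 'a) measure)"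
    by (rule law.distr_pair_fst)
  then have "integrable (distr ((gaussian 1 :: ('a \<times> 'a) measure) \<Otimes>\<^sub>M law t) (gaussian 1) fst) (\<lambda>x::'a \<times> 'a. (norm x)\<^sup>2)"
    using integrable_gaussian_norm2 by simp
  then have 2: "integrable ((gaussian 1 :: ('a \<times> 'a) measure) \<Otimes>\<^sub>M law t) (\<lambda>x. (norm (fst x))\<^sup>2)"
    by (subst (asm) integrable_distr_eq) auto
  have 3: "integrable ((gaussian 1 :: ('a \<times> 'a) measure) \<Otimes>\<^sub>M law t) (\<lambda>x. (norm (snd x))\<^sup>2)"
  proof (rule Bochner_Integration.integrable_bound)
    show "integrable ((gaussian 1 :: ('a \<times> 'a) measure) \<Otimes>\<^sub>M law t) (\<lambda>x. 2 * (norm (flow t (fst x) + snd x))\<^sup>2 + 2 * (norm (fst x))\<^sup>2)"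
      using 1 2 by simp
    have "(norm y)\<^sup>2 \<le> 2 * (norm (flow t z + y))\<^sup>2 + 2 * (norm z)\<^sup>2" for z y
    proof -
      have "norm y \<le> norm (flow t z + y) + norm z"
        using norm_triangle_ineq4[of "flow t z + y" "flow t z"] norm_flow[OF t, of z] by simp
      then have "(norm y)\<^sup>2 \<le> (norm (flow t z + y) + norm z)\<^sup>2" by (intro power_mono) auto
      also have "\<dots> \<le> 2 * (norm (flow t z + y))\<^sup>2 + 2 * (norm z)\<^sup>2"
        using zero_le_power2[of "norm (flow t z + y) - norm z"] by (simp add: power2_sum power2_diff)
      finally show ?thesis .
    qed
    then show "AE x in (gaussian 1 :: ('a \<times> 'a) measure) \<Otimes>\<^sub>M law t. norm ((norm (snd x))\<^sup>2)
        \<le> norm (2 * (norm (flow t (fst x) + snd x))\<^sup>2 + 2 * (norm (fst x))\<^sup>2)"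
      by (intro AE_I2) (simp add: abs_of_nonneg)
  qed measurable
  have "AE z in gaussian 1. integrable (law t) (\<lambda>y. (norm (snd (z :: 'a \<times> 'a, y)))\<^sup>2)"
    by (rule P.AE_integrable_fst'[OF 3])
  then show ?thesis by simp
qed

lemma integrable_law_linear:
  fixes f :: "'a \<times> 'a \<Rightarrow> real"
  assumes t: "t > 0" and f: "linear f"
  shows "integrable (law t) f"
proof -
  interpret law: prob_space "law t" using t by (intro prob_space_law) simp
  obtain c where c: "c > 0" "\<And>x. norm (f x) \<le> c * norm x" using linear_bounded_pos[OF f] by blast
  show ?thesis
  proof (rule Bochner_Integration.integrable_bound)
    show "integrable (law t) (\<lambda>y. c * (1 + (norm y)\<^sup>2))"
      using integrable_law_norm2[OF t] by simp
    show "f \<in> borel_measurable (law t)" using linear_borel_measurable[OF f] by simp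
    show "AE y in law t. norm (f y) \<le> norm (c * (1 + (norm y)\<^sup>2))"
    proof (rule AE_I2)
      fix y :: "'a \<times> 'a"
      have "norm y \<le> 1 + (norm y)\<^sup>2"
        using zero_le_power2[of "norm y - 1"] norm_ge_zero[of y] unfolding power2_diff power_one mult_1_right
        by linarith
      then have "c * norm y \<le> c * (1 + (norm y)\<^sup>2)" using c by (intro mult_left_mono) auto
      then show "norm (f y) \<le> norm (c * (1 + (norm y)\<^sup>2))" using c(2)[of y]
          abs_ge_self[of "c * (1 + (norm y)\<^sup>2)"] unfolding real_norm_def by linarith
    qed
  qed
qed

text \<open>Invariance forces the noise to be centred: a linear function has Gaussian mean 0 both
  before and after time \<open>t\<close>, and the only other contribution is its mean under
  \<open>law t\<close>.\<close>

lemma integral_law_linear: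
  fixes f :: "'a \<times> 'a \<Rightarrow> real"
  assumes t: "t > 0" and f: "linear f"
  shows "(\<integral>y. f y \<partial>law t) = 0"
proof -
  interpret G: prob_space "gaussian 1 :: ('a \<times> 'a) measure" by (rule prob_space_gaussian) simp
  interpret law: prob_space "law t" using t by (intro prob_space_law) simp
  interpret P: pair_prob_space "gaussian 1 :: ('a \<times> 'a) measure" "law t" ..
  have int: "integrable (gaussian 1) g" if g: "linear g" for g :: "'a \<times> 'a \<Rightarrow> real"
  proof -
    obtain c where "\<And>x. norm (g x) \<le> c * norm x" using linear_bounded[OF g] by blast
    then show ?thesis
      by (intro integrable_gaussian_power_bound[where k=1 and C=c] linear_borel_measurable[OF g]) auto
  qed
  have lf: "linear (\<lambda>z. f (flow t z))" using linear_compose[OF linear_flow[OF t] f] by (simp add: o_def)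
  have "0 = (\<integral>x. f (flow t (fst x) + snd x) \<partial>(gaussian 1 \<Otimes>\<^sub>M law t))"
    by (simp add: integrable_invariant(2)[OF t int[OF f]] integral_gaussian_linear[OF f])
  also have "\<dots> = (\<integral>z. (\<integral>y. f (flow t z + y) \<partial>law t) \<partial>gaussian 1)"
    using P.integral_fst'[OF integrable_invariant(1)[OF t int[OF f]]] by simp
  also have "\<dots> = (\<integral>z. f (flow t z) + (\<integral>y. f y \<partial>law t) \<partial>gaussian 1)"
    using integrable_law_linear[OF t f] by (simp add: linear_add[OF f] law.prob_space[simplified])
  also have "\<dots> = (\<integral>y. f y \<partial>law t)"
    using int[OF lf] integral_gaussian_linear[OF lf] G.prob_space by simp
  finally show ?thesis by simp
qed

lemma integrable_law_bilinear:
  assumes t: "t > 0" and B: "bilinear B"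
  shows "integrable (law t) (\<lambda>y. B y y :: real)"
proof -
  obtain b where b: "b \<ge> 0" "\<And>x y. \<bar>B x y\<bar> \<le> b * norm x * norm y" using bilinear_bound[OF B] by blast
  show ?thesis
  proof (rule Bochner_Integration.integrable_bound)
    show "integrable (law t) (\<lambda>y. b * (norm y)\<^sup>2)" using integrable_law_norm2[OF t] by simp
    show "(\<lambda>y. B y y) \<in> borel_measurable (law t)" by (rule bilinear_measurable[OF B]) auto
    show "AE y in law t. norm (B y y) \<le> norm (b * (norm y)\<^sup>2)"
      using b by (intro AE_I2) (simp add: abs_mult power2_eq_square mult.assoc)
  qed
qed

lemma integral_law_bilinear_add:
  assumes t: "t > 0" and B: "bilinear B"
  shows "(\<integral>y. B (u + y) (u + y) \<partial>law t) = B u u + (\<integral>y. B y y \<partial>law t :: real)"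
proof -
  interpret law: prob_space "law t" using t by (intro prob_space_law) simp
  have "(\<integral>y. B (u + y) (u + y) \<partial>law t) = (\<integral>y. B u u + B u y + B y u + B y y \<partial>law t)"
    by (simp add: bilinear_ladd[OF B] bilinear_radd[OF B] algebra_simps)
  also have "\<dots> = B u u + (\<integral>y. B y y \<partial>law t)"
    using integrable_law_linear[OF t bilinear_linear(1)[OF B]] integrable_law_linear[OF t bilinear_linear(2)[OF B]]
      integral_law_linear[OF t bilinear_linear(1)[OF B]] integral_law_linear[OF t bilinear_linear(2)[OF B]]
      integrable_law_bilinear[OF t B] by (simp add: law.prob_space[simplified])
  finally show ?thesis .
qed

lemma bilinear_flow:
  "\<lbrakk>t > 0; bilinear B\<rbrakk> \<Longrightarrow> bilinear (\<lambda>x y. B (flow t x) (flow t y))"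
  unfolding bilinear_def
  using linear_compose[OF linear_flow, of t "B _"] linear_compose[OF linear_flow, of t "\<lambda>x. B x _"]
  by (simp add: o_def del: split_paired_All)

text \<open>Invariance of the Gaussian gives the covariance of the noise without any stochastic integration.\<close>

lemma integral_law_bilinear:
  assumes t: "t > 0" and B: "bilinear B"
  shows "(\<integral>y. B y y \<partial>law t) = (\<Sum>b\<in>Basis. B b b) - (\<Sum>b\<in>Basis. B (flow t b) (flow t b) :: real)"
proof -
  interpret G: prob_space "gaussian 1 :: ('a \<times> 'a) measure" by (rule prob_space_gaussian) simp
  interpret law: prob_space "law t" using t by (intro prob_space_law) simp
  interpret P: pair_prob_space "gaussian 1 :: ('a \<times> 'a) measure" "law t" ..
  note F = bilinear_flow[OF t B]
  have "(\<Sum>b\<in>Basis. B b b) = (\<integral>x. B (flow t (fst x) + snd x) (flow t (fst x) + snd x) \<partial>(gaussian 1 \<Otimes>\<^sub>M law t))"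
    using integrable_invariant(2)[OF t integrable_gaussian_bilinear[OF B]] integral_gaussian_bilinear[OF B] by simp
  also have "\<dots> = (\<integral>z. (\<integral>y. B (flow t z + y) (flow t z + y) \<partial>law t) \<partial>gaussian 1)"
    using P.integral_fst'[OF integrable_invariant(1)[OF t integrable_gaussian_bilinear[OF B]]] by simp
  also have "\<dots> = (\<integral>z. B (flow t z) (flow t z) + (\<integral>y. B y y \<partial>law t) \<partial>gaussian 1)"
    by (simp add: integral_law_bilinear_add[OF t B])
  also have "\<dots> = (\<Sum>b\<in>Basis. B (flow t b) (flow t b)) + (\<integral>y. B y y \<partial>law t)"
    using integrable_gaussian_bilinear[OF F] integral_gaussian_bilinear[OF F] G.prob_space by simp
  finally show ?thesis by simp
qed

text \<open>The noise contributes the trace of \<open>B\<close> minus the trace of the pulled-back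
  form, which is exactly the change of centring in \<open>quad_form\<close>.\<close>

lemma semigroup_quad_form:
  assumes t: "t > 0" and B: "bilinear B"
  shows "markov_semigroup M X t (quad_form B) z = quad_form (\<lambda>x y. B (flow t x) (flow t y)) z"
proof -
  interpret law: prob_space "law t" using t by (intro prob_space_law) simp
  have i: "integrable (law t) (\<lambda>y. B (u + y) (u + y))" for u
    using integrable_law_linear[OF t bilinear_linear(1)[OF B]] integrable_law_linear[OF t bilinear_linear(2)[OF B]]
      integrable_law_bilinear[OF t B]
    by (simp add: bilinear_ladd[OF B] bilinear_radd[OF B])
  show ?thesis
    unfolding markov_semigroup_X[OF t quad_form_measurable[OF B]] quad_form_def
    using i law.prob_space by (simp add: integral_law_bilinear_add[OF t B] integral_law_bilinear[OF t B])
qed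

end

section \<open>The Poisson equation\<close>

text \<open>This is the derivative of \<open>B\<close> along the drift. The second-order part of the
  generator adds only a constant to a quadratic function, and the centring in
  \<open>quad_form\<close> accounts for it.\<close>

definition generator_form ::
  "real \<Rightarrow> ('a::euclidean_space \<times> 'a \<Rightarrow> 'a \<times> 'a) \<Rightarrow> ('a \<times> 'a \<Rightarrow> 'a \<times> 'a \<Rightarrow> real) \<Rightarrow> 'a \<times> 'a \<Rightarrow> 'a \<times> 'a \<Rightarrow> real" where
  "generator_form \<gamma> R B x y = B (drift \<gamma> R x) y + B x (drift \<gamma> R y)"

context langevin_dual_pair begin

text \<open>Both sides integrate g(x) \<phi>(y) over the stationary two-point law. Its marginals are
  Gaussian, so the two factors are square integrable and Fubini applies.\<close>

lemma semigroup_duality: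
  assumes t: "t > 0" and g: "square_integrable (gaussian 1) g" and \<phi>: "square_integrable (gaussian 1) \<phi>"
  shows "integrable (gaussian 1) (\<lambda>z. g z * markov_semigroup M X t \<phi> z)"
    and "integrable (gaussian 1) (\<lambda>z. \<phi> z * markov_semigroup M X' t g z)"
    and "(\<integral>z. g z * markov_semigroup M X t \<phi> z \<partial>gaussian 1) = (\<integral>z. \<phi> z * markov_semigroup M X' t g z \<partial>gaussian 1)"
proof -
  interpret G: prob_space "gaussian 1 :: ('a \<times> 'a) measure" by (rule prob_space_gaussian) simp
  interpret law: prob_space "law t" using t by (intro prob_space_law) simp
  interpret dlaw: prob_space "dual.law t" using t by (intro dual.prob_space_law) simp
  interpret P: pair_prob_space "gaussian 1 :: ('a \<times> 'a) measure" "law t" ..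
  interpret D: pair_prob_space "gaussian 1 :: ('a \<times> 'a) measure" "dual.law t" ..
  note [measurable] = flow_measurable[OF t] dual.flow_measurable[OF t]
  have [measurable]: "g \<in> borel_measurable borel" "\<phi> \<in> borel_measurable borel"
    using g \<phi> by (auto simp: square_integrable_def)
  let ?J = "distr (gaussian 1 \<Otimes>\<^sub>M law t) (borel \<Otimes>\<^sub>M borel) (\<lambda>x. (fst x, flow t (fst x) + snd x))"
  have fst: "distr ?J borel fst = gaussian 1"
  proof -
    have "distr ?J borel fst = distr (gaussian 1 \<Otimes>\<^sub>M law t) (gaussian 1) fst"
      by (subst distr_distr) (auto simp: o_def intro!: distr_cong)
    then show ?thesis by (simp only: law.distr_pair_fst)
  qed
  have snd: "distr ?J borel snd = gaussian 1"
    by (subst distr_distr) (auto simp: o_def invariant_measure[OF t])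
  have "square_integrable ?J (\<lambda>x. g (fst x))"
    using g integrable_distr_eq[of fst ?J borel "\<lambda>x. (g x)\<^sup>2"] fst by (simp add: square_integrable_def)
  moreover have "square_integrable ?J (\<lambda>x. \<phi> (snd x))"
    using \<phi> integrable_distr_eq[of snd ?J borel "\<lambda>x. (\<phi> x)\<^sup>2"] snd by (simp add: square_integrable_def)
  ultimately have iJ: "integrable ?J (\<lambda>x. g (fst x) * \<phi> (snd x))" by (rule square_integrable_mult)
  have i1: "integrable (gaussian 1 \<Otimes>\<^sub>M law t) (\<lambda>x. g (fst x) * \<phi> (flow t (fst x) + snd x))"
    using iJ by (subst (asm) integrable_distr_eq) auto
  have i2: "integrable (gaussian 1 \<Otimes>\<^sub>M dual.law t) (\<lambda>x. g (dual.flow t (fst x) + snd x) * \<phi> (fst x))"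
    using iJ unfolding joint_law_duality[OF t] by (subst (asm) integrable_distr_eq) auto
  have m1: "(\<integral>y. g z * \<phi> (flow t z + y) \<partial>law t) = g z * markov_semigroup M X t \<phi> z" for z
    by (simp add: markov_semigroup_X[OF t])
  have m2: "(\<integral>y. g (dual.flow t z + y) * \<phi> z \<partial>dual.law t) = \<phi> z * markov_semigroup M X' t g z" for z
    by (simp add: dual.markov_semigroup_X[OF t])
  show "integrable (gaussian 1) (\<lambda>z. g z * markov_semigroup M X t \<phi> z)"
    using P.integrable_fst'[OF i1] unfolding fst_conv snd_conv m1 .
  show "integrable (gaussian 1) (\<lambda>z. \<phi> z * markov_semigroup M X' t g z)"
    using D.integrable_fst'[OF i2] unfolding fst_conv snd_conv m2 .
  have "(\<integral>z. g z * markov_semigroup M X t \<phi> z \<partial>gaussian 1) = (\<integral>x. g (fst x) * \<phi> (flow t (fst x) + snd x) \<partial>(gaussian 1 \<Otimes>\<^sub>M law t))"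
    using P.integral_fst'[OF i1] unfolding fst_conv snd_conv m1 .
  also have "\<dots> = (\<integral>x. g (fst x) * \<phi> (snd x) \<partial>?J)"
    by (subst integral_distr) auto
  also have "\<dots> = (\<integral>x. g (dual.flow t (fst x) + snd x) * \<phi> (fst x) \<partial>(gaussian 1 \<Otimes>\<^sub>M dual.law t))"
    unfolding joint_law_duality[OF t] by (subst integral_distr) auto
  also have "\<dots> = (\<integral>z. \<phi> z * markov_semigroup M X' t g z \<partial>gaussian 1)"
    using D.integral_fst'[OF i2] unfolding fst_conv snd_conv m2 by (rule sym)
  finally show "(\<integral>z. g z * markov_semigroup M X t \<phi> z \<partial>gaussian 1) = (\<integral>z. \<phi> z * markov_semigroup M X' t g z \<partial>gaussian 1)" .
qed

lemma semigroup_measurable: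
  assumes t: "t > 0" and [measurable]: "\<phi> \<in> borel_measurable borel"
  shows "markov_semigroup M X t \<phi> \<in> borel_measurable borel"
proof -
  interpret law: prob_space "law t" using t by (intro prob_space_law) simp
  note [measurable] = flow_measurable[OF t]
  have "(\<lambda>z. \<integral>y. \<phi> (flow t z + y) \<partial>law t) \<in> borel_measurable borel" by measurable
  then show ?thesis
    using markov_semigroup_X[OF t, of \<phi>] by (simp cong: measurable_cong)
qed

lemma bilinear_generator_form:
  assumes "bilinear B"
  shows "bilinear (generator_form \<gamma> R B)"
  unfolding bilinear_def generator_form_def
  using linear_compose[OF linear_drift, of "B _"] linear_compose[OF linear_drift, of "\<lambda>x. B x _"] assms
  by (auto simp: bilinear_def o_def intro!: linear_compose_add simp del: split_paired_All)

text \<open>The error of the difference quotient is itself a centred quadratic form, with bilinear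
  form of size O(t). Its squared L^2 norm is therefore O(t^2), with a fourth moment as
  factor.\<close>

lemma generator_quad_form:
  assumes B: "bilinear B"
  shows "generator_graph M (gaussian 1) X (quad_form B) (quad_form (generator_form \<gamma> R B))"
proof -
  obtain b where b0: "b \<ge> 0" and b: "\<And>x y. \<bar>B x y\<bar> \<le> b * norm x * norm y" using bilinear_bound[OF B] by blast
  obtain a where a0: "a > 0" and a: "\<And>x. norm (drift \<gamma> R x) \<le> a * norm x" using drift_bound by blast
  \<comment> \<open>The error splits into three terms, each bounded by \<open>b * a\<^sup>2\<close>
    times t^2 and the two norms before division by \<open>t\<close>.\<close>
  define K where "K = 3 * b * a\<^sup>2"
  define m where "m = (\<integral>z. ((norm (z :: 'a \<times> 'a))\<^sup>2 + DIM('a \<times> 'a))\<^sup>2 \<partial>gaussian 1)"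
  let ?A = "drift \<gamma> R"
  have bound: "(\<integral>\<^sup>+z. ennreal (((markov_semigroup M X t (quad_form B) z - quad_form B z) / t
      - quad_form (generator_form \<gamma> R B) z)\<^sup>2) \<partial>gaussian 1) \<le> ennreal (K\<^sup>2 * t\<^sup>2 * m)" if t: "t > 0" for t
  proof -
    define E where "E x y = (B (flow t x) (flow t y) - B x y) / t - generator_form \<gamma> R B x y" for x y
    have bE: "bilinear E"
    proof -
      note F = bilinear_flow[OF t B] and G = bilinear_generator_form[OF B]
      show ?thesis
        unfolding E_def bilinear_def linear_iff
        by (simp add: bilinear_ladd[OF F] bilinear_radd[OF F] bilinear_lmul[OF F] bilinear_rmul[OF F]
            bilinear_ladd[OF G] bilinear_radd[OF G] bilinear_lmul[OF G] bilinear_rmul[OF G]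
            bilinear_ladd[OF B] bilinear_radd[OF B] bilinear_lmul[OF B] bilinear_rmul[OF B]
            diff_divide_distrib add_divide_distrib right_diff_distrib)
    qed
    have eq: "(markov_semigroup M X t (quad_form B) z - quad_form B z) / t - quad_form (generator_form \<gamma> R B) z = quad_form E z" for z
      unfolding semigroup_quad_form[OF t B] quad_form_def E_def
      by (simp add: sum_subtractf sum_divide_distrib[symmetric] diff_divide_distrib)
    note fd = flow_derivative[OF a less_imp_le[OF a0] t]
    have E_le: "\<bar>E x y\<bar> \<le> K * t * norm x * norm y" for x y
    proof -
      \<comment> \<open>The arguments are replaced one at a time: the outer terms are second-order
        errors of the flow, the middle one is a product of two first-order terms.\<close>
      have "t * E x y = B (flow t x - x - t *\<^sub>R ?A x) (flow t y) + t * B (?A x) (flow t y - y) + B x (flow t y - y - t *\<^sub>R ?A y)"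
      proof -
        have "t * E x y = B (flow t x) (flow t y) - B x y - t * (B (?A x) y + B x (?A y))"
          using t by (simp add: E_def generator_form_def field_simps)
        then show ?thesis
          by (simp add: bilinear_lsub[OF B] bilinear_rsub[OF B] bilinear_lmul[OF B] bilinear_rmul[OF B]
              right_diff_distrib distrib_left)
      qed
      also have "\<bar>\<dots>\<bar> \<le> b * (a\<^sup>2 * t\<^sup>2 * norm x) * norm y + t * (b * (a * norm x) * (a * t * norm y)) + b * norm x * (a\<^sup>2 * t\<^sup>2 * norm y)"
      proof (intro order_trans[OF abs_triangle_ineq] add_mono)
        show "\<bar>B (flow t x - x - t *\<^sub>R ?A x) (flow t y)\<bar> \<le> b * (a\<^sup>2 * t\<^sup>2 * norm x) * norm y"
          by (rule order_trans[OF b]) (intro mult_mono mult_left_mono fd norm_flow[OF t] b0 mult_nonneg_nonneg norm_ge_zero zero_le_power2 order_refl)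
        show "\<bar>t * B (?A x) (flow t y - y)\<bar> \<le> t * (b * (a * norm x) * (a * t * norm y))"
          unfolding abs_mult abs_of_pos[OF t]
          by (intro mult_left_mono order_trans[OF b] mult_mono a fd) (use t a0 b0 in auto)
        show "\<bar>B x (flow t y - y - t *\<^sub>R ?A y)\<bar> \<le> b * norm x * (a\<^sup>2 * t\<^sup>2 * norm y)"
          by (rule order_trans[OF b]) (intro mult_left_mono fd b0 mult_nonneg_nonneg norm_ge_zero)
      qed
      also have "\<dots> = t * (K * t * norm x * norm y)" by (simp add: K_def power2_eq_square algebra_simps)
      finally show ?thesis using t by (simp add: abs_mult)
    qed
    have "(\<integral>\<^sup>+z. ennreal ((quad_form E z)\<^sup>2) \<partial>gaussian 1)
       \<le> (\<integral>\<^sup>+z. ennreal (K\<^sup>2 * t\<^sup>2 * ((norm (z :: 'a \<times> 'a))\<^sup>2 + DIM('a \<times> 'a))\<^sup>2) \<partial>gaussian 1)"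
    proof (intro nn_integral_mono ennreal_leI)
      fix z
      have "\<bar>quad_form E z\<bar>\<^sup>2 \<le> (K * t * ((norm z)\<^sup>2 + DIM('a \<times> 'a)))\<^sup>2"
        by (intro power_mono quad_form_bound bE E_le) auto
      then show "(quad_form E z)\<^sup>2 \<le> K\<^sup>2 * t\<^sup>2 * ((norm z)\<^sup>2 + DIM('a \<times> 'a))\<^sup>2"
        by (simp add: power_mult_distrib)
    qed
    also have "\<dots> = ennreal (K\<^sup>2 * t\<^sup>2 * m)"
      unfolding m_def using integrable_quad_bound_square[where 'b="'a \<times> 'a" and c="DIM('a \<times> 'a)"]
      by (subst nn_integral_eq_integral) auto
    finally show ?thesis unfolding eq .
  qed
  have "((\<lambda>t. ennreal (K\<^sup>2 * t\<^sup>2 * m)) \<longlongrightarrow> ennreal (K\<^sup>2 * 0\<^sup>2 * m)) (at_right 0)"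
    by (intro tendsto_ennrealI tendsto_intros)
  then have lim: "((\<lambda>t. ennreal (K\<^sup>2 * t\<^sup>2 * m)) \<longlongrightarrow> 0) (at_right 0)" by simp
  have "((\<lambda>t. \<integral>\<^sup>+z. ennreal (((markov_semigroup M X t (quad_form B) z - quad_form B z) / t
      - quad_form (generator_form \<gamma> R B) z)\<^sup>2) \<partial>gaussian 1) \<longlongrightarrow> 0) (at_right 0)"
    by (rule tendsto_sandwich[OF _ _ tendsto_const lim])
      (auto intro!: eventually_at_right_less[THEN eventually_mono] bound)
  then show ?thesis
    by (simp add: generator_graph_def square_integrable_quad_form B bilinear_generator_form)
qed

end

context langevin_dual_pair begin

lemma dual_generator_quad_form:
  assumes B: "bilinear B"
  shows "generator_graph M (gaussian 1) X' (quad_form B) (quad_form (generator_form \<gamma> (\<lambda>x. - R x) B))"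
proof -
  interpret rev: langevin_dual_pair "\<lambda>x. - R x" \<gamma> M W X' X
    using langevin_process_axioms dual.langevin_process_axioms
    by (simp add: langevin_dual_pair_def)
  show ?thesis by (rule rev.generator_quad_form[OF B])
qed

text \<open>With L \<phi> = - F and L* \<chi> = - F one has <\<chi>, F> = - <\<chi>, L \<phi>> = -
  <L* \<chi>, \<phi>> = <\<phi>, F>. The adjoint is used only for difference quotients at positive
  times, so \<phi> may be any element of the domain. The value is thus the same for all
  solutions.\<close>

lemma poisson_inner_product:
  assumes \<phi>: "poisson_solution M (gaussian 1) X F \<phi>" and B: "bilinear B"
    and BF: "\<And>z. quad_form (generator_form \<gamma> (\<lambda>x. - R x) B) z = - F z"
  shows "(\<integral>z. \<phi> z * F z \<partial>gaussian 1) = (\<integral>z. quad_form B z * F z \<partial>gaussian 1)"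
proof -
  let ?N = "gaussian 1 :: ('a \<times> 'a) measure"
  let ?\<chi> = "quad_form B"
  have sq: "square_integrable ?N \<phi>" and sF: "square_integrable ?N (\<lambda>z. - F z)"
    and l1: "((\<lambda>t. \<integral>\<^sup>+z. ennreal (((markov_semigroup M X t \<phi> z - \<phi> z) / t - - F z)\<^sup>2) \<partial>?N) \<longlongrightarrow> 0) (at_right 0)"
    using \<phi> by (auto simp: poisson_solution_def generator_graph_def)
  have l2: "((\<lambda>t. \<integral>\<^sup>+z. ennreal (((markov_semigroup M X' t ?\<chi> z - ?\<chi> z) / t - - F z)\<^sup>2) \<partial>?N) \<longlongrightarrow> 0) (at_right 0)"
    using dual_generator_quad_form[OF B] by (simp add: generator_graph_def BF)
  have s\<chi>: "square_integrable ?N ?\<chi>" by (rule square_integrable_quad_form[OF B])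
  interpret rev: langevin_dual_pair "\<lambda>x. - R x" \<gamma> M W X' X
    using langevin_process_axioms dual.langevin_process_axioms
    by (simp add: langevin_dual_pair_def)
  have m: "\<phi> \<in> borel_measurable borel" "?\<chi> \<in> borel_measurable borel"
    using sq s\<chi> by (auto simp: square_integrable_def)
  note [measurable] = m
  note prod = square_integrable_mult[OF s\<chi> sq]
  have 1: "((\<lambda>t. \<integral>z. ?\<chi> z * ((markov_semigroup M X t \<phi> z - \<phi> z) / t) \<partial>?N) \<longlongrightarrow> (\<integral>z. ?\<chi> z * - F z \<partial>?N)) (at_right 0)"
  proof (rule integral_mult_tendsto_L2[OF s\<chi> sF eventually_mono[OF eventually_at_right_less] l1], intro conjI)
    fix t :: real assume t: "0 < t"
    note [measurable] = semigroup_measurable[OF t m(1)]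
    show "(\<lambda>z. (markov_semigroup M X t \<phi> z - \<phi> z) / t) \<in> borel_measurable ?N" by measurable
    show "integrable ?N (\<lambda>z. ?\<chi> z * ((markov_semigroup M X t \<phi> z - \<phi> z) / t))"
      using semigroup_duality(1)[OF t s\<chi> sq] prod by (simp add: right_diff_distrib)
  qed
  have 2: "((\<lambda>t. \<integral>z. \<phi> z * ((markov_semigroup M X' t ?\<chi> z - ?\<chi> z) / t) \<partial>?N) \<longlongrightarrow> (\<integral>z. \<phi> z * - F z \<partial>?N)) (at_right 0)"
  proof (rule integral_mult_tendsto_L2[OF sq sF eventually_mono[OF eventually_at_right_less] l2], intro conjI)
    fix t :: real assume t: "0 < t"
    note [measurable] = rev.semigroup_measurable[OF t m(2)]
    show "(\<lambda>z. (markov_semigroup M X' t ?\<chi> z - ?\<chi> z) / t) \<in> borel_measurable ?N" by measurable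
    show "integrable ?N (\<lambda>z. \<phi> z * ((markov_semigroup M X' t ?\<chi> z - ?\<chi> z) / t))"
      using semigroup_duality(2)[OF t s\<chi> sq] prod by (simp add: right_diff_distrib mult.commute)
  qed
  have "eventually (\<lambda>t. (\<integral>z. ?\<chi> z * ((markov_semigroup M X t \<phi> z - \<phi> z) / t) \<partial>?N)
     = (\<integral>z. \<phi> z * ((markov_semigroup M X' t ?\<chi> z - ?\<chi> z) / t) \<partial>?N)) (at_right 0)"
  proof (rule eventually_mono[OF eventually_at_right_less])
    fix t :: real assume t: "0 < t"
    show "(\<integral>z. ?\<chi> z * ((markov_semigroup M X t \<phi> z - \<phi> z) / t) \<partial>?N)
     = (\<integral>z. \<phi> z * ((markov_semigroup M X' t ?\<chi> z - ?\<chi> z) / t) \<partial>?N)"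
      using semigroup_duality[OF t s\<chi> sq] prod
      by (simp add: right_diff_distrib mult.commute[of "\<phi> _" "?\<chi> _"])
  qed
  from Lim_transform_eventually[OF 1 this] 2
  have "(\<integral>z. ?\<chi> z * - F z \<partial>?N) = (\<integral>z. \<phi> z * - F z \<partial>?N)"
    by (rule tendsto_unique[rotated]) simp
  then show ?thesis by simp
qed

text \<open>The form \<open>B\<close> exhibits a solution, so that the choice operator returns one;
  the adjoint form \<open>D\<close> evaluates it.\<close>

lemma asymptotic_variance_eq:
  fixes F :: "'a \<times> 'a \<Rightarrow> real"
  assumes B: "bilinear B" "\<And>z. quad_form (generator_form \<gamma> R B) z = - F z"
    and D: "bilinear D" "\<And>z. quad_form (generator_form \<gamma> (\<lambda>x. - R x) D) z = - F z"
  shows "(\<integral>z. (SOME \<phi>. poisson_solution M (gaussian 1) X F \<phi>) z * F z \<partial>gaussian 1)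
    = (\<integral>z. quad_form D z * F z \<partial>gaussian 1)"
proof (rule poisson_inner_product[OF _ D])
  have "poisson_solution M (gaussian 1) X F (quad_form B)"
    using generator_quad_form[OF B(1)] integral_quad_form[OF B(1)]
    by (simp add: poisson_solution_def B(2)[abs_def])
  then show "poisson_solution M (gaussian 1) X F (SOME \<phi>. poisson_solution M (gaussian 1) X F \<phi>)"
    by (rule someI[of "poisson_solution M (gaussian 1) X F"])
qed

end

section \<open>The commutator equation\<close>

definition commutator :: "real^'n^'n \<Rightarrow> real^'n^'n \<Rightarrow> real^'n^'n" where
  "commutator J X = J ** X - X ** J"

lemma matrix_inner_mult_left:
  fixes A B C :: "real^'n^'n"
  shows "(A ** B) \<bullet> C = B \<bullet> (transpose A ** C)"
proof -
  have "(A ** B) \<bullet> C = (\<Sum>i\<in>UNIV. \<Sum>j\<in>UNIV. \<Sum>k\<in>UNIV. A $ i $ k * B $ k $ j * C $ i $ j)"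
    by (simp add: inner_vec_def matrix_matrix_mult_def sum_distrib_right)
  also have "\<dots> = (\<Sum>i\<in>UNIV. \<Sum>k\<in>UNIV. \<Sum>j\<in>UNIV. A $ i $ k * B $ k $ j * C $ i $ j)"
    by (intro sum.cong refl sum.swap)
  also have "\<dots> = (\<Sum>k\<in>UNIV. \<Sum>i\<in>UNIV. \<Sum>j\<in>UNIV. A $ i $ k * B $ k $ j * C $ i $ j)"
    by (rule sum.swap)
  also have "\<dots> = (\<Sum>k\<in>UNIV. \<Sum>j\<in>UNIV. \<Sum>i\<in>UNIV. A $ i $ k * B $ k $ j * C $ i $ j)"
    by (intro sum.cong refl sum.swap)
  also have "\<dots> = B \<bullet> (transpose A ** C)"
    by (simp add: inner_vec_def matrix_matrix_mult_def transpose_def sum_distrib_left mult_ac)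
  finally show ?thesis .
qed

lemma transpose_inner: "transpose A \<bullet> transpose B = A \<bullet> (B :: real^'n^'n)"
  unfolding inner_vec_def transpose_def by (simp, rule sum.swap)

lemma matrix_inner_mult_right:
  fixes A B C :: "real^'n^'n"
  shows "(B ** A) \<bullet> C = B \<bullet> (C ** transpose A)"
proof -
  have "(B ** A) \<bullet> C = (transpose A ** transpose B) \<bullet> transpose C"
    by (metis matrix_transpose_mul transpose_inner)
  also have "\<dots> = transpose B \<bullet> (A ** transpose C)"
    by (simp add: matrix_inner_mult_left)
  also have "\<dots> = B \<bullet> (C ** transpose A)"
    by (metis matrix_transpose_mul transpose_inner transpose_transpose)
  finally show ?thesis .
qed

lemma matrix_minus_left: "(- A) ** B = - (A ** (B :: real^'n^'n))"
  and matrix_minus_right: "A ** (- B) = - (A ** (B :: real^'n^'n))"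
  by (simp_all add: matrix_matrix_mult_def vec_eq_iff sum_negf)

lemma matrix_diff_left: "(A - B) ** C = A ** C - B ** (C :: real^'n^'n)"
  and matrix_diff_right: "C ** (A - B) = C ** A - C ** (B :: real^'n^'n)"
  by (simp_all add: matrix_matrix_mult_def vec_eq_iff sum_subtractf algebra_simps)

lemma linear_commutator: "linear (commutator J)"
  unfolding linear_iff commutator_def
  by (simp add: vec_eq_iff matrix_matrix_mult_def sum.distrib sum_distrib_left algebra_simps)

lemma commutator_skew:
  assumes "skew_symmetric J"
  shows "commutator J X \<bullet> Y = - (X \<bullet> commutator J Y)"
proof -
  have t: "transpose J = - J" using assms by (simp add: skew_symmetric_def)
  show ?thesis
    by (simp add: commutator_def inner_diff_left inner_diff_right matrix_inner_mult_left[of J]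
        matrix_inner_mult_right[of X J] t matrix_minus_left matrix_minus_right)
qed

lemma commutator_skew_0: "skew_symmetric J \<Longrightarrow> X \<bullet> commutator J X = 0"
  using commutator_skew[of J X X] by (simp add: inner_commute)

lemma inner_mat_1: "A \<bullet> (mat 1 :: real^'n^'n) = trace A"
  by (simp add: inner_vec_def mat_def trace_def if_distrib cong: if_cong)

lemma trace_commutator: "trace (commutator J X) = 0"
  by (simp add: commutator_def trace_sub trace_mul_sym[of J X])

text \<open>The block equations of \<open>- L \<chi> = f\<close> for the quadratic function \<open>\<chi>\<close> with blocks \<open>X\<close>
  (position), \<open>Y\<close> (mixed) and \<open>Z\<close> (momentum).\<close>

definition block_equations ::
  "real \<Rightarrow> real \<Rightarrow> real^'n^'n \<Rightarrow> real^'n^'n \<Rightarrow> real^'n^'n \<Rightarrow> real^'n^'n \<Rightarrow> real^'n^'n \<Rightarrow> bool" where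
  "block_equations \<gamma> \<mu> J K X Y Z \<longleftrightarrow>
     \<mu> *\<^sub>R commutator J X - 2 *\<^sub>R Y = - K \<and>
     \<mu> *\<^sub>R commutator J Y + X - \<gamma> *\<^sub>R Y - Z = 0 \<and>
     \<mu> *\<^sub>R commutator J Z + 2 *\<^sub>R Y - (2 * \<gamma>) *\<^sub>R Z = 0"

text \<open>Pairing the equations with \<open>X\<close>, \<open>Y\<close> and \<open>Z\<close>
  removes the commutators and leaves <K, X> = 2 <Y, X>, <Y, X> = <Y, Z> + \<gamma> |Y|^2 and <Y, Z>
  = \<gamma> |Z|^2.\<close>

lemma block_equations_energy:
  assumes J: "skew_symmetric J" and e: "block_equations \<gamma> \<mu> J K X Y Z"
  shows "K \<bullet> X = 2 * \<gamma> * (Y \<bullet> Y + Z \<bullet> Z)"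
proof -
  have 1: "K = 2 *\<^sub>R Y - \<mu> *\<^sub>R commutator J X"
    and 2: "X = Z + \<gamma> *\<^sub>R Y - \<mu> *\<^sub>R commutator J Y"
    and 3: "2 *\<^sub>R Y = (2 * \<gamma>) *\<^sub>R Z - \<mu> *\<^sub>R commutator J Z"
    using e by (auto simp: block_equations_def algebra_simps)
  have "K \<bullet> X = 2 * (Y \<bullet> X)"
    using arg_cong[OF 1, of "\<lambda>A. A \<bullet> X"] commutator_skew_0[OF J, of X]
    by (simp add: inner_diff_left inner_diff_right inner_commute)
  also have "Y \<bullet> X = Y \<bullet> Z + \<gamma> * (Y \<bullet> Y)"
    using arg_cong[OF 2, of "inner Y"] commutator_skew_0[OF J, of Y]
    by (simp add: inner_diff_right inner_add_right)
  also have "Y \<bullet> Z = \<gamma> * (Z \<bullet> Z)"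
  proof -
    have "(2 *\<^sub>R Y) \<bullet> Z = ((2 * \<gamma>) *\<^sub>R Z - \<mu> *\<^sub>R commutator J Z) \<bullet> Z" by (simp only: 3)
    then show ?thesis using commutator_skew_0[OF J, of Z] by (simp add: inner_diff_left inner_diff_right inner_commute)
  qed
  finally show ?thesis by (simp add: algebra_simps)
qed

text \<open>The system is square, and the energy identity for K = 0 makes it injective; finite
  dimension does the rest.\<close>

lemma block_equations_exist:
  fixes K :: "real^'n^'n"
  assumes J: "skew_symmetric J" and \<gamma>: "\<gamma> > 0"
  shows "\<exists>X Y Z. block_equations \<gamma> \<mu> J K X Y Z"
proof -
  define T :: "(real^'n^'n) \<times> (real^'n^'n) \<times> (real^'n^'n) \<Rightarrow> (real^'n^'n) \<times> (real^'n^'n) \<times> (real^'n^'n)" where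
    "T x = (\<mu> *\<^sub>R commutator J (fst x) - 2 *\<^sub>R fst (snd x),
      \<mu> *\<^sub>R commutator J (fst (snd x)) + fst x - \<gamma> *\<^sub>R fst (snd x) - snd (snd x),
      \<mu> *\<^sub>R commutator J (snd (snd x)) + 2 *\<^sub>R fst (snd x) - (2 * \<gamma>) *\<^sub>R snd (snd x))" for x
  have be: "block_equations \<gamma> \<mu> J K X Y Z \<longleftrightarrow> T (X, Y, Z) = (- K, 0, 0)" for K X Y Z
    by (simp add: block_equations_def T_def)
  have lin: "linear T"
    unfolding linear_iff T_def
    by (simp add: linear_add[OF linear_commutator] linear_scale[OF linear_commutator] algebra_simps)
  have "x = 0" if "T x = 0" for x
  proof -
    obtain X Y Z where x: "x = (X, Y, Z)" by (metis surj_pair)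
    have e: "block_equations \<gamma> \<mu> J 0 X Y Z" using that by (simp add: be x zero_prod_def)
    from block_equations_energy[OF J e] have "Y \<bullet> Y + Z \<bullet> Z = 0" using \<gamma> by simp
    then have YZ: "Y = 0" "Z = 0"
      using inner_ge_zero[of Y] inner_ge_zero[of Z] by (auto simp: add_nonneg_eq_0_iff)
    then have "X = 0" using e linear_0[OF linear_commutator, of J] by (simp add: block_equations_def)
    with YZ show "x = 0" by (simp add: x zero_prod_def)
  qed
  then have "inj T" using linear_injective_0[OF lin] by blast
  then have "surj T" using linear_injective_imp_surjective[OF lin] by simp
  then obtain x where "T x = (- K, 0, 0)" by (metis surjE)
  then show ?thesis by (metis be prod.collapse)
qed

text \<open>For a skew operator the orthogonal complement of the range is contained in the
  kernel.\<close>

lemma commutator_decomposition: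
  fixes K :: "real^'n^'n"
  assumes J: "skew_symmetric J"
  obtains K0 S where "K = K0 + commutator J S" "commutator J K0 = 0"
proof -
  obtain y z where y: "y \<in> span (range (commutator J))" and z: "\<And>w. w \<in> span (range (commutator J)) \<Longrightarrow> orthogonal z w"
    and K: "K = y + z"
    using orthogonal_subspace_decomp_exists[of "range (commutator J)" K] by metis
  have "span (range (commutator J)) = range (commutator J)"
    by (simp add: span_eq_iff linear_subspace_image[OF linear_commutator])
  with y have "y \<in> range (commutator J)" by (simp only:)
  then obtain S where S: "y = commutator J S" by auto
  have "commutator J z \<bullet> commutator J z = 0"
    using z[of "commutator J (commutator J z)"]
    by (simp add: commutator_skew[OF J] orthogonal_def span_base)
  then show thesis using that[of z S] K S by (simp add: add.commute)
qed

text \<open>After the explicit solution for \<open>K0\<close> is subtracted, the source is D S and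
  the energy is v = <D S, X'> \<ge> 2 \<gamma> |Y'|^2. Moving D to the other side and using the
  first equation gives \<mu> v = - 2 <S, Y'>. Together these bound |Y'| by |S| / (\<gamma> |\<mu>|),
  and then \<open>v\<close> by the right-hand side.\<close>

lemma block_equations_limit:
  assumes J: "skew_symmetric J" and \<gamma>: "\<gamma> > 0" and \<mu>: "\<mu> \<noteq> 0"
    and K: "K = K0 + commutator J S" and K0: "commutator J K0 = 0"
    and e: "block_equations \<gamma> \<mu> J K X Y Z"
  shows "\<bar>K \<bullet> X - (\<gamma> + 1 / \<gamma>) / 2 * (K0 \<bullet> K0)\<bar> \<le> 2 * (norm S)\<^sup>2 / (\<gamma> * \<mu>\<^sup>2)"
proof -
  define a where "a = (\<gamma> + 1 / \<gamma>) / 2"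
  define X' where "X' = X - a *\<^sub>R K0"
  define Y' where "Y' = Y - (1 / 2) *\<^sub>R K0"
  define Z' where "Z' = Z - (1 / (2 * \<gamma>)) *\<^sub>R K0"
  note lin = linear_diff[OF linear_commutator] linear_scale[OF linear_commutator]
  have e': "block_equations \<gamma> \<mu> J (commutator J S) X' Y' Z'"
  proof -
    have e1: "\<mu> *\<^sub>R commutator J X - 2 *\<^sub>R Y = - K0 - commutator J S"
     and e2: "\<mu> *\<^sub>R commutator J Y + X - \<gamma> *\<^sub>R Y - Z = 0"
     and e3: "\<mu> *\<^sub>R commutator J Z + 2 *\<^sub>R Y - (2 * \<gamma>) *\<^sub>R Z = 0"
      using e by (auto simp: block_equations_def K)
    have "\<mu> *\<^sub>R commutator J X' - 2 *\<^sub>R Y' = (\<mu> *\<^sub>R commutator J X - 2 *\<^sub>R Y) + K0"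
      by (simp add: X'_def Y'_def lin K0 algebra_simps)
    moreover have "\<mu> *\<^sub>R commutator J Y' + X' - \<gamma> *\<^sub>R Y' - Z'
      = (\<mu> *\<^sub>R commutator J Y + X - \<gamma> *\<^sub>R Y - Z) + (\<gamma> / 2 + 1 / (2 * \<gamma>) - a) *\<^sub>R K0"
      by (simp add: X'_def Y'_def Z'_def lin K0 algebra_simps)
    moreover have "\<gamma> / 2 + 1 / (2 * \<gamma>) - a = 0" using \<gamma> by (simp add: a_def add_divide_distrib)
    moreover have "\<mu> *\<^sub>R commutator J Z' + 2 *\<^sub>R Y' - (2 * \<gamma>) *\<^sub>R Z'
       = \<mu> *\<^sub>R commutator J Z + 2 *\<^sub>R Y - (2 * \<gamma>) *\<^sub>R Z"
      using \<gamma> by (simp add: Y'_def Z'_def lin K0 algebra_simps)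
    ultimately show ?thesis using e1 e2 e3 by (simp add: block_equations_def)
  qed
  define v where "v = commutator J S \<bullet> X'"
  have v: "v = 2 * \<gamma> * (Y' \<bullet> Y' + Z' \<bullet> Z')"
    using block_equations_energy[OF J e'] by (simp add: v_def)
  then have v0: "v \<ge> 0" and vY: "2 * \<gamma> * (norm Y')\<^sup>2 \<le> v"
    using \<gamma> by (auto simp: power2_norm_eq_inner intro!: mult_nonneg_nonneg add_nonneg_nonneg)
  have DS: "K0 \<bullet> commutator J W = 0" for W
    using commutator_skew[OF J, of K0 W] K0 by simp
  \<comment> \<open>Since \<open>K0\<close> is orthogonal to all commutators, pairing it with the
    first, third and second equation gives zero inner product with \<open>Y'\<close>,
    \<open>Z'\<close> and \<open>X'\<close> in turn.\<close>
  have X0: "K0 \<bullet> X' = 0"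
  proof -
    from e' have "X' = Z' + \<gamma> *\<^sub>R Y' - \<mu> *\<^sub>R commutator J Y'"
      and "2 *\<^sub>R Y' = \<mu> *\<^sub>R commutator J X' + commutator J S"
      and "(2 * \<gamma>) *\<^sub>R Z' = \<mu> *\<^sub>R commutator J Z' + 2 *\<^sub>R Y'"
      by (auto simp: block_equations_def algebra_simps)
    from arg_cong[OF this(1), of "inner K0"] arg_cong[OF this(2), of "inner K0"] arg_cong[OF this(3), of "inner K0"]
    show ?thesis using \<gamma> by (simp add: inner_diff_right inner_add_right DS)
  qed
  have KX: "K \<bullet> X = a * (K0 \<bullet> K0) + v"
  proof -
    have "X = X' + a *\<^sub>R K0" by (simp add: X'_def)
    then have "K \<bullet> X = (K0 + commutator J S) \<bullet> (X' + a *\<^sub>R K0)" by (simp add: K)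
    then show ?thesis
      using X0 DS[of S] by (simp add: inner_add_left inner_add_right v_def inner_commute)
  qed
  have "\<mu> * v = - 2 * (S \<bullet> Y')"
  proof -
    have "\<mu> *\<^sub>R commutator J X' = 2 *\<^sub>R Y' - commutator J S"
      using e' by (simp add: block_equations_def algebra_simps)
    from arg_cong[OF this, of "inner S"] have "\<mu> * (S \<bullet> commutator J X') = 2 * (S \<bullet> Y')"
      by (simp add: inner_diff_right commutator_skew_0[OF J])
    then show ?thesis by (simp add: v_def commutator_skew[OF J])
  qed
  then have "\<bar>\<mu>\<bar> * v = 2 * \<bar>S \<bullet> Y'\<bar>"
    using v0 abs_mult[of \<mu> v] by (simp add: abs_mult)
  also have "\<dots> \<le> 2 * (norm S * norm Y')" using Cauchy_Schwarz_ineq2[of S Y'] by simp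
  finally have mv: "\<bar>\<mu>\<bar> * v \<le> 2 * norm S * norm Y'" by simp
  have Y: "\<gamma> * \<bar>\<mu>\<bar> * norm Y' \<le> norm S"
  proof (cases "Y' = 0")
    case False
    have "\<bar>\<mu>\<bar> * (2 * \<gamma> * (norm Y')\<^sup>2) \<le> 2 * norm S * norm Y'"
      using mult_left_mono[OF vY abs_ge_zero[of \<mu>]] mv by linarith
    then have "(\<gamma> * \<bar>\<mu>\<bar> * norm Y') * norm Y' \<le> norm S * norm Y'" by (simp add: power2_eq_square mult_ac)
    then show ?thesis using False by simp
  qed simp
  have "\<gamma> * \<mu>\<^sup>2 * v = \<gamma> * \<bar>\<mu>\<bar> * (\<bar>\<mu>\<bar> * v)" by (simp add: power2_eq_square abs_mult_self_eq mult.assoc[symmetric] mult.commute[of \<gamma>])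
  also have "\<dots> \<le> \<gamma> * \<bar>\<mu>\<bar> * (2 * norm S * norm Y')" using mv \<gamma> by (intro mult_left_mono) auto
  also have "\<dots> = 2 * norm S * (\<gamma> * \<bar>\<mu>\<bar> * norm Y')" by simp
  also have "\<dots> \<le> 2 * norm S * norm S" using Y by (intro mult_left_mono) auto
  finally have "v * (\<gamma> * \<mu>\<^sup>2) \<le> 2 * (norm S)\<^sup>2" by (simp add: power2_eq_square mult_ac)
  moreover have "\<gamma> * \<mu>\<^sup>2 > 0" using \<gamma> \<mu> by simp
  ultimately have "v \<le> 2 * (norm S)\<^sup>2 / (\<gamma> * \<mu>\<^sup>2)" by (simp only: pos_le_divide_eq)
  then show ?thesis using KX v0 by (simp add: a_def)
qed

text \<open>The commutator terms vanish, and the remaining scalar system is solved from Y upwards.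
  The solution is the same for every \<mu>, in particular at 0.\<close>

lemma block_equations_commuting:
  assumes "commutator J K = 0" and "\<gamma> > 0"
  shows "block_equations \<gamma> \<mu> J K (((\<gamma> + 1 / \<gamma>) / 2) *\<^sub>R K) ((1 / 2) *\<^sub>R K) ((1 / (2 * \<gamma>)) *\<^sub>R K)"
proof -
  have "commutator J (c *\<^sub>R K) = 0" for c
    using assms linear_scale[OF linear_commutator, of J c K] by simp
  moreover have "((\<gamma> + 1 / \<gamma>) / 2) *\<^sub>R K - \<gamma> *\<^sub>R (1 / 2) *\<^sub>R K - (1 / (2 * \<gamma>)) *\<^sub>R K
      = ((\<gamma> + 1 / \<gamma>) / 2 - \<gamma> / 2 - 1 / (2 * \<gamma>)) *\<^sub>R K"
    by (simp only: scaleR_left_diff_distrib scaleR_scaleR) simp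
  moreover have "(\<gamma> + 1 / \<gamma>) / 2 - \<gamma> / 2 - 1 / (2 * \<gamma>) = 0" by (simp add: add_divide_distrib)
  ultimately show ?thesis using assms(2) by (simp add: block_equations_def)
qed

text \<open>The trace is the inner product with the identity. Multiples of the identity attain
  equality, which singles out \<open>K1\<close>.\<close>

lemma trace_square_le:
  fixes K0 :: "real^'n^'n"
  shows "(trace K0)\<^sup>2 \<le> real CARD('n) * (K0 \<bullet> K0)"
proof -
  have "(K0 \<bullet> mat 1)\<^sup>2 \<le> (K0 \<bullet> K0) * ((mat 1 :: real^'n^'n) \<bullet> mat 1)" by (rule Cauchy_Schwarz_ineq)
  then show ?thesis by (simp add: inner_mat_1 trace_I mult.commute)
qed

section \<open>Symmetric traceless matrices as commutators\<close>

lemma isotropic_vector: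
  fixes a b c :: real
  assumes "a > 0" "b < 0"
  obtains x y where "x\<^sup>2 + y\<^sup>2 = 1" "x\<^sup>2 * a + 2 * x * y * c + y\<^sup>2 * b = 0"
proof -
  define D where "D = c\<^sup>2 - a * b"
  have "a * b < 0" using assms by (simp add: mult_less_0_iff)
  then have D: "D > 0" by (simp add: D_def) (smt (verit) zero_le_power2)
  \<comment> \<open>The slope y/x of an isotropic line is a root of b s^2 + 2 c s + a, whose quarter
    discriminant is \<open>D\<close>.\<close>
  define s where "s = (- c - sqrt D) / b"
  have "b * s = - c - sqrt D" using assms by (simp add: s_def)
  then have "(b * s + c)\<^sup>2 = D" using D by simp
  then have "b * (b * s\<^sup>2 + 2 * c * s + a) = 0" by (simp add: D_def power2_eq_square algebra_simps)
  then have "b * s\<^sup>2 + 2 * c * s + a = 0" using assms by (simp only: mult_eq_0_iff) auto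
  then have s: "a + 2 * s * c + s\<^sup>2 * b = 0" by (simp add: algebra_simps)
  define x where "x = 1 / sqrt (1 + s\<^sup>2)"
  have "1 + s\<^sup>2 > 0" by (simp add: add_pos_nonneg)
  then have x2: "x\<^sup>2 * (1 + s\<^sup>2) = 1" by (simp add: x_def power_divide)
  show thesis
  proof (rule that[of x "s * x"])
    show "x\<^sup>2 + (s * x)\<^sup>2 = 1" using x2 by (simp add: power_mult_distrib algebra_simps)
    have "x\<^sup>2 * a + 2 * x * (s * x) * c + (s * x)\<^sup>2 * b = x\<^sup>2 * (a + 2 * s * c + s\<^sup>2 * b)"
      by (simp add: power2_eq_square algebra_simps)
    then show "x\<^sup>2 * a + 2 * x * (s * x) * c + (s * x)\<^sup>2 * b = 0" using s by simp
  qed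
qed

text \<open>Horn's argument: while some diagonal entry is nonzero, rotate in a plane spanned by two frame vectors
  with diagonal entries of opposite sign so that one of them becomes zero.\<close>

lemma zero_diagonal_frame:
  fixes M :: "real^'n^'n"
  assumes M: "transpose M = M" and tr: "trace M = 0"
  obtains e :: "'n \<Rightarrow> real^'n" where "\<And>i j. e i \<bullet> e j = (if i = j then 1 else 0)" "\<And>i. e i \<bullet> (M *v e i) = 0"
proof -
  define m where "m x y = x \<bullet> (M *v y)" for x y :: "real^'n"
  have sym: "m x y = m y x" for x y
    unfolding m_def by (metis M dot_lmul_matrix inner_commute vector_transpose_matrix)
  have lin: "m (x + y) z = m x z + m y z" "m z (x + y) = m z x + m z y" "m (r *\<^sub>R x) z = r * m x z" "m z (r *\<^sub>R x) = r * m z x"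
    for x y z r
    by (simp_all add: m_def inner_add_left inner_add_right matrix_vector_right_distrib matrix_vector_mult_scaleR)
  define good where "good e \<longleftrightarrow> (\<forall>i j. e i \<bullet> e j = (if i = j then 1 else 0)) \<and> (\<Sum>i\<in>UNIV. m (e i) (e i)) = 0"
    for e :: "'n \<Rightarrow> real^'n"
  define cnt where "cnt e = card {i. m (e i) (e i) \<noteq> 0}" for e :: "'n \<Rightarrow> real^'n"
  have "good (\<lambda>i. axis i 1)"
  proof -
    have "m (axis i 1) (axis i 1) = M $ i $ i" for i
      by (simp add: m_def inner_axis' matrix_vector_mult_basis column_def)
    then show ?thesis using tr by (simp add: good_def inner_axis_axis trace_def)
  qed
  \<comment> \<open>A frame with the fewest nonzero diagonal entries replaces an iteration. The
    vanishing trace is part of \<open>good\<close>, so that entries of both signs remain available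
    after a rotation.\<close>
  then obtain e where e: "good e" and min: "\<And>e'. good e' \<Longrightarrow> cnt e \<le> cnt e'"
    using ex_has_least_nat[of good _ cnt] by blast
  have orth: "e i \<bullet> e j = (if i = j then 1 else 0)" for i j using e by (simp add: good_def)
  have "m (e k) (e k) = 0" for k
  proof (rule ccontr)
    assume k: "m (e k) (e k) \<noteq> 0"
    have sum0: "(\<Sum>i\<in>UNIV. m (e i) (e i)) = 0" using e by (simp add: good_def)
    have "\<exists>i. m (e i) (e i) > 0"
    proof (rule ccontr)
      assume "\<not> (\<exists>i. m (e i) (e i) > 0)"
      then have "\<forall>i. 0 \<le> - m (e i) (e i)" by (simp add: not_less)
      moreover have "(\<Sum>i\<in>UNIV. - m (e i) (e i)) = 0" using sum0 by (simp add: sum_negf)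
      ultimately show False using k sum_nonneg_eq_0_iff[of UNIV "\<lambda>i. - m (e i) (e i)"] by auto
    qed
    then obtain i where i: "m (e i) (e i) > 0" by blast
    have "\<exists>j. m (e j) (e j) < 0"
    proof (rule ccontr)
      assume "\<not> (\<exists>j. m (e j) (e j) < 0)"
      then have "\<forall>i. 0 \<le> m (e i) (e i)" by (simp add: not_less)
      then show False using k sum0 sum_nonneg_eq_0_iff[of UNIV "\<lambda>i. m (e i) (e i)"] by auto
    qed
    then obtain j where j: "m (e j) (e j) < 0" by blast
    have ij: "i \<noteq> j" using i j by auto
    obtain x y where xy: "x\<^sup>2 + y\<^sup>2 = 1" "x\<^sup>2 * m (e i) (e i) + 2 * x * y * m (e i) (e j) + y\<^sup>2 * m (e j) (e j) = 0"
      using isotropic_vector[OF i j] by blast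
    define e' where "e' = e(i := x *\<^sub>R e i + y *\<^sub>R e j, j := (- y) *\<^sub>R e i + x *\<^sub>R e j)"
    have e'i: "e' i = x *\<^sub>R e i + y *\<^sub>R e j" and e'j: "e' j = (- y) *\<^sub>R e i + x *\<^sub>R e j"
      and e'k: "\<And>k. k \<noteq> i \<Longrightarrow> k \<noteq> j \<Longrightarrow> e' k = e k" using ij by (auto simp: e'_def)
    have mi: "m (e' i) (e' i) = 0"
      using xy(2) sym[of "e j" "e i"] by (simp add: e'i lin power2_eq_square algebra_simps)
    have mij: "m (e' i) (e' i) + m (e' j) (e' j) = m (e i) (e i) + m (e j) (e j)"
    proof -
      have "m (e' i) (e' i) + m (e' j) (e' j) = (x\<^sup>2 + y\<^sup>2) * (m (e i) (e i) + m (e j) (e j))"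
        unfolding e'i e'j lin by (simp add: power2_eq_square algebra_simps)
      then show ?thesis using xy(1) by simp
    qed
    have "(\<Sum>i\<in>UNIV. m (e' i) (e' i)) = 0"
    proof -
      have "(\<Sum>k\<in>UNIV. m (h k) (h k)) = m (h i) (h i) + m (h j) (h j) + (\<Sum>k\<in>UNIV - {i, j}. m (h k) (h k))" for h
        using ij sum.remove[of UNIV i "\<lambda>k. m (h k) (h k)"] sum.remove[of "UNIV - {i}" j "\<lambda>k. m (h k) (h k)"]
        by (simp add: insert_commute Diff_insert2[symmetric] del: Diff_insert0)
      moreover have "(\<Sum>k\<in>UNIV - {i, j}. m (e' k) (e' k)) = (\<Sum>k\<in>UNIV - {i, j}. m (e k) (e k))"
        by (intro sum.cong) (auto simp: e'k)
      ultimately show ?thesis using mij sum0 by simp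
    qed
    moreover have "e' k \<bullet> e' l = (if k = l then 1 else 0)" for k l
    proof -
      have "x * x + y * y = 1" using xy(1) by (simp add: power2_eq_square)
      moreover from this have "y * y + x * x = 1" by simp
      ultimately show ?thesis
        using ij by (auto simp: e'_def inner_add_left inner_add_right inner_diff_left inner_diff_right orth)
    qed
    ultimately have "good e'" by (simp add: good_def)
    \<comment> \<open>The entry at \<open>i\<close> becomes zero, and the only other entry that
      changes, at \<open>j\<close>, was already counted.\<close>
    moreover have "cnt e' < cnt e"
      unfolding cnt_def
    proof (rule psubset_card_mono)
      have "{k. m (e' k) (e' k) \<noteq> 0} \<subseteq> {k. m (e k) (e k) \<noteq> 0}"
      proof
        fix k
        assume "k \<in> {k. m (e' k) (e' k) \<noteq> 0}"
        then show "k \<in> {k. m (e k) (e k) \<noteq> 0}"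
          using mi j e'k[of k] by (cases "k = i"; cases "k = j") auto
      qed
      moreover have "i \<notin> {k. m (e' k) (e' k) \<noteq> 0}" "i \<in> {k. m (e k) (e k) \<noteq> 0}" using mi i by auto
      ultimately show "{k. m (e' k) (e' k) \<noteq> 0} \<subset> {k. m (e k) (e k) \<noteq> 0}" by blast
    qed simp
    ultimately show False using min[of e'] by simp
  qed
  then show thesis using orth by (intro that[of e]) (auto simp: m_def)
qed

text \<open>In a frame where the diagonal of M vanishes, the commutator of J' with a diagonal matrix
  of distinct entries s has entries J'(i, j) (s j - s i), so J' is found by division. A symmetric
  numerator over an antisymmetric denominator makes it antisymmetric.\<close>

lemma traceless_commutator:
  fixes M :: "real^'n^'n"
  assumes M: "transpose M = M" and tr: "trace M = 0"
  obtains J S where "skew_symmetric J" "M = commutator J S"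
proof -
  obtain e :: "'n \<Rightarrow> real^'n" where e: "\<And>i j. e i \<bullet> e j = (if i = j then 1 else 0)" "\<And>i. e i \<bullet> (M *v e i) = 0"
    using zero_diagonal_frame[OF M tr] by blast
  obtain idx :: "'n \<Rightarrow> nat" where idx: "inj idx"
    using finite_imp_inj_to_nat_seg[of "UNIV :: 'n set"] by auto
  define s where "s i = real (idx i)" for i
  \<comment> \<open>Any injective choice of reals would serve as diagonal; here the indices are
    numbered.\<close>
  have s: "s i = s j \<longleftrightarrow> i = j" for i j using idx by (simp add: s_def inj_eq)
  define P :: "real^'n^'n" where "P = (\<chi> r k. e k $ r)"
  have PP: "transpose P ** P = mat 1"
    using e(1) by (simp add: vec_eq_iff matrix_matrix_mult_def transpose_def P_def mat_def inner_vec_def)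
  then have PP': "P ** transpose P = mat 1" by (simp add: matrix_left_right_inverse)
  define M' where "M' = transpose P ** M ** P"
  have M'_entry: "M' $ i $ j = e i \<bullet> (M *v e j)" for i j
    by (simp add: M'_def matrix_matrix_mult_def transpose_def P_def inner_vec_def matrix_vector_mult_def
        sum_distrib_right sum_distrib_left mult_ac matrix_mul_assoc[symmetric], rule sum.swap)
  have M'_sym: "M' $ i $ j = M' $ j $ i" for i j
  proof -
    have "transpose M' = M'" by (simp add: M'_def matrix_transpose_mul M matrix_mul_assoc)
    then show ?thesis by (metis (no_types, lifting) transpose_def vec_lambda_beta)
  qed
  \<comment> \<open>On the diagonal this is a division by zero and gives 0, as antisymmetry demands;
    the zero diagonal of \<open>M'\<close> makes that consistent.\<close>
  define J' :: "real^'n^'n" where "J' = (\<chi> i j. M' $ i $ j / (s j - s i))"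
  define D :: "real^'n^'n" where "D = (\<chi> i j. if i = j then s i else 0)"
  have "transpose J' = - J'"
    using M'_sym by (auto simp: J'_def transpose_def vec_eq_iff) (metis minus_diff_eq minus_divide_right)
  then have "skew_symmetric (P ** J' ** transpose P)"
    by (simp add: skew_symmetric_def matrix_transpose_mul matrix_mul_assoc matrix_minus_left matrix_minus_right)
  moreover have "M = commutator (P ** J' ** transpose P) (P ** D ** transpose P)"
  proof -
    have "M' = J' ** D - D ** J'"
    proof -
      have "(J' ** D - D ** J') $ i $ j = J' $ i $ j * s j - s i * J' $ i $ j" for i j
        by (simp add: matrix_matrix_mult_def D_def if_distrib if_distribR cong: if_cong)
      moreover have "J' $ i $ j * s j - s i * J' $ i $ j = M' $ i $ j" for i j
      proof (cases "i = j")
        case True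
        then show ?thesis using e(2) by (simp add: J'_def M'_entry)
      next
        case False
        then have "s j - s i \<noteq> 0" using s by auto
        then have "J' $ i $ j * (s j - s i) = M' $ i $ j" by (simp add: J'_def)
        then show ?thesis by (simp add: algebra_simps)
      qed
      ultimately show ?thesis by (simp add: vec_eq_iff)
    qed
    moreover have "P ** (J' ** D) ** transpose P = (P ** J' ** transpose P) ** (P ** D ** transpose P)"
      "P ** (D ** J') ** transpose P = (P ** D ** transpose P) ** (P ** J' ** transpose P)"
      by (metis (no_types, lifting) PP matrix_mul_assoc matrix_mul_rid)+
    moreover have "M = P ** M' ** transpose P"
      unfolding M'_def by (metis (no_types, lifting) PP' matrix_mul_assoc matrix_mul_lid matrix_mul_rid)
    ultimately show ?thesis
      by (simp add: commutator_def matrix_diff_left matrix_diff_right)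
  qed
  ultimately show thesis by (rule that)
qed

section \<open>The asymptotic variance of quadratic observables\<close>

definition hamiltonian :: "real \<Rightarrow> real^'n^'n \<Rightarrow> (real^'n) \<times> (real^'n) \<Rightarrow> (real^'n) \<times> (real^'n)" where
  "hamiltonian \<mu> J z = (snd z - \<mu> *\<^sub>R (J *v fst z), - fst z - \<mu> *\<^sub>R (J *v snd z))"

lemma matrix_vector_mult_neg: "A *v (- x) = - ((A :: real^'n^'n) *v x)"
  by (simp add: vec_eq_iff matrix_vector_mult_def sum_negf)

lemma skew_symmetric_inner:
  assumes "skew_symmetric J"
  shows "(J *v x) \<bullet> y = - (x \<bullet> (J *v y))"
proof -
  have "(J *v x) \<bullet> y = x \<bullet> (transpose J *v y)"
    by (metis dot_lmul_matrix inner_commute vector_transpose_matrix)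
  also have "transpose J *v y = - (J *v y)"
    using assms by (simp add: skew_symmetric_def vec_eq_iff matrix_vector_mult_def sum_negf)
  finally show ?thesis by simp
qed

lemma skew_linear_hamiltonian:
  fixes J :: "real^'n^'n"
  assumes "skew_symmetric J"
  shows "skew_linear (hamiltonian \<mu> J)"
proof (rule skew_linear.intro)
  show "linear (hamiltonian \<mu> J)"
    unfolding linear_iff
    by (simp add: hamiltonian_def matrix_vector_right_distrib matrix_vector_mult_scaleR algebra_simps)
  fix z :: "(real^'n) \<times> (real^'n)"
  have "x \<bullet> (J *v x) = 0" for x
    using skew_symmetric_inner[OF assms, of x x] by (simp add: inner_commute)
  then show "z \<bullet> hamiltonian \<mu> J z = 0"
    by (simp add: hamiltonian_def inner_prod_def inner_diff_right inner_commute)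
qed

lemma has_integral_Pair:
  fixes f :: "real \<Rightarrow> 'a::euclidean_space" and g :: "real \<Rightarrow> 'b::euclidean_space"
  assumes "(f has_integral a) S" "(g has_integral b) S"
  shows "((\<lambda>x. (f x, g x)) has_integral (a, b)) S"
proof -
  have "bounded_linear (\<lambda>x::'a. (x, 0::'b))" "bounded_linear (\<lambda>x::'b. (0::'a, x))"
    by (auto intro!: bounded_linear_Pair bounded_linear_ident bounded_linear_zero)
  from has_integral_add[OF has_integral_linear[OF assms(1) this(1)] has_integral_linear[OF assms(2) this(2)]]
  show ?thesis by (simp add: o_def)
qed

lemma langevin_solution_path:
  assumes "langevin_solution M W \<gamma> \<mu> J z x"
  shows "AE \<omega> in M. path_solution \<gamma> (hamiltonian \<mu> J) (\<lambda>t. W t \<omega>) z (\<lambda>t. x t \<omega>)"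
proof -
  have "AE \<omega> in M. continuous_on {0..} (\<lambda>t. x t \<omega>) \<and>
        (\<forall>t\<ge>0.
           ((\<lambda>s. snd (x s \<omega>) - \<mu> *\<^sub>R (J *v fst (x s \<omega>))) has_integral (fst (x t \<omega>) - fst z)) {0..t} \<and>
           ((\<lambda>s. - fst (x s \<omega>) - \<mu> *\<^sub>R (J *v snd (x s \<omega>)) - \<gamma> *\<^sub>R snd (x s \<omega>))
              has_integral (snd (x t \<omega>) - snd z - sqrt (2 * \<gamma>) *\<^sub>R W t \<omega>)) {0..t})"
    using assms by (simp add: langevin_solution_def)
  then show ?thesis
  proof eventually_elim
    case (elim \<omega>)
    have "((\<lambda>s. drift \<gamma> (hamiltonian \<mu> J) (x s \<omega>)) has_integral (x t \<omega> - z - noise \<gamma> (W t \<omega>))) {0..t}" if "t \<ge> 0" for t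
    proof -
      have "((\<lambda>s. (snd (x s \<omega>) - \<mu> *\<^sub>R (J *v fst (x s \<omega>)),
           - fst (x s \<omega>) - \<mu> *\<^sub>R (J *v snd (x s \<omega>)) - \<gamma> *\<^sub>R snd (x s \<omega>))) has_integral
         (fst (x t \<omega>) - fst z, snd (x t \<omega>) - snd z - sqrt (2 * \<gamma>) *\<^sub>R W t \<omega>)) {0..t}"
        using elim that by (intro has_integral_Pair) auto
      moreover have "drift \<gamma> (hamiltonian \<mu> J) y = (snd y - \<mu> *\<^sub>R (J *v fst y),
           - fst y - \<mu> *\<^sub>R (J *v snd y) - \<gamma> *\<^sub>R snd y)" for y
        by (simp add: drift_def hamiltonian_def)
      moreover have "x t \<omega> - z - noise \<gamma> (W t \<omega>) = (fst (x t \<omega>) - fst z, snd (x t \<omega>) - snd z - sqrt (2 * \<gamma>) *\<^sub>R W t \<omega>)"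
        by (simp add: noise_def prod_eq_iff)
      ultimately show ?thesis by simp
    qed
    then show ?case using elim by (simp add: path_solution_def)
  qed
qed

text \<open>Conjugation by this map turns \<open>hamiltonian (- \<mu>) J\<close> into the negative
  of \<open>hamiltonian \<mu> J\<close> and leaves friction and noise as they are, so the dual
  process has the same Brownian motion. Flipping the momenta instead would replace it by its
  negative.\<close>

definition position_flip :: "(real^'n) \<times> (real^'n) \<Rightarrow> (real^'n) \<times> (real^'n)" where
  "position_flip z = (- fst z, snd z)"

lemma path_solution_flip:
  assumes "path_solution \<gamma> (hamiltonian (- \<mu>) J) w (position_flip z) x"
  shows "path_solution \<gamma> (\<lambda>y. - hamiltonian \<mu> J y) w z (\<lambda>t. position_flip (x t))"
proof -
  have bl: "bounded_linear (position_flip :: (real^'n) \<times> (real^'n) \<Rightarrow> _)"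
    unfolding position_flip_def[abs_def]
    by (intro bounded_linear_Pair bounded_linear_minus bounded_linear_fst bounded_linear_snd)
  have d: "position_flip (drift \<gamma> (hamiltonian (- \<mu>) J) y) = drift \<gamma> (\<lambda>y. - hamiltonian \<mu> J y) (position_flip y)" for y
    by (simp add: position_flip_def drift_def hamiltonian_def prod_eq_iff matrix_vector_mult_neg)
  have e: "position_flip (a - position_flip z - noise \<gamma> b) = position_flip a - z - noise \<gamma> b" for a b
    by (simp add: position_flip_def noise_def prod_eq_iff)
  show ?thesis
    unfolding path_solution_def
  proof (intro conjI allI impI)
    show "continuous_on {0..} (\<lambda>t. position_flip (x t))"
      using assms by (intro bounded_linear.continuous_on[OF bl]) (simp add: path_solution_def)
    fix t :: real assume "t \<ge> 0"
    then have "((\<lambda>s. drift \<gamma> (hamiltonian (- \<mu>) J) (x s)) has_integral (x t - position_flip z - noise \<gamma> (w t))) {0..t}"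
      using assms by (simp add: path_solution_def)
    from has_integral_linear[OF this bl]
    show "((\<lambda>s. drift \<gamma> (\<lambda>y. - hamiltonian \<mu> J y) (position_flip (x s))) has_integral
       (position_flip (x t) - z - noise \<gamma> (w t))) {0..t}"
      by (simp add: o_def d e)
  qed
qed

text \<open>The dual process at \<mu> is obtained from the given process at -\<mu>, which is why
  solutions for all real parameters are supplied.\<close>

lemma langevin_dual_pair_hamiltonian:
  fixes J :: "real^'n^'n" and X :: "real \<Rightarrow> (real^'n) \<times> (real^'n) \<Rightarrow> real \<Rightarrow> 'w \<Rightarrow> (real^'n) \<times> (real^'n)"
  assumes bm: "brownian_motion M W" and \<gamma>: "\<gamma> > 0" and J: "skew_symmetric J"
    and X: "\<And>\<mu> z. langevin_solution M W \<gamma> \<mu> J z (X \<mu> z)"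
  shows "langevin_dual_pair (hamiltonian \<mu> J) \<gamma> M W (X \<mu>) (\<lambda>z t \<omega>. position_flip (X (- \<mu>) (position_flip z) t \<omega>))"
proof -
  interpret langevin_drift "hamiltonian \<mu> J" \<gamma>
    using skew_linear_hamiltonian[OF J] \<gamma> by (simp add: langevin_drift_def langevin_drift_axioms_def)
  interpret dual: langevin_drift "\<lambda>z. - hamiltonian \<mu> J z" \<gamma> by (rule langevin_drift_neg)
  have m: "X \<nu> z t \<in> borel_measurable M" if "t \<ge> 0" for \<nu> z t
    using X[of \<nu> z] that by (simp add: langevin_solution_def)
  have fm: "(position_flip :: (real^'n) \<times> (real^'n) \<Rightarrow> _) \<in> borel_measurable borel"
    by (intro linear_borel_measurable linearI) (auto simp: position_flip_def)
  show ?thesis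
  proof (intro langevin_dual_pair.intro)
    show "langevin_process (hamiltonian \<mu> J) \<gamma> M W (X \<mu>)"
      by unfold_locales (use bm m langevin_solution_path[OF X] in auto)
    show "langevin_process (\<lambda>z. - hamiltonian \<mu> J z) \<gamma> M W (\<lambda>z t \<omega>. position_flip (X (- \<mu>) (position_flip z) t \<omega>))"
    proof
      show "brownian_motion M W" by fact
      show "(\<lambda>\<omega>. position_flip (X (- \<mu>) (position_flip z) t \<omega>)) \<in> borel_measurable M" if "t \<ge> 0" for t z
        using measurable_compose[OF m[OF that] fm] .
      show "AE \<omega> in M. path_solution \<gamma> (\<lambda>z. - hamiltonian \<mu> J z) (\<lambda>t. W t \<omega>) z
          (\<lambda>t. position_flip (X (- \<mu>) (position_flip z) t \<omega>))" for z
        using langevin_solution_path[OF X[of "- \<mu>" "position_flip z"]]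
        by eventually_elim (rule path_solution_flip)
    qed
  qed
qed

text \<open>The value -1 of \<open>\<epsilon>\<close> belongs to the adjoint problem: flipping
  positions reverses the sign of the mixed terms only. One system of block equations, with
  \<epsilon> \<mu> as parameter, then serves both problems.\<close>

definition block_form ::
  "real \<Rightarrow> real^'n^'n \<Rightarrow> real^'n^'n \<Rightarrow> real^'n^'n \<Rightarrow> (real^'n) \<times> (real^'n) \<Rightarrow> (real^'n) \<times> (real^'n) \<Rightarrow> real" where
  "block_form \<epsilon> X Y Z u v = fst u \<bullet> (X *v fst v) + \<epsilon> * (fst u \<bullet> (Y *v snd v) + snd u \<bullet> (Y *v fst v)) + snd u \<bullet> (Z *v snd v)"

lemma bilinear_block_form: "bilinear (block_form \<epsilon> X Y Z)"
  unfolding bilinear_def linear_iff block_form_def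
  by (simp add: inner_add_left inner_add_right matrix_vector_right_distrib matrix_vector_mult_scaleR algebra_simps)

lemma matrix_inner_linear:
  fixes A B :: "real^'n^'n"
  shows "x \<bullet> ((A + B) *v y) = x \<bullet> (A *v y) + x \<bullet> (B *v y)" "x \<bullet> ((A - B) *v y) = x \<bullet> (A *v y) - x \<bullet> (B *v y)"
    "x \<bullet> ((- A) *v y) = - (x \<bullet> (A *v y))" "x \<bullet> ((c *\<^sub>R A) *v y) = c * (x \<bullet> (A *v y))" "x \<bullet> ((0 :: real^'n^'n) *v y) = 0"
  by (simp_all add: inner_vec_def matrix_vector_mult_def sum.distrib sum_subtractf sum_negf algebra_simps
      sum_distrib_left)

lemma commutator_inner: "x \<bullet> (commutator A B *v y) = x \<bullet> (A *v (B *v y)) - x \<bullet> (B *v (A *v y))"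
  by (simp add: commutator_def matrix_inner_linear matrix_vector_mul_assoc)

lemma generator_block_form:
  assumes J: "skew_symmetric J" and \<epsilon>: "\<epsilon> = 1 \<or> \<epsilon> = - 1" and e: "block_equations \<gamma> (\<epsilon> * \<mu>) J K X Y Z"
  shows "generator_form \<gamma> (\<lambda>z. \<epsilon> *\<^sub>R hamiltonian \<mu> J z) (block_form \<epsilon> X Y Z) z z = - (fst z \<bullet> (K *v fst z))"
proof -
  obtain q p where z: "z = (q, p)" by (cases z)
  have e1: "(\<epsilon> * \<mu>) *\<^sub>R commutator J X - 2 *\<^sub>R Y = - K"
    and e2: "(\<epsilon> * \<mu>) *\<^sub>R commutator J Y + X - \<gamma> *\<^sub>R Y - Z = 0"
    and e3: "(\<epsilon> * \<mu>) *\<^sub>R commutator J Z + 2 *\<^sub>R Y - (2 * \<gamma>) *\<^sub>R Z = 0"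
    using e by (auto simp: block_equations_def)
  \<comment> \<open>These compare the coefficients of the two pure and the two mixed terms. The
    blocks need not be symmetric, so the mixed equation is evaluated in both orders.\<close>
  note E1 = arg_cong[OF e1, of "\<lambda>A. q \<bullet> (A *v q)", unfolded matrix_inner_linear commutator_inner]
   and E2 = arg_cong[OF e2, of "\<lambda>A. p \<bullet> (A *v q)", unfolded matrix_inner_linear commutator_inner]
   and E3 = arg_cong[OF e2, of "\<lambda>A. q \<bullet> (A *v p)", unfolded matrix_inner_linear commutator_inner]
   and E4 = arg_cong[OF e3, of "\<lambda>A. p \<bullet> (A *v p)", unfolded matrix_inner_linear commutator_inner]
  show ?thesis
    using \<epsilon> E1 E2 E3 E4
    unfolding generator_form_def block_form_def drift_def hamiltonian_def z
    by (elim disjE; simp add: skew_symmetric_inner[OF J] inner_add_left inner_add_right inner_diff_left inner_diff_right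
        matrix_vector_right_distrib matrix_vector_mult_diff_distrib matrix_vector_mult_scaleR matrix_vector_mult_neg
        algebra_simps)
qed

section \<open>Traces over phase space and pairing with the observable\<close>

lemma sum_Basis_vec: "(\<Sum>b\<in>(Basis :: (real^'n) set). h b) = (\<Sum>i\<in>UNIV. h (axis i 1))"
proof -
  have B: "(Basis :: (real^'n) set) = range (\<lambda>i::'n. axis i 1)" by (auto simp: Basis_vec_def)
  have i: "inj (\<lambda>i::'n. axis i (1::real))" by (auto simp: inj_on_def axis_eq_axis)
  show ?thesis unfolding B sum.reindex[OF i] by simp
qed

lemma sum_Basis_phase_space:
  "(\<Sum>b\<in>(Basis :: ((real^'n) \<times> (real^'n)) set). h b) = (\<Sum>i\<in>UNIV. h (axis i 1, 0)) + (\<Sum>i\<in>UNIV. h (0, axis i 1))"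
proof -
  have "(\<Sum>b\<in>(Basis :: ((real^'n) \<times> (real^'n)) set). h b)
    = (\<Sum>b\<in>(\<lambda>u. (u, 0)) ` (Basis :: (real^'n) set). h b) + (\<Sum>b\<in>(\<lambda>v. (0, v)) ` (Basis :: (real^'n) set). h b)"
    unfolding Basis_prod_def by (rule sum.union_disjoint) auto
  also have "\<dots> = (\<Sum>b\<in>(Basis :: (real^'n) set). h (b, 0)) + (\<Sum>b\<in>(Basis :: (real^'n) set). h (0, b))"
    by (subst sum.reindex, simp add: inj_on_def)+ simp
  finally show ?thesis by (simp add: sum_Basis_vec)
qed

lemma axis_inner_matrix: "axis i 1 \<bullet> ((K :: real^'n^'n) *v axis j 1) = K $ i $ j"
  by (simp add: inner_axis' matrix_vector_mult_basis column_def)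

lemma quad_form_position:
  fixes K :: "real^'n^'n" and B :: "(real^'n) \<times> (real^'n) \<Rightarrow> (real^'n) \<times> (real^'n) \<Rightarrow> real"
  assumes "\<And>z. B z z = c * (fst z \<bullet> (K *v fst z))"
  shows "quad_form B z = c * (fst z \<bullet> (K *v fst z) - trace K)"
proof -
  have "(\<Sum>b\<in>(Basis :: ((real^'n) \<times> (real^'n)) set). fst b \<bullet> (K *v fst b)) = trace K"
    by (simp add: sum_Basis_phase_space axis_inner_matrix trace_def)
  then show ?thesis by (simp add: quad_form_def assms right_diff_distrib flip: sum_distrib_left)
qed

text \<open>The observable has no momentum part, so the fourth moment formula sees only the position
  block, and the symmetry of \<open>K\<close> discards the antisymmetric part of
  \<open>X\<close>.\<close>

lemma block_form_inner_product:
  fixes K :: "real^'n^'n"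
  assumes K: "transpose K = K"
  shows "(\<integral>z. quad_form (block_form \<epsilon> X Y Z) z * (fst z \<bullet> (K *v fst z) - trace K) \<partial>gaussian 1) = 2 * (K \<bullet> X)"
proof -
  define D where "D u v = fst u \<bullet> (K *v fst v)" for u v :: "(real^'n) \<times> (real^'n)"
  have D: "bilinear D"
    unfolding bilinear_def linear_iff D_def
    by (simp add: inner_add_left inner_add_right matrix_vector_right_distrib matrix_vector_mult_scaleR)
  have Ks: "K $ j $ i = K $ i $ j" for i j
    by (metis (no_types, lifting) K transpose_def vec_lambda_beta)
  have "(\<integral>z. quad_form (block_form \<epsilon> X Y Z) z * (fst z \<bullet> (K *v fst z) - trace K) \<partial>gaussian 1)
     = (\<integral>z. quad_form (block_form \<epsilon> X Y Z) z * quad_form D z \<partial>gaussian 1)"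
    using quad_form_position[of D 1 K] by (simp add: D_def)
  also have "\<dots> = (\<Sum>a\<in>Basis. \<Sum>b\<in>Basis. (block_form \<epsilon> X Y Z a b + block_form \<epsilon> X Y Z b a) * (D a b + D b a)) / 2"
    by (rule integral_quad_form_mult[OF bilinear_block_form D])
  also have "\<dots> = (\<Sum>i\<in>UNIV. \<Sum>j\<in>UNIV. (X $ i $ j + X $ j $ i) * (K $ i $ j + K $ j $ i)) / 2"
    unfolding sum_Basis_phase_space by (simp add: D_def block_form_def axis_inner_matrix)
  also have "\<dots> = (\<Sum>i\<in>UNIV. \<Sum>j\<in>UNIV. X $ i $ j * K $ i $ j) + (\<Sum>i\<in>UNIV. \<Sum>j\<in>UNIV. X $ j $ i * K $ i $ j)"
    by (simp add: Ks[of _ _] algebra_simps sum.distrib sum_distrib_left flip: mult_2)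
  also have "(\<Sum>i\<in>UNIV. \<Sum>j\<in>UNIV. X $ j $ i * K $ i $ j) = (\<Sum>i\<in>UNIV. \<Sum>j\<in>UNIV. X $ i $ j * K $ i $ j)"
    by (subst sum.swap) (simp add: Ks)
  finally show ?thesis by (simp add: inner_vec_def mult.commute)
qed

text \<open>The parameter is -\<mu> because the value is computed from the adjoint equation. The
  system at \<mu> enters through its solvability, which provides a solution for the choice
  operator.\<close>

lemma asymptotic_variance_block:
  fixes J :: "real^'n^'n" and X :: "real \<Rightarrow> (real^'n) \<times> (real^'n) \<Rightarrow> real \<Rightarrow> 'w \<Rightarrow> (real^'n) \<times> (real^'n)"
  assumes bm: "brownian_motion M W" and \<gamma>: "\<gamma> > 0" and J: "skew_symmetric J"
    and X: "\<And>\<mu> z. langevin_solution M W \<gamma> \<mu> J z (X \<mu> z)"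
    and K: "transpose K = K" and f: "\<And>q. f q = q \<bullet> (K *v q) - trace K"
    and e: "block_equations \<gamma> (- \<mu>) J K A B C"
  shows "asymptotic_variance M (X \<mu>) f = 2 * (K \<bullet> A)"
proof -
  interpret langevin_dual_pair "hamiltonian \<mu> J" \<gamma> M W "X \<mu>" "\<lambda>z t \<omega>. position_flip (X (- \<mu>) (position_flip z) t \<omega>)"
    by (rule langevin_dual_pair_hamiltonian) fact+
  obtain A' B' C' where e': "block_equations \<gamma> \<mu> J K A' B' C'"
    using block_equations_exist[OF J \<gamma>] by blast
  have 1: "quad_form (generator_form \<gamma> (hamiltonian \<mu> J) (block_form 1 A' B' C')) z = - f (fst z)" for z
    using quad_form_position[of "generator_form \<gamma> (hamiltonian \<mu> J) (block_form 1 A' B' C')" "- 1" K z]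
      generator_block_form[OF J, of 1 \<gamma> \<mu> K A' B' C'] e' by (simp add: f)
  have 2: "quad_form (generator_form \<gamma> (\<lambda>z. - hamiltonian \<mu> J z) (block_form (- 1) A B C)) z = - f (fst z)" for z
    using quad_form_position[of "generator_form \<gamma> (\<lambda>z. - hamiltonian \<mu> J z) (block_form (- 1) A B C)" "- 1" K z]
      generator_block_form[OF J, of "- 1" \<gamma> \<mu> K A B C] e by (simp add: f)
  have "asymptotic_variance M (X \<mu>) f = (\<integral>z. quad_form (block_form (- 1) A B C) z * f (fst z) \<partial>gaussian 1)"
    unfolding asymptotic_variance_def Let_def
    by (rule asymptotic_variance_eq[OF bilinear_block_form 1 bilinear_block_form 2])
  also have "\<dots> = 2 * (K \<bullet> A)"
    unfolding f by (rule block_form_inner_product[OF K])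
  finally show ?thesis .
qed

theorem corollary3:
  fixes M :: "'w measure"
    and W :: "real \<Rightarrow> 'w \<Rightarrow> real^'n"
    and \<gamma> :: real
    and X :: "real \<Rightarrow> real^'n^'n \<Rightarrow> (real^'n) \<times> (real^'n) \<Rightarrow> real \<Rightarrow> 'w \<Rightarrow> (real^'n) \<times> (real^'n)"
    and K K1 J0 :: "real^'n^'n"
    and f f1 :: "real^'n \<Rightarrow> real"
  assumes "brownian_motion M W"
    and "\<gamma> > 0"
    and "\<And>\<mu> J z. skew_symmetric J \<Longrightarrow> langevin_solution M W \<gamma> \<mu> J z (X \<mu> J z)"
    and "transpose K = K"
    and "K1 = (trace K / real CARD('n)) *\<^sub>R mat 1"
    and "\<And>q. f q = q \<bullet> (K *v q) - trace K"
    and "\<And>q. f1 q = q \<bullet> (K1 *v q) - trace K"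
    and "skew_symmetric J0"
  shows "\<exists>V :: real^'n^'n \<Rightarrow> real.
           (\<forall>J. skew_symmetric J \<longrightarrow>
              ((\<lambda>\<mu>. asymptotic_variance M (X \<mu> J) f) \<longlongrightarrow> V J) at_top) \<and>
           (\<exists>J. skew_symmetric J \<and> V J = asymptotic_variance M (X 0 J0) f1) \<and>
           (\<forall>J. skew_symmetric J \<longrightarrow> asymptotic_variance M (X 0 J0) f1 \<le> V J)"
proof -
  define a where "a = \<gamma> + 1 / \<gamma>"
  have a: "a > 0" using assms(2) by (simp add: a_def add_pos_pos)
  \<comment> \<open>The bound of \<open>block_equations_limit\<close> is doubled, since the variance
    is twice \<open>K \<bullet> A\<close>. It depends on \<mu> only through its square, so the sign
    change of the adjoint equation is harmless.\<close>
  have lim: "((\<lambda>\<mu>. asymptotic_variance M (X \<mu> J) f) \<longlongrightarrow> a * (K0 \<bullet> K0)) at_top"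
    if J: "skew_symmetric J" and K: "K = K0 + commutator J S" and K0: "commutator J K0 = 0" for J K0 S
  proof (rule tendsto_sandwich[of "\<lambda>\<mu>. a * (K0 \<bullet> K0) - 4 * (norm S)\<^sup>2 / (\<gamma> * \<mu>\<^sup>2)" _ _ "\<lambda>\<mu>. a * (K0 \<bullet> K0) + 4 * (norm S)\<^sup>2 / (\<gamma> * \<mu>\<^sup>2)"])
    have b: "\<bar>asymptotic_variance M (X \<mu> J) f - a * (K0 \<bullet> K0)\<bar> \<le> 4 * (norm S)\<^sup>2 / (\<gamma> * \<mu>\<^sup>2)" if "\<mu> > 0" for \<mu>
    proof -
      obtain A B C where e: "block_equations \<gamma> (- \<mu>) J K A B C"
        using block_equations_exist[OF J assms(2)] by blast
      have "\<bar>K \<bullet> A - a / 2 * (K0 \<bullet> K0)\<bar> \<le> 2 * (norm S)\<^sup>2 / (\<gamma> * \<mu>\<^sup>2)"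
        using block_equations_limit[OF J assms(2) _ K K0 e] that by (simp add: a_def)
      moreover have "asymptotic_variance M (X \<mu> J) f = 2 * (K \<bullet> A)"
        by (rule asymptotic_variance_block[where X="\<lambda>\<mu>. X \<mu> J", OF assms(1,2) J assms(3)[OF J] assms(4,6) e])
      ultimately show ?thesis by (simp add: abs_le_iff)
    qed
    have ev: "eventually (\<lambda>\<mu>::real. \<mu> > 0) at_top" by (rule eventually_gt_at_top)
    show "eventually (\<lambda>\<mu>. a * (K0 \<bullet> K0) - 4 * (norm S)\<^sup>2 / (\<gamma> * \<mu>\<^sup>2) \<le> asymptotic_variance M (X \<mu> J) f) at_top"
      using ev by eventually_elim (use b in \<open>fastforce simp: abs_le_iff\<close>)
    show "eventually (\<lambda>\<mu>. asymptotic_variance M (X \<mu> J) f \<le> a * (K0 \<bullet> K0) + 4 * (norm S)\<^sup>2 / (\<gamma> * \<mu>\<^sup>2)) at_top"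
      using ev by eventually_elim (use b in \<open>fastforce simp: abs_le_iff\<close>)
    have "((\<lambda>\<mu>. 4 * (norm S)\<^sup>2 / (\<gamma> * \<mu>\<^sup>2)) \<longlongrightarrow> 0) at_top"
    proof (rule tendsto_divide_0[OF tendsto_const])
      show "LIM \<mu> at_top. \<gamma> * \<mu>\<^sup>2 :> at_infinity"
        using assms(2)
        by (intro filterlim_at_top_imp_at_infinity filterlim_tendsto_pos_mult_at_top[OF tendsto_const]
            filterlim_pow_at_top filterlim_ident) auto
    qed
    from tendsto_diff[OF tendsto_const this] tendsto_add[OF tendsto_const this]
    show "((\<lambda>\<mu>. a * (K0 \<bullet> K0) - 4 * (norm S)\<^sup>2 / (\<gamma> * \<mu>\<^sup>2)) \<longlongrightarrow> a * (K0 \<bullet> K0)) at_top"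
      and "((\<lambda>\<mu>. a * (K0 \<bullet> K0) + 4 * (norm S)\<^sup>2 / (\<gamma> * \<mu>\<^sup>2)) \<longlongrightarrow> a * (K0 \<bullet> K0)) at_top"
      by simp_all
  qed
  define V where "V J = Lim at_top (\<lambda>\<mu>. asymptotic_variance M (X \<mu> J) f)" for J
  have V: "V J = a * (K0 \<bullet> K0)" if "skew_symmetric J" "K = K0 + commutator J S" "commutator J K0 = 0" for J K0 S
    unfolding V_def by (rule tendsto_Lim[OF _ lim[OF that]]) simp
  \<comment> \<open>Multiples of the identity commute with every \<open>J\<close>, so
    \<open>K1\<close> is its own kernel part and the value at 0 does not depend on
    \<open>J0\<close>.\<close>
  have K1c: "commutator J K1 = 0" for J
    by (simp add: assms(5) commutator_def linear_scale[OF linear_commutator, unfolded commutator_def])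
  have K1t: "transpose K1 = K1" and K1tr: "trace K1 = trace K"
    by (simp_all add: assms(5) transpose_scalar[symmetric] transpose_mat trace_def vec_eq_iff transpose_def mat_def)
  have K1K1: "K1 \<bullet> K1 = (trace K)\<^sup>2 / real CARD('n)"
  proof -
    have "K1 \<bullet> K1 = (trace K / real CARD('n)) * (K1 \<bullet> mat 1)" by (subst (2) assms(5)) simp
    then show ?thesis by (simp add: inner_mat_1 K1tr power2_eq_square)
  qed
  have v1: "asymptotic_variance M (X 0 J0) f1 = a * (K1 \<bullet> K1)"
  proof -
    have "asymptotic_variance M (X 0 J0) f1 = 2 * (K1 \<bullet> (((\<gamma> + 1 / \<gamma>) / 2) *\<^sub>R K1))"
      using assms(7) K1tr
      by (intro asymptotic_variance_block[where X="\<lambda>\<mu>. X \<mu> J0", OF assms(1,2,8) assms(3)[OF assms(8)] K1t _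
            block_equations_commuting[OF K1c assms(2)]]) simp
    then show ?thesis by (simp add: a_def)
  qed
  show ?thesis
  proof (intro exI[of _ V] conjI allI impI)
    fix J :: "real^'n^'n"
    assume J: "skew_symmetric J"
    obtain K0 S where K: "K = K0 + commutator J S" "commutator J K0 = 0"
      using commutator_decomposition[OF J] by blast
    show "((\<lambda>\<mu>. asymptotic_variance M (X \<mu> J) f) \<longlongrightarrow> V J) at_top"
      using lim[OF J K] V[OF J K] by simp
    \<comment> \<open>Commutators are traceless, so the kernel part always keeps the trace of
      \<open>K\<close>, and \<open>K1\<close> has the least norm for that trace.\<close>
    have "trace K = trace K0" using K(1) by (simp add: trace_add trace_commutator)
    then have "K1 \<bullet> K1 \<le> K0 \<bullet> K0"
      using trace_square_le[of K0] by (simp add: K1K1 pos_divide_le_eq mult.commute)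
    then show "asymptotic_variance M (X 0 J0) f1 \<le> V J"
      using a by (simp add: v1 V[OF J K])
  next
    \<comment> \<open>For \<open>K1\<close> to be the kernel part of \<open>K\<close>, the rest must
      be a commutator with some antisymmetric \<open>J\<close>; it is symmetric and
      traceless.\<close>
    have "transpose (K - K1) = K - K1" using assms(4) K1t by (simp add: transpose_def vec_eq_iff)
    moreover have "trace (K - K1) = 0" by (simp add: trace_sub K1tr)
    ultimately obtain J S where J: "skew_symmetric J" and S: "K - K1 = commutator J S"
      by (rule traceless_commutator)
    have "K = K1 + commutator J S" using S by (simp add: algebra_simps)
    then show "\<exists>J. skew_symmetric J \<and> V J = asymptotic_variance M (X 0 J0) f1"
      using V[OF J _ K1c] J v1 by auto
  qed
qed

end
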